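(* There exists a universal constant $c>0$ such that the following holds. Let $\beta>0$ and let $W\in L^1(\mathbb T^d)$ be even and centered, $\int_{\mathbb T^d}W=0$, with $W_-\in L^\infty(\mathbb T^d)$, and assume $$\beta\big(\|W\|_{L^1(\mathbb T^d)}+\|W_-\|_{L^\infty(\mathbb T^d)}\big)\le c.$$ Then the spatial Gibbs partition function $$\bar Z_{N,\beta}:=\int_{(\mathbb T^d)^N}\exp\Big(-\frac{\beta}{2N}\sum_{1\le i\neq j\le N}W(x_i-x_j)\Big)\,dx_1\ldots dx_N$$ satisfies the following estimates. (i) If $W\in L^2(\mathbb T^d)$, then for all $N\ge1$, $$1\le \bar Z_{N,\beta}\le \exp\big(C\beta^2\|W\|_{L^2(\mathbb T^d)}^2\big).$$ (ii) If $W\in L^{2,\infty}(\mathbb T^d)$, then for all $N\ge1$, $$1\le\bar Z_{N,\beta}\le CN^{C\beta^2\|W\|_{L^{2,\infty}(\mathbb T^d)}^2}.$$ (iii) If $W$ is the repulsive periodic Riesz kernel of order $0<s<d$, that is, $\widehat W(\xi)=|\xi|^{s-d}\mathbf 1_{\xi\ne0}$, then for all $N\ge1$, $$1\le\bar Z_{N,\beta}\le \begin{cases}C&\text{if } s<\frac d2,\\ CN^{C\beta^2}&\text{if } s=\frac d2,\\ C\exp\big(C\beta^{d/s}N^{2-d/s}\big)&\text{if } s>\frac d2.\end{cases}$$ Here the constants $C$ depend only on $d$ in (i)–(ii), and only on $d,s$ in (iii).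
   Context: $\mathbb T^d$ is the $d$-dimensional periodic torus ($d\ge1$), normalized to have unit volume. $W_-=\max(-W,0)$ is the negative part of $W$, $L^{2,\infty}$ is weak $L^2$, and $\widehat W(\xi)$ are the Fourier coefficients of $W$ on $\mathbb T^d$. *)

theory Defs
  imports "HOL-Probability.Probability"
begin

text \<open>
  The dimension is a natural number rather than an index type, so that it can be quantified
  inside formulas (the smallness constant has to be chosen before the dimension).
  A point of the torus is represented by its unique representative in the unit cube,
  an element of \<open>{..<d} \<rightarrow>\<^sub>E {0..<1}\<close>; consequently every real function of torus points is a
  function on the torus, with no periodicity condition.
\<close>

definition torus :: "nat \<Rightarrow> (nat \<Rightarrow> real) measure" where
  "torus d = PiM {..<d} (\<lambda>_. restrict_space lborel {0..<1})"

definition torus_diff :: "nat \<Rightarrow> (nat \<Rightarrow> real) \<Rightarrow> (nat \<Rightarrow> real) \<Rightarrow> (nat \<Rightarrow> real)" where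
  "torus_diff d x y = (\<lambda>k\<in>{..<d}. frac (x k - y k))"

definition torus_uminus :: "nat \<Rightarrow> (nat \<Rightarrow> real) \<Rightarrow> (nat \<Rightarrow> real)" where
  "torus_uminus d x = (\<lambda>k\<in>{..<d}. frac (- x k))"

text \<open>
  The real-valued norms below are meaningful only on the corresponding spaces, membership in
  which is expressed by \<open>integrable\<close> (for $L^1$), \<open>in_L2\<close>, \<open>in_Linf\<close> and \<open>in_weak_L2\<close>.
\<close>

definition L1_norm :: "'a measure \<Rightarrow> ('a \<Rightarrow> real) \<Rightarrow> real" where
  "L1_norm M f = (\<integral>x. \<bar>f x\<bar> \<partial>M)"

definition in_L2 :: "'a measure \<Rightarrow> ('a \<Rightarrow> real) \<Rightarrow> bool" where
  "in_L2 M f \<longleftrightarrow> f \<in> borel_measurable M \<and> integrable M (\<lambda>x. (f x)\<^sup>2)"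

definition L2_norm :: "'a measure \<Rightarrow> ('a \<Rightarrow> real) \<Rightarrow> real" where
  "L2_norm M f = sqrt (\<integral>x. (f x)\<^sup>2 \<partial>M)"

definition in_Linf :: "'a measure \<Rightarrow> ('a \<Rightarrow> real) \<Rightarrow> bool" where
  "in_Linf M f \<longleftrightarrow> f \<in> borel_measurable M \<and> esssup M (\<lambda>x. ereal \<bar>f x\<bar>) < \<infinity>"

definition Linf_norm :: "'a measure \<Rightarrow> ('a \<Rightarrow> real) \<Rightarrow> real" where
  "Linf_norm M f = real_of_ereal (esssup M (\<lambda>x. ereal \<bar>f x\<bar>))"

text \<open>
  The weak $L^2$ quasi-norm $\sup_{t>0} t\,\mu(|f|>t)^{1/2}$, with values in $[0,\infty]$.
  The measure is real-valued, so this is intended for finite measures.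
\<close>

definition weak_L2_enorm :: "'a measure \<Rightarrow> ('a \<Rightarrow> real) \<Rightarrow> ennreal" where
  "weak_L2_enorm M f =
     (SUP t\<in>{0<..}. ennreal (t * sqrt (measure M {x \<in> space M. \<bar>f x\<bar> > t})))"

definition in_weak_L2 :: "'a measure \<Rightarrow> ('a \<Rightarrow> real) \<Rightarrow> bool" where
  "in_weak_L2 M f \<longleftrightarrow> f \<in> borel_measurable M \<and> weak_L2_enorm M f < \<infinity>"

definition weak_L2_norm :: "'a measure \<Rightarrow> ('a \<Rightarrow> real) \<Rightarrow> real" where
  "weak_L2_norm M f = enn2real (weak_L2_enorm M f)"

definition neg_part :: "('a \<Rightarrow> real) \<Rightarrow> 'a \<Rightarrow> real" where
  "neg_part W = (\<lambda>x. max (- W x) 0)"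

text \<open>Evenness is required almost everywhere only, since $W$ stands for an $L^1$ class.\<close>

definition admissible_potential :: "nat \<Rightarrow> ((nat \<Rightarrow> real) \<Rightarrow> real) \<Rightarrow> bool" where
  "admissible_potential d W \<longleftrightarrow>
     integrable (torus d) W \<and>
     (AE x in torus d. W (torus_uminus d x) = W x) \<and>
     (\<integral>x. W x \<partial>torus d) = 0 \<and>
     in_Linf (torus d) (neg_part W)"

definition partition_function :: "nat \<Rightarrow> ((nat \<Rightarrow> real) \<Rightarrow> real) \<Rightarrow> nat \<Rightarrow> real \<Rightarrow> real" where
  "partition_function d W N \<beta> =
     (\<integral>x. exp (- (\<beta> / (2 * real N)) *
          (\<Sum>i\<in>{1..N}. \<Sum>j\<in>{1..N} - {i}. W (torus_diff d (x i) (x j))))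
      \<partial>PiM {1..N} (\<lambda>_. torus d))"

text \<open>
  Frequencies range over $\mathbb Z^d$, with characters $e^{2\pi i \xi\cdot x}$.  Only the
  values \<open>\<xi> k\<close> with \<open>k < d\<close> matter.  (Taking frequencies in $2\pi\mathbb Z^d$ instead multiplies
  the Riesz kernel below by the constant $(2\pi)^{s-d}$.)
\<close>

definition fourier_coeff :: "nat \<Rightarrow> ((nat \<Rightarrow> real) \<Rightarrow> real) \<Rightarrow> (nat \<Rightarrow> int) \<Rightarrow> complex" where
  "fourier_coeff d W \<xi> =
     (\<integral>x. complex_of_real (W x) * cis (- 2 * pi * (\<Sum>k<d. real_of_int (\<xi> k) * x k)) \<partial>torus d)"

definition freq_norm :: "nat \<Rightarrow> (nat \<Rightarrow> int) \<Rightarrow> real" where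
  "freq_norm d \<xi> = sqrt (\<Sum>k<d. (real_of_int (\<xi> k))\<^sup>2)"

definition is_riesz_kernel :: "nat \<Rightarrow> real \<Rightarrow> ((nat \<Rightarrow> real) \<Rightarrow> real) \<Rightarrow> bool" where
  "is_riesz_kernel d s W \<longleftrightarrow>
     integrable (torus d) W \<and>
     (\<forall>\<xi>. fourier_coeff d W \<xi> =
        (if \<forall>k<d. \<xi> k = 0 then 0 else complex_of_real (freq_norm d \<xi> powr (s - real d))))"

end

theory Submission
  imports Defs
begin

text \<open>
  Put $u = \beta W/N$ and write $e^{-u} = m(1+g)$ with $\int g = 0$.  Then $\bar Z$ is a power of $m$
  times the mean of $\prod_{i<j}(1+g(x_i-x_j))$, which is expanded into clusters.  Removing a root
  vertex from a connected cluster leaves blocks joined to the root, each carrying a factor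
  $\prod_{j}(1+g_{vj})-1$.  Bounding this factor to first order gives, by induction, $L^1$ bounds on the
  clusters of tree-graph type, governed by Catalan numbers; this uses the smallness of $N\|g\|_{L^1}$ and the
  one-sided bound on $g$ only.  In the mean of a cluster the first-order terms vanish by translation
  invariance, and the second-order terms contribute a factor $\|g\|_{L^2}^2$.  Summing over clusters yields
  $\bar Z \le \exp(C N^2 \int \min(u^2,|u|))$, from which all three cases follow by integrating the
  distribution function of $W$.

  For the Riesz kernel the required fact is that $W$ is in weak $L^{d/s}$.  The remainder of $W$ after
  subtraction of its low-frequency part is, up to a constant, a positive measure, so its $L^1$ norm
  can be read off from its total mass; interpolating between this and the sup norm of the low-frequency
  part gives the weak-type bound.
\<close>

section \<open>Cluster functions\<close>

text \<open>Where W is large compared with N / \<beta>, g is close to -1, so edges beyond a spanning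
  tree bring no smallness, and the connected graphs are too numerous to be bounded one by one. The
  factors that join a removed vertex to a block are therefore kept together as one product. A vertex
  meets fewer than N others, and 1 + g is at most exp(\<beta> L / N) with L the sup norm of the
  negative part of W, so every such product is at most exp(\<beta> L), and only one factor |g| per
  removed block has to be integrated. Dividing by m makes the cancellation of the first-order terms
  exact; the power of m split off is harmless because W has mean zero, so that m - 1 is itself of
  second order. These estimates hold on any homogeneous probability space and do not see the
  dimension, hence the universality of the smallness constant. The truncated square min(u^2, |u|)
  replaces u^2 because W need not be square integrable in (ii) and (iii); it suffices because
  exp(-u) is bounded.\<close>

definition pair_prod :: "(nat \<Rightarrow> nat \<Rightarrow> real) \<Rightarrow> nat set \<Rightarrow> real" where
  "pair_prod G V = (\<Prod>i\<in>V. \<Prod>j\<in>{j\<in>V. i < j}. 1 + G i j)"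

lemma pair_prod_empty [simp]: "pair_prod G {} = 1"
  by (simp add: pair_prod_def)

lemma pair_prod_insert:
  assumes sym: "\<And>i j. G i j = G j i" and "finite V" "v \<notin> V"
  shows "pair_prod G (insert v V) = (\<Prod>j\<in>V. 1 + G v j) * pair_prod G V"
proof -
  have *: "(\<Prod>j\<in>{j\<in>insert v V. i < j}. 1 + G i j)
      = (if i < v then 1 + G v i else 1) * (\<Prod>j\<in>{j\<in>V. i < j}. 1 + G i j)" if "i \<in> V" for i
  proof (cases "i < v")
    case True
    then have "{j\<in>insert v V. i < j} = insert v {j\<in>V. i < j}" by auto
    then show ?thesis using True assms(2,3) by (subst sym) simp
  next
    case False
    then have "{j\<in>insert v V. i < j} = {j\<in>V. i < j}" by auto
    then show ?thesis using False by simp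
  qed
  note assms(2,3)[simp]
  have "(\<Prod>j\<in>{j\<in>insert v V. v < j}. 1 + G v j) = (\<Prod>j\<in>V. if v < j then 1 + G v j else 1)"
    by (subst prod.inter_filter[symmetric]) (auto intro!: prod.cong)
  then have "pair_prod G (insert v V) = (\<Prod>j\<in>V. if v < j then 1 + G v j else 1)
      * (\<Prod>i\<in>V. (if i < v then 1 + G v i else 1) * (\<Prod>j\<in>{j\<in>V. i < j}. 1 + G i j))"
    unfolding pair_prod_def using * by simp
  also have "\<dots> = (\<Prod>j\<in>V. (if v < j then 1 + G v j else 1) * (if j < v then 1 + G v j else 1))
      * pair_prod G V"
    by (simp add: prod.distrib pair_prod_def)
  also have "(\<Prod>j\<in>V. (if v < j then 1 + G v j else 1) * (if j < v then 1 + G v j else 1))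
      = (\<Prod>j\<in>V. 1 + G v j)"
    using assms(3) by (intro prod.cong) (auto simp: neq_iff)
  finally show ?thesis .
qed

text \<open>
  This is the sum, over the connected graphs on $V$, of the products of the weights $G$ along
  the edges (the Ursell function): the recursion peels off the component of the least vertex.
\<close>

function cluster :: "(nat \<Rightarrow> nat \<Rightarrow> real) \<Rightarrow> nat set \<Rightarrow> real" where
  "cluster G V = (if finite V then
     pair_prod G V - (\<Sum>B\<in>{B. B \<subset> V \<and> Min V \<in> B}. cluster G B * pair_prod G (V - B)) else 0)"
  by auto
termination
  by (relation "Wellfounded.measure (\<lambda>(G, V). card V)") (auto simp: psubset_card_mono)

declare cluster.simps [simp del]

lemma finite_subsets_Collect [simp]:
  assumes "finite V"
  shows "finite {B. B \<subseteq> V \<and> R B}" "finite {B. B \<subset> V \<and> R B}"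
  by (rule finite_subset[of _ "Pow V"]; use assms in auto)+

lemma sum_rooted_swap:
  fixes f :: "nat set \<Rightarrow> nat set \<Rightarrow> real"
  assumes "finite V"
  shows "(\<Sum>B\<in>{B. B \<subseteq> V \<and> P B}. \<Sum>C\<in>{C. C \<subseteq> V - B \<and> Q C}. f B C)
       = (\<Sum>C\<in>{C. C \<subseteq> V \<and> Q C}. \<Sum>B\<in>{B. B \<subseteq> V - C \<and> P B}. f B C)"
  using assms by (subst (1 2) sum.Sigma)
    (auto intro!: sum.reindex_bij_witness[of _ prod.swap prod.swap])

lemma sum_rooted_nested:
  fixes f :: "nat set \<Rightarrow> nat set \<Rightarrow> real"
  assumes "finite V"
  shows "(\<Sum>A\<in>{A. A \<subseteq> V \<and> w \<in> A}. \<Sum>B\<in>{B. B \<subseteq> A \<and> w \<in> B}. f B (A - B))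
       = (\<Sum>B\<in>{B. B \<subseteq> V \<and> w \<in> B}. \<Sum>C\<in>{C. C \<subseteq> V - B}. f B C)"
  using assms finite_subset[OF _ assms] by (subst (1 2) sum.Sigma)
    (auto intro!: sum.reindex_bij_witness[of _ "\<lambda>(B, C). (B \<union> C, B)" "\<lambda>(A, B). (B, A - B)"])

lemma pair_prod_root_Min:
  assumes "finite V" "V \<noteq> {}"
  shows "pair_prod G V = (\<Sum>B\<in>{B. B \<subseteq> V \<and> Min V \<in> B}. cluster G B * pair_prod G (V - B))"
proof -
  have "{B. B \<subseteq> V \<and> Min V \<in> B} = insert V {B. B \<subset> V \<and> Min V \<in> B}"
    using Min_in[OF assms] by auto
  then show ?thesis
    using assms by (simp add: cluster.simps[of G V])
qed

text \<open>The recursion that defines \<open>cluster\<close> is tied to \<open>Min V\<close>; this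
  frees the choice of root. Among the blocks around the minimum m, those that miss v leave a
  remainder that is expanded around v by induction. The resulting sum over pairs of disjoint blocks
  is symmetric, so it can be resummed with the block of v taken first.\<close>

lemma pair_prod_root:
  assumes "finite V" "v \<in> V"
  shows "pair_prod G V = (\<Sum>B\<in>{B. B \<subseteq> V \<and> v \<in> B}. cluster G B * pair_prod G (V - B))"
  using assms
proof (induction "card V" arbitrary: V v rule: less_induct)
  case less
  define m where "m = Min V"
  let ?\<Phi> = "cluster G" and ?\<psi> = "pair_prod G"
  have ne: "V \<noteq> {}" using less.prems by auto
  have comm: "V - B - C = V - C - B" for B C :: "nat set" by blast
  have m: "m \<in> V" unfolding m_def by (rule Min_in[OF less.prems(1) ne])
  show ?case
  proof (cases "v = m")
    case True
    with pair_prod_root_Min[OF less.prems(1) ne] show ?thesis by (simp add: m_def)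
  next
    case False
    have IH: "?\<psi> (V - B) = (\<Sum>C\<in>{C. C \<subseteq> V - B \<and> u \<in> C}. ?\<Phi> C * ?\<psi> (V - B - C))"
      if "B \<subseteq> V" "B \<noteq> {}" "u \<in> V" "u \<notin> B" for B u
      using that less.prems by (intro less.hyps) (auto intro!: psubset_card_mono)
    have split: "(\<Sum>B\<in>{B. B \<subseteq> V \<and> u \<in> B}. h B) = (\<Sum>B\<in>{B. B \<subseteq> V \<and> u \<in> B \<and> w \<in> B}. h B)
        + (\<Sum>B\<in>{B. B \<subseteq> V \<and> u \<in> B \<and> w \<notin> B}. h B)" for h :: "nat set \<Rightarrow> real" and u w
      using less.prems(1) by (subst sum.union_disjoint[symmetric]) (auto intro!: sum.cong)
    have "?\<psi> V = (\<Sum>B\<in>{B. B \<subseteq> V \<and> m \<in> B}. ?\<Phi> B * ?\<psi> (V - B))"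
      using pair_prod_root_Min[OF less.prems(1) ne] by (simp add: m_def)
    also have "\<dots> = (\<Sum>B\<in>{B. B \<subseteq> V \<and> m \<in> B \<and> v \<in> B}. ?\<Phi> B * ?\<psi> (V - B))
       + (\<Sum>B\<in>{B. B \<subseteq> V \<and> m \<in> B \<and> v \<notin> B}. ?\<Phi> B * ?\<psi> (V - B))"
      by (rule split)
    also have "(\<Sum>B\<in>{B. B \<subseteq> V \<and> m \<in> B \<and> v \<notin> B}. ?\<Phi> B * ?\<psi> (V - B))
       = (\<Sum>B\<in>{B. B \<subseteq> V \<and> m \<in> B \<and> v \<notin> B}. \<Sum>C\<in>{C. C \<subseteq> V - B \<and> v \<in> C}.
            ?\<Phi> B * ?\<Phi> C * ?\<psi> (V - B - C))"
      using less.prems by (intro sum.cong refl, subst IH[where u = v])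
        (auto simp: sum_distrib_left algebra_simps)
    also have "\<dots> = (\<Sum>B\<in>{B. B \<subseteq> V \<and> m \<in> B \<and> v \<notin> B}. \<Sum>C\<in>{C. C \<subseteq> V - B \<and> v \<in> C \<and> m \<notin> C}.
            ?\<Phi> B * ?\<Phi> C * ?\<psi> (V - B - C))"
      by (intro sum.cong refl) auto
    also have "\<dots> = (\<Sum>C\<in>{C. C \<subseteq> V \<and> v \<in> C \<and> m \<notin> C}. \<Sum>B\<in>{B. B \<subseteq> V - C \<and> m \<in> B \<and> v \<notin> B}.
            ?\<Phi> B * ?\<Phi> C * ?\<psi> (V - B - C))"
      by (rule sum_rooted_swap) (use less.prems in auto)
    also have "\<dots> = (\<Sum>C\<in>{C. C \<subseteq> V \<and> v \<in> C \<and> m \<notin> C}. \<Sum>B\<in>{B. B \<subseteq> V - C \<and> m \<in> B}.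
            ?\<Phi> B * ?\<Phi> C * ?\<psi> (V - C - B))"
      by (intro sum.cong refl) (auto simp: comm)
    also have "\<dots> = (\<Sum>C\<in>{C. C \<subseteq> V \<and> v \<in> C \<and> m \<notin> C}. ?\<Phi> C * ?\<psi> (V - C))"
      using m by (intro sum.cong refl, subst IH[where u = m])
        (auto simp: sum_distrib_left algebra_simps)
    also have "{B. B \<subseteq> V \<and> m \<in> B \<and> v \<in> B} = {B. B \<subseteq> V \<and> v \<in> B \<and> m \<in> B}" by auto
    finally show ?thesis by (simp only: split[where u = v and w = m])
  qed
qed

lemma cluster_singleton [simp]: "cluster G {v} = 1"
proof -
  have "{B. B \<subseteq> {v} \<and> v \<in> B} = {{v}}" by auto
  moreover have "pair_prod G {v} = 1" by (auto simp: pair_prod_def intro!: prod.neutral)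
  ultimately show ?thesis using pair_prod_root[of "{v}" v G] by simp
qed

text \<open>In graph terms, B is the component of w after v has been deleted from a connected graph:
  at least one edge must join B to v, which gives the product minus 1, and the rest stays connected
  through v. The proof avoids graphs: it compares two expansions of the pair product on
  \<open>insert v V\<close> and inverts a convolution with \<open>\<psi>\<close> by
  induction.\<close>

lemma cluster_remove_root:
  assumes sym: "\<And>i j. G i j = G j i" and "finite V" "v \<notin> V" "w \<in> V"
  shows "cluster G (insert v V) = (\<Sum>B\<in>{B. B \<subseteq> V \<and> w \<in> B}.
    ((\<Prod>j\<in>B. 1 + G v j) - 1) * cluster G B * cluster G (insert v (V - B)))"
  using assms(2-)
proof (induction "card V" arbitrary: V rule: less_induct)
  case less
  let ?\<Phi> = "cluster G" and ?\<psi> = "pair_prod G"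
  define h where "h B = (\<Prod>j\<in>B. 1 + G v j)" for B
  define X where "X B = ?\<Phi> (insert v B)" for B
  define Y where "Y A = (\<Sum>B\<in>{B. B \<subseteq> A \<and> w \<in> B}. (h B - 1) * ?\<Phi> B * X (A - B))" for A
  have comm: "V - B - C = V - C - B" for B C :: "nat set" by blast
  have Diff_Un_eq: "V - (B \<union> C) = V - B - C" for B C :: "nat set" by blast
  have hmul: "h V = h B * h (V - B)" if "B \<subseteq> V" for B
    unfolding h_def using that less.prems(1) by (metis prod.subset_diff mult.commute)
  have vroot: "h A * ?\<psi> A = (\<Sum>C\<in>{C. C \<subseteq> A}. X C * ?\<psi> (A - C))" if "A \<subseteq> V" for A
  proof -
    have A: "finite A" "v \<notin> A" using that less.prems finite_subset by auto
    have "h A * ?\<psi> A = ?\<psi> (insert v A)"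
      unfolding h_def by (rule pair_prod_insert[OF sym A, symmetric])
    also have "\<dots> = (\<Sum>B\<in>{B. B \<subseteq> insert v A \<and> v \<in> B}. ?\<Phi> B * ?\<psi> (insert v A - B))"
      using A by (intro pair_prod_root) auto
    also have "\<dots> = (\<Sum>C\<in>{C. C \<subseteq> A}. ?\<Phi> (insert v C) * ?\<psi> (A - C))"
      using A by (intro sum.reindex_bij_witness[of _ "insert v" "\<lambda>B. B - {v}"])
        (auto simp: insert_absorb insert_Diff_if intro!: arg_cong2[where f = "(*)"] arg_cong[where f = ?\<psi>])
    finally show ?thesis by (simp add: X_def)
  qed
  have IH: "X A = Y A" if "A \<subset> V" "w \<in> A" for A
    using that less.prems psubset_card_mono[of V A] finite_subset[of A V]
    unfolding X_def Y_def h_def by (intro less.hyps) auto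
  \<comment> \<open>\<open>h V * \<psi> V\<close> is the pair product with v adjoined. Here it is
    expanded around w inside V and then around v; afterwards it is expanded around v alone, with the
    blocks sorted by whether they contain w. The blocks without w reproduce the first expansion with
    the factor \<open>h B\<close> missing, and the difference is \<open>h B - 1\<close>.\<close>
  have "h V * ?\<psi> V = (\<Sum>B\<in>{B. B \<subseteq> V \<and> w \<in> B}. h B * ?\<Phi> B * (h (V - B) * ?\<psi> (V - B)))"
    by (subst pair_prod_root[of V w]) (use less.prems in \<open>auto simp: sum_distrib_left hmul intro!: sum.cong\<close>)
  also have "\<dots> = (\<Sum>B\<in>{B. B \<subseteq> V \<and> w \<in> B}. \<Sum>C\<in>{C. C \<subseteq> V - B}. h B * ?\<Phi> B * (X C * ?\<psi> (V - B - C)))"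
    by (intro sum.cong refl, subst vroot) (auto simp: sum_distrib_left)
  finally have L: "h V * ?\<psi> V = \<dots>" .
  have "h V * ?\<psi> V = (\<Sum>A\<in>{A. A \<subseteq> V \<and> w \<in> A}. X A * ?\<psi> (V - A))
      + (\<Sum>A\<in>{A. A \<subseteq> V \<and> w \<notin> A}. X A * ?\<psi> (V - A))"
    using less.prems(1) by (subst vroot[OF order_refl], subst sum.union_disjoint[symmetric]) (auto intro!: sum.cong)
  also have "(\<Sum>A\<in>{A. A \<subseteq> V \<and> w \<notin> A}. X A * ?\<psi> (V - A))
      = (\<Sum>A\<in>{A. A \<subseteq> V \<and> w \<notin> A}. \<Sum>B\<in>{B. B \<subseteq> V - A \<and> w \<in> B}. ?\<Phi> B * (X A * ?\<psi> (V - B - A)))"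
    using less.prems by (intro sum.cong refl, subst pair_prod_root[of _ w])
      (auto simp: sum_distrib_left mult_ac comm)
  also have "\<dots> = (\<Sum>B\<in>{B. B \<subseteq> V \<and> w \<in> B}. \<Sum>A\<in>{A. A \<subseteq> V - B \<and> w \<notin> A}. ?\<Phi> B * (X A * ?\<psi> (V - B - A)))"
    by (rule sum_rooted_swap[symmetric]) (use less.prems in auto)
  also have "\<dots> = (\<Sum>B\<in>{B. B \<subseteq> V \<and> w \<in> B}. \<Sum>A\<in>{A. A \<subseteq> V - B}. ?\<Phi> B * (X A * ?\<psi> (V - B - A)))"
    by (intro sum.cong refl) auto
  finally have "(\<Sum>A\<in>{A. A \<subseteq> V \<and> w \<in> A}. X A * ?\<psi> (V - A))
      = (\<Sum>B\<in>{B. B \<subseteq> V \<and> w \<in> B}. \<Sum>C\<in>{C. C \<subseteq> V - B}. (h B - 1) * ?\<Phi> B * (X C * ?\<psi> (V - B - C)))"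
    using L by (simp add: algebra_simps sum_subtractf)
  also have "\<dots> = (\<Sum>B\<in>{B. B \<subseteq> V \<and> w \<in> B}. \<Sum>C\<in>{C. C \<subseteq> V - B}. (h B - 1) * ?\<Phi> B * (X C * ?\<psi> (V - (B \<union> C))))"
    by (simp only: Diff_Un_eq)
  also have "\<dots> = (\<Sum>A\<in>{A. A \<subseteq> V \<and> w \<in> A}. \<Sum>B\<in>{B. B \<subseteq> A \<and> w \<in> B}.
      (h B - 1) * ?\<Phi> B * (X (A - B) * ?\<psi> (V - (B \<union> (A - B)))))"
    by (rule sum_rooted_nested[symmetric]) (use less.prems in auto)
  also have "\<dots> = (\<Sum>A\<in>{A. A \<subseteq> V \<and> w \<in> A}. Y A * ?\<psi> (V - A))"
    unfolding Y_def sum_distrib_right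
    by (intro sum.cong refl) (auto simp: Un_absorb1 mult_ac)
  finally have eq: "(\<Sum>A\<in>{A. A \<subseteq> V \<and> w \<in> A}. X A * ?\<psi> (V - A)) = (\<Sum>A\<in>{A. A \<subseteq> V \<and> w \<in> A}. Y A * ?\<psi> (V - A))" .
  have ins: "{A. A \<subseteq> V \<and> w \<in> A} = insert V {A. A \<subset> V \<and> w \<in> A}" using less.prems by auto
  have "(\<Sum>A\<in>{A. A \<subset> V \<and> w \<in> A}. X A * ?\<psi> (V - A)) = (\<Sum>A\<in>{A. A \<subset> V \<and> w \<in> A}. Y A * ?\<psi> (V - A))"
    by (intro sum.cong refl) (auto simp: IH)
  \<comment> \<open>The terms with A a proper subset cancel by induction, and the term A = V carries
    the factor \<open>\<psi> {} = 1\<close>.\<close>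
  with eq have "X V = Y V" unfolding ins using less.prems(1) by simp
  then show ?case by (simp add: X_def Y_def h_def)
qed

lemma cluster_cong:
  assumes "\<And>i j. i \<in> V \<Longrightarrow> j \<in> V \<Longrightarrow> G i j = G' i j"
  shows "cluster G V = cluster G' V"
  using assms
proof (induction "card V" arbitrary: V rule: less_induct)
  case less
  have pp: "pair_prod G A = pair_prod G' A" if "A \<subseteq> V" for A
    unfolding pair_prod_def using that less.prems by (intro prod.cong refl) auto
  show ?case
  proof (cases "finite V")
    case True
    have "cluster G B = cluster G' B" if "B \<subset> V" for B
      using that True by (intro less.hyps less.prems) (auto simp: psubset_card_mono)
    then show ?thesis
      using True by (subst (1 2) cluster.simps)
        (auto simp: pp intro!: sum.cong)
  qed (simp add: cluster.simps)
qed

section \<open>Counting rooted blocks, product estimates, Catalan numbers\<close>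

lemma sum_Pow_card:
  fixes f :: "nat \<Rightarrow> real"
  assumes "finite S"
  shows "(\<Sum>B\<in>Pow S. f (card B)) = (\<Sum>k\<le>card S. real (card S choose k) * f k)"
proof -
  have "(\<Sum>B\<in>Pow S. f (card B)) = (\<Sum>k\<le>card S. \<Sum>B\<in>{B\<in>Pow S. card B = k}. f (card B))"
    using assms by (intro sum.group[symmetric]) (auto intro: card_mono)
  also have "\<dots> = (\<Sum>k\<le>card S. real (card S choose k) * f k)"
    using assms n_subsets[OF assms] by (intro sum.cong refl) (auto simp: Pow_def)
  finally show ?thesis .
qed

lemma sum_rooted_card:
  fixes f :: "nat \<Rightarrow> real"
  assumes "finite V" "w \<in> V" "card V = Suc n"
  shows "(\<Sum>B\<in>{B. B \<subseteq> V \<and> w \<in> B}. f (card B)) = (\<Sum>k\<le>n. real (n choose k) * f (Suc k))"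
proof -
  have "(\<Sum>B\<in>{B. B \<subseteq> V \<and> w \<in> B}. f (card B)) = (\<Sum>B\<in>Pow (V - {w}). f (Suc (card B)))"
    using assms
    by (intro sum.reindex_bij_witness[of _ "insert w" "\<lambda>B. B - {w}"])
      (auto simp: insert_absorb card_Suc_Diff1[OF finite_subset] simp del: card_Diff_singleton card_Diff_insert card_Diff_singleton_if)
  also have "\<dots> = (\<Sum>k\<le>n. real (n choose k) * f (Suc k))"
    using sum_Pow_card[of "V - {w}" "\<lambda>k. f (Suc k)"] assms by simp
  finally show ?thesis .
qed

text \<open>Telescoping: a new factor changes the product by u i times a product over a smaller set.
  This is why E has to dominate all subproducts; in return the bound is linear in |u|, where a full
  expansion would leave products of several |u j|.\<close>

lemma prod_minus_1_bound:
  fixes u :: "'b \<Rightarrow> real"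
  assumes "finite S" "\<And>j. j \<in> S \<Longrightarrow> -1 \<le> u j" "\<And>S'. S' \<subseteq> S \<Longrightarrow> (\<Prod>j\<in>S'. 1 + u j) \<le> E"
  shows "\<bar>(\<Prod>j\<in>S. 1 + u j) - 1\<bar> \<le> E * (\<Sum>j\<in>S. \<bar>u j\<bar>)"
  using assms
proof (induction S rule: finite_induct)
  case (insert i S)
  have le: "\<bar>(\<Prod>j\<in>S. 1 + u j) - 1\<bar> \<le> E * (\<Sum>j\<in>S. \<bar>u j\<bar>)"
    using insert.prems by (intro insert.IH) (auto intro: insert.prems(2))
  have 0: "(\<Prod>j\<in>S. 1 + u j) \<ge> 0"
    using insert.prems(1) by (intro prod_nonneg) (smt (verit) insertCI)
  have "\<bar>(\<Prod>j\<in>insert i S. 1 + u j) - 1\<bar> = \<bar>((\<Prod>j\<in>S. 1 + u j) - 1) + u i * (\<Prod>j\<in>S. 1 + u j)\<bar>"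
    using insert.hyps by (simp add: algebra_simps)
  also have "\<dots> \<le> E * (\<Sum>j\<in>S. \<bar>u j\<bar>) + \<bar>u i\<bar> * E"
    using le 0 insert.prems(2)[of S]
    by (intro order_trans[OF abs_triangle_ineq] add_mono) (auto simp: abs_mult intro!: mult_mono)
  finally show ?case using insert.hyps by (simp add: algebra_simps)
qed simp

text \<open>The same telescoping one order higher: the increment is now u i times a product minus 1,
  which the linear bound controls. The full square, diagonal included, is the form to which
  Cauchy-Schwarz applies later.\<close>

lemma prod_minus_linear_bound:
  fixes u :: "'b \<Rightarrow> real"
  assumes "finite S" "\<And>j. j \<in> S \<Longrightarrow> -1 \<le> u j" "\<And>S'. S' \<subseteq> S \<Longrightarrow> (\<Prod>j\<in>S'. 1 + u j) \<le> E"
  shows "\<bar>(\<Prod>j\<in>S. 1 + u j) - 1 - (\<Sum>j\<in>S. u j)\<bar> \<le> E * (\<Sum>j\<in>S. \<bar>u j\<bar>)\<^sup>2"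
  using assms
proof (induction S rule: finite_induct)
  case (insert i S)
  have E: "E \<ge> 0" using insert.prems(2)[of "{}"] by simp
  have le: "\<bar>(\<Prod>j\<in>S. 1 + u j) - 1 - (\<Sum>j\<in>S. u j)\<bar> \<le> E * (\<Sum>j\<in>S. \<bar>u j\<bar>)\<^sup>2"
    using insert.prems by (intro insert.IH) (auto intro: insert.prems(2))
  have le2: "\<bar>(\<Prod>j\<in>S. 1 + u j) - 1\<bar> \<le> E * (\<Sum>j\<in>S. \<bar>u j\<bar>)"
    using insert.prems insert.hyps by (intro prod_minus_1_bound) (auto intro: insert.prems(2))
  let ?s = "\<Sum>j\<in>S. \<bar>u j\<bar>"
  have s: "?s \<ge> 0" by (simp add: sum_nonneg)
  have "\<bar>(\<Prod>j\<in>insert i S. 1 + u j) - 1 - (\<Sum>j\<in>insert i S. u j)\<bar>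
      = \<bar>((\<Prod>j\<in>S. 1 + u j) - 1 - (\<Sum>j\<in>S. u j)) + u i * ((\<Prod>j\<in>S. 1 + u j) - 1)\<bar>"
    using insert.hyps by (simp add: algebra_simps)
  also have "\<dots> \<le> E * ?s\<^sup>2 + \<bar>u i\<bar> * (E * ?s)"
    using le le2
    by (intro order_trans[OF abs_triangle_ineq] add_mono) (auto simp: abs_mult intro!: mult_mono)
  also have "\<dots> = E * (?s\<^sup>2 + \<bar>u i\<bar> * ?s)" by (simp add: algebra_simps)
  also have "\<dots> \<le> E * (\<bar>u i\<bar> + ?s)\<^sup>2"
    using E s by (intro mult_left_mono) (auto simp: power2_eq_square algebra_simps)
  finally show ?case using insert.hyps by simp
qed simp

fun catalan :: "nat \<Rightarrow> real" where
  "catalan n = (if n = 0 then 1 else (\<Sum>k<n. catalan k * catalan (n - 1 - k)))"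

declare catalan.simps [simp del]

lemma catalan_0 [simp]: "catalan 0 = 1"
  by (simp add: catalan.simps)

lemma catalan_Suc: "catalan (Suc n) = (\<Sum>k\<le>n. catalan k * catalan (n - k))"
  by (subst catalan.simps) (simp add: lessThan_Suc_atMost)

lemma catalan_nonneg: "catalan n \<ge> 0"
proof (induction n rule: less_induct)
  case (less n)
  then show ?case
    by (subst catalan.simps) (auto intro!: sum_nonneg mult_nonneg_nonneg)
qed

text \<open>The factor 1/4 is the radius of convergence of the generating function. Since a
  truncated Cauchy product is at most the product of the truncations, the partial sums satisfy
  s_(n+1) \<le> 1 + s_n^2 / 4, and 2 is the fixed point of the right-hand side. The growth rate 4^n
  follows without a closed formula.\<close>

lemma catalan_partial_sums: "(\<Sum>i\<le>n. catalan i / 4 ^ i) \<le> 2"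
proof (induction n)
  case (Suc n)
  let ?c = "\<lambda>i. catalan i / 4 ^ i"
  have fin: "finite {(k, i). k + i \<le> n}"
    by (rule finite_subset[of _ "{..n} \<times> {..n}"]) auto
  have "(\<Sum>i\<le>Suc n. ?c i) = 1 + (\<Sum>i\<le>n. ?c (Suc i))"
    by (subst sum.atMost_Suc_shift) simp
  also have "(\<Sum>i\<le>n. ?c (Suc i)) = (\<Sum>i\<le>n. \<Sum>k\<le>i. ?c k * ?c (i - k)) / 4"
    by (auto simp: catalan_Suc sum_divide_distrib power_add[symmetric] intro!: sum.cong)
  also have "(\<Sum>i\<le>n. \<Sum>k\<le>i. ?c k * ?c (i - k)) = (\<Sum>(k, i)\<in>{(k, i). k + i \<le> n}. ?c k * ?c i)"
    by (subst sum.Sigma) (auto intro!: sum.reindex_bij_witness[of _ "\<lambda>(k, i). (k + i, k)" "\<lambda>(i, k). (k, i - k)"])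
  also have "\<dots> \<le> (\<Sum>(k, i)\<in>{..n} \<times> {..n}. ?c k * ?c i)"
    by (intro sum_mono2) (auto intro!: divide_nonneg_nonneg mult_nonneg_nonneg catalan_nonneg)
  also have "\<dots> = (\<Sum>i\<le>n. ?c i) * (\<Sum>i\<le>n. ?c i)"
    by (simp add: sum_product sum.cartesian_product)
  also have "\<dots> \<le> 2 * 2"
    using Suc by (intro mult_mono) (auto intro!: sum_nonneg divide_nonneg_nonneg catalan_nonneg)
  finally show ?case by simp
qed simp

lemma catalan_le: "catalan n \<le> 2 * 4 ^ n"
proof -
  have "catalan n / 4 ^ n \<le> (\<Sum>i\<le>n. catalan i / 4 ^ i)"
    by (intro member_le_sum) (auto intro!: divide_nonneg_nonneg catalan_nonneg)
  with catalan_partial_sums[of n] have "catalan n / 4 ^ n \<le> 2" by linarith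
  then show ?thesis by (simp add: field_simps)
qed

section \<open>Cluster expansion of a homogeneous mean-field gas\<close>

text \<open>
  Only an upper bound of order $1/N$ is imposed on $g$, which may come close to $-1$: \<open>E\<close>
  bounds every product of at most $N$ factors $1+g$, and this is all the stability that is needed.
\<close>

locale homogeneous_gas = prob_space M for M :: "'a measure" +
  fixes g :: "'a \<Rightarrow> 'a \<Rightarrow> real" and N :: nat and \<kappa> E \<delta> a :: real
  assumes g_measurable [measurable]: "case_prod g \<in> borel_measurable (M \<Otimes>\<^sub>M M)"
    and g_sym: "g x y = g y x"
    and g_ge: "-1 \<le> g x y"
    and g_le: "g x y \<le> \<kappa>"
    and kappa: "0 \<le> \<kappa>" "(1 + \<kappa>) ^ N \<le> E"
    and g_mean: "x \<in> space M \<Longrightarrow> (\<integral>y. g x y \<partial>M) = 0"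
    and g_L1: "x \<in> space M \<Longrightarrow> (\<integral>y. \<bar>g x y\<bar> \<partial>M) \<le> \<delta>"
    and g_L2: "x \<in> space M \<Longrightarrow> (\<integral>y. (g x y)\<^sup>2 \<partial>M) \<le> a"
    and homogeneous: "x \<in> space M \<Longrightarrow> y \<in> space M \<Longrightarrow> \<exists>\<tau>\<in>measurable M M. distr M M \<tau> = M \<and> \<tau> x = y \<and>
      (\<forall>u\<in>space M. \<forall>v\<in>space M. g (\<tau> u) (\<tau> v) = g u v)"
begin

section \<open>Integration of cluster functions and absolute bounds\<close>

abbreviation P :: "nat set \<Rightarrow> (nat \<Rightarrow> 'a) measure" where
  "P I \<equiv> PiM I (\<lambda>_. M)"

abbreviation \<psi> :: "(nat \<Rightarrow> 'a) \<Rightarrow> nat set \<Rightarrow> real" where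
  "\<psi> x \<equiv> pair_prod (\<lambda>i j. g (x i) (x j))"

abbreviation \<Phi> :: "(nat \<Rightarrow> 'a) \<Rightarrow> nat set \<Rightarrow> real" where
  "\<Phi> x \<equiv> cluster (\<lambda>i j. g (x i) (x j))"

sublocale PM: product_prob_space "\<lambda>_::nat. M" UNIV
  by unfold_locales

lemma prob_space_P: "prob_space (P I)"
  by (intro prob_space_PiM) unfold_locales

lemma integrable_P:
  fixes f :: "(nat \<Rightarrow> 'a) \<Rightarrow> real"
  assumes "f \<in> borel_measurable (P I)" "\<And>x. \<bar>f x\<bar> \<le> K"
  shows "integrable (P I) f"
proof -
  interpret I: prob_space "P I" by (rule prob_space_P)
  show ?thesis using assms by (intro I.integrable_const_bound[of _ K]) auto
qed

lemma integrable_M: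
  fixes f :: "'a \<Rightarrow> real"
  assumes "f \<in> borel_measurable M" "\<And>x. \<bar>f x\<bar> \<le> K"
  shows "integrable M f"
  using assms by (intro integrable_const_bound[of _ K]) auto

lemma g_measurable' [measurable (raw)]:
  assumes "f \<in> measurable L M" "h \<in> measurable L M"
  shows "(\<lambda>x. g (f x) (h x)) \<in> borel_measurable L"
  using measurable_compose[OF measurable_Pair[OF assms] g_measurable] by simp

lemma g_bounded: "\<bar>g x y\<bar> \<le> 1 + \<kappa>"
  using g_ge[of x y] g_le[of x y] kappa by auto

lemma prod_le_E:
  assumes "finite S" "card S \<le> N"
  shows "(\<Prod>j\<in>S. 1 + g b (x j)) \<le> E"
proof -
  have "(\<Prod>j\<in>S. 1 + g b (x j)) \<le> (\<Prod>j\<in>S. 1 + \<kappa>)"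
    using g_ge g_le by (intro prod_mono) (smt (verit))
  also have "\<dots> \<le> (1 + \<kappa>) ^ N"
    using assms kappa by (simp add: power_increasing)
  finally show ?thesis using kappa by simp
qed

lemma E_ge_1: "1 \<le> E"
  using prod_le_E[of "{}"] by simp

lemma E_nonneg: "0 \<le> E"
  using E_ge_1 by simp

lemma delta_nonneg: "0 \<le> \<delta>"
proof -
  obtain x where "x \<in> space M" using not_empty by auto
  from g_L1[OF this] show ?thesis
    by (rule order_trans[rotated]) auto
qed

lemma a_nonneg: "0 \<le> a"
proof -
  obtain x where "x \<in> space M" using not_empty by auto
  from g_L2[OF this] show ?thesis
    by (rule order_trans[rotated]) auto
qed

lemma pair_prod_measurable [measurable]:
  assumes "V \<subseteq> I"
  shows "(\<lambda>x. \<psi> x V) \<in> borel_measurable (P I)"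
  unfolding pair_prod_def
proof (intro borel_measurable_prod borel_measurable_add borel_measurable_const)
  fix i j assume "i \<in> V" "j \<in> {j \<in> V. i < j}"
  then have [measurable]: "(\<lambda>x. x i) \<in> measurable (P I) M" "(\<lambda>x. x j) \<in> measurable (P I) M"
    using assms by (auto intro!: measurable_component_singleton)
  show "(\<lambda>x. g (x i) (x j)) \<in> borel_measurable (P I)" by measurable
qed

lemma pair_prod_bounded: "\<exists>K. \<forall>x. \<bar>\<psi> x V\<bar> \<le> K"
proof (intro exI allI)
  fix x
  show "\<bar>\<psi> x V\<bar> \<le> (\<Prod>i\<in>V. \<Prod>j\<in>{j\<in>V. i < j}. 1 + \<kappa>)"
    unfolding pair_prod_def abs_prod
    using g_ge g_le by (intro prod_mono conjI prod_nonneg) (auto, smt (verit))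
qed

lemma pair_prod_nonneg: "0 \<le> \<psi> x V"
  unfolding pair_prod_def using g_ge by (intro prod_nonneg ballI) (smt (verit))

lemma cluster_regular:
  assumes "finite V"
  shows "(\<forall>I. V \<subseteq> I \<longrightarrow> (\<lambda>x. \<Phi> x V) \<in> borel_measurable (P I)) \<and> (\<exists>K. \<forall>x. \<bar>\<Phi> x V\<bar> \<le> K)"
  using assms
proof (induction rule: finite_psubset_induct)
  case (psubset V)
  let ?S = "{B. B \<subset> V \<and> Min V \<in> B}"
  have eq: "\<Phi> x V = \<psi> x V - (\<Sum>B\<in>?S. \<Phi> x B * \<psi> x (V - B))" for x
    using psubset.hyps by (simp add: cluster.simps[of _ V])
  have "\<forall>B\<in>?S. \<exists>K. \<forall>x. \<bar>\<Phi> x B\<bar> \<le> K" using psubset.IH by auto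
  then obtain K where K: "\<And>B x. B \<in> ?S \<Longrightarrow> \<bar>\<Phi> x B\<bar> \<le> K B" by metis
  obtain L where L: "\<And>B x. \<bar>\<psi> x B\<bar> \<le> L B" using pair_prod_bounded by metis
  have L0: "L B \<ge> 0" for B using L[of undefined B] by linarith
  have K0: "K B \<ge> 0" if "B \<in> ?S" for B using K[OF that, of undefined] by linarith
  have "\<bar>\<Phi> x V\<bar> \<le> L V + (\<Sum>B\<in>?S. K B * L (V - B))" for x
    unfolding eq
    by (intro order_trans[OF abs_triangle_ineq4] add_mono L order_trans[OF sum_abs] sum_mono)
      (auto simp: abs_mult intro!: mult_mono K L K0)
  moreover have "(\<lambda>x. \<Phi> x V) \<in> borel_measurable (P I)" if "V \<subseteq> I" for I
  proof -
    have "(\<lambda>x. \<Phi> x B) \<in> borel_measurable (P I)" if B: "B \<in> ?S" for B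
    proof -
      have "B \<subset> V" "B \<subseteq> I" using B \<open>V \<subseteq> I\<close> by auto
      with psubset.IH[of B] show ?thesis by blast
    qed
    moreover have "V - B \<subseteq> I" for B using that by auto
    ultimately show ?thesis
      unfolding eq using that
      by (intro borel_measurable_diff borel_measurable_sum borel_measurable_times pair_prod_measurable)
  qed
  ultimately show ?case by blast
qed

lemma cluster_measurable [measurable]:
  "finite V \<Longrightarrow> V \<subseteq> I \<Longrightarrow> (\<lambda>x. \<Phi> x V) \<in> borel_measurable (P I)"
  using cluster_regular by blast

lemma cluster_bounded:
  assumes "finite V"
  obtains K where "\<And>x. \<bar>\<Phi> x V\<bar> \<le> K" "K \<ge> 0"
proof -
  obtain K where K: "\<And>x. \<bar>\<Phi> x V\<bar> \<le> K" using cluster_regular[OF assms] by metis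
  have "K \<ge> 0" using K[of undefined] by linarith
  with K that show ?thesis by blast
qed

lemma integral_P_insert:
  fixes f :: "(nat \<Rightarrow> 'a) \<Rightarrow> real"
  assumes "finite I" "i \<notin> I" and f: "f \<in> borel_measurable (P (insert i I))" and K: "\<And>x. \<bar>f x\<bar> \<le> K"
  shows "(\<integral>x. f x \<partial>P (insert i I)) = (\<integral>b. (\<integral>x. f (x(i := b)) \<partial>P I) \<partial>M)"
proof -
  interpret I: prob_space "P I" by (rule prob_space_P)
  interpret IM: pair_prob_space "P I" M ..
  note [measurable] = f
  have "(\<lambda>(x, b). f (x(i := b))) \<in> borel_measurable (P I \<Otimes>\<^sub>M M)"
    using measurable_compose[OF measurable_add_dim f] by (simp add: split_beta')
  then have "integrable (P I \<Otimes>\<^sub>M M) (\<lambda>(x, b). f (x(i := b)))"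
    using K by (intro IM.integrable_const_bound[of _ K]) auto
  from IM.Fubini_integral[OF this] show ?thesis
    using assms by (subst PM.product_integral_insert) (auto intro!: integrable_P)
qed

text \<open>Independence of disjoint groups of coordinates. The conditions with
  \<open>restrict\<close> say that F sees only the coordinates in A and H only those in B, although
  both are functions on all of \<open>nat \<Rightarrow> 'a\<close>.\<close>

lemma integral_P_times:
  fixes F H :: "(nat \<Rightarrow> 'a) \<Rightarrow> real"
  assumes AB: "A \<inter> B = {}" "finite A" "finite B"
    and F: "F \<in> borel_measurable (P A)" "\<And>x. \<bar>F x\<bar> \<le> K" "\<And>x. F (restrict x A) = F x"
    and H: "H \<in> borel_measurable (P B)" "\<And>x. \<bar>H x\<bar> \<le> L" "\<And>x. H (restrict x B) = H x"
  shows "(\<integral>x. F x * H x \<partial>P (A \<union> B)) = (\<integral>x. F x \<partial>P A) * (\<integral>x. H x \<partial>P B)"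
    and "integrable (P (A \<union> B)) (\<lambda>x. F x * H x)"
proof -
  have [measurable]: "F \<in> borel_measurable (P (A \<union> B))"
    using measurable_compose[OF measurable_restrict_subset[of A "A \<union> B"] F(1)] by (simp add: F(3))
  have [measurable]: "H \<in> borel_measurable (P (A \<union> B))"
    using measurable_compose[OF measurable_restrict_subset[of B "A \<union> B"] H(1)] by (simp add: H(3))
  have KL: "\<bar>F x * H x\<bar> \<le> K * L" for x
    unfolding abs_mult using F(2)[of x] H(2)[of x] by (intro mult_mono) auto
  show int: "integrable (P (A \<union> B)) (\<lambda>x. F x * H x)"
    using KL by (intro integrable_P) auto
  have 1: "F (merge A B (x, y)) = F x" for x y
  proof -
    have "restrict (merge A B (x, y)) A = restrict x A" by (auto simp: merge_def)
    then show ?thesis by (metis F(3))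
  qed
  have 2: "H (merge A B (x, y)) = H y" for x y
  proof -
    have "restrict (merge A B (x, y)) B = restrict y B"
      using AB(1) by (intro ext) (auto simp: merge_def restrict_def)
    then show ?thesis by (metis H(3))
  qed
  show "(\<integral>x. F x * H x \<partial>P (A \<union> B)) = (\<integral>x. F x \<partial>P A) * (\<integral>x. H x \<partial>P B)"
    using AB int by (simp add: PM.product_integral_fold 1 2)
qed

lemma cluster_restrict: "V \<subseteq> I \<Longrightarrow> \<Phi> (restrict x I) V = \<Phi> x V"
  by (intro cluster_cong) (auto simp: subset_eq)

lemma pair_prod_restrict: "V \<subseteq> I \<Longrightarrow> \<psi> (restrict x I) V = \<psi> x V"
  unfolding pair_prod_def by (intro prod.cong refl) (auto simp: subset_eq)

lemma measurable_fun_upd_P: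
  assumes "b \<in> space M" "f \<in> borel_measurable (P (insert v V))"
  shows "(\<lambda>x. f (x(v := b))) \<in> borel_measurable (P V)"
proof -
  have "(\<lambda>x. x(v := b)) \<in> measurable (P V) (P (insert v V))"
    by (rule measurable_fun_upd[where J = V]) (use assms(1) in auto)
  from measurable_compose[OF this assms(2)] show ?thesis .
qed

lemma cluster_pinned_measurable:
  assumes "b \<in> space M" "finite V"
  shows "(\<lambda>x. \<Phi> (x(v := b)) (insert v V)) \<in> borel_measurable (P V)"
  using assms by (intro measurable_fun_upd_P cluster_measurable) auto

text \<open>Fubini with the position of the marked vertex j integrated last. \<open>F\<close> stands
  for the absolute value in the L1 bounds and for the identity where cancellation matters.\<close>

lemma integral_marked:
  fixes f :: "'a \<Rightarrow> real" and F :: "real \<Rightarrow> real"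
  assumes f: "f \<in> borel_measurable M" "\<And>x. \<bar>f x\<bar> \<le> L" and "finite B" "j \<in> B"
    and F: "F \<in> borel_measurable borel" "\<And>x. \<bar>F x\<bar> \<le> \<bar>x\<bar>"
  shows "(\<integral>x. f (x j) * F (\<Phi> x B) \<partial>P B) = (\<integral>c. f c * (\<integral>x. F (\<Phi> (x(j := c)) B) \<partial>P (B - {j})) \<partial>M)"
    and "integrable (P B) (\<lambda>x. f (x j) * F (\<Phi> x B))"
    and "integrable M (\<lambda>c. f c * (\<integral>x. F (\<Phi> (x(j := c)) B) \<partial>P (B - {j})))"
proof -
  have B: "B = insert j (B - {j})" using assms by auto
  have [measurable]: "(\<lambda>x. x j) \<in> measurable (P B) M" using assms by simp
  note [measurable] = f(1) F(1)
  have [measurable]: "(\<lambda>x. \<Phi> x B) \<in> borel_measurable (P B)"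
    using assms by (intro cluster_measurable) auto
  obtain K where K: "\<And>x. \<bar>\<Phi> x B\<bar> \<le> K" "K \<ge> 0" using cluster_bounded assms by blast
  have FK: "\<bar>F (\<Phi> x B)\<bar> \<le> K" for x using F(2) K(1) order_trans by blast
  have bd: "\<bar>f (x j) * F (\<Phi> x B)\<bar> \<le> L * K" for x
    unfolding abs_mult using f(2)[of "x j"] FK[of x] by (intro mult_mono) auto
  have m: "(\<lambda>x. f (x j) * F (\<Phi> x B)) \<in> borel_measurable (P B)" by measurable
  show "integrable (P B) (\<lambda>x. f (x j) * F (\<Phi> x B))"
    using bd by (intro integrable_P m)
  have "(\<integral>x. f (x j) * F (\<Phi> x B) \<partial>P B) = (\<integral>x. f (x j) * F (\<Phi> x B) \<partial>P (insert j (B - {j})))"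
    using B by simp
  also have "\<dots> = (\<integral>c. (\<integral>x. f c * F (\<Phi> (x(j := c)) B) \<partial>P (B - {j})) \<partial>M)"
    using assms m bd B[symmetric] by (subst integral_P_insert[where K = "L * K"]) auto
  finally show "(\<integral>x. f (x j) * F (\<Phi> x B) \<partial>P B) = (\<integral>c. f c * (\<integral>x. F (\<Phi> (x(j := c)) B) \<partial>P (B - {j})) \<partial>M)"
    by simp
  interpret J: prob_space "P (B - {j})" by (rule prob_space_P)
  have "(\<lambda>x. F (\<Phi> x B)) \<in> borel_measurable (P (insert j (B - {j})))"
    using assms by (intro measurable_compose[OF cluster_measurable F(1)]) auto
  from measurable_compose[OF measurable_add_dim this]
  have "(\<lambda>p. F (\<Phi> ((\<lambda>(f, y). f(j := y)) p) B)) \<in> borel_measurable (P (B - {j}) \<Otimes>\<^sub>M M)" .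
  from measurable_compose[OF measurable_pair_swap' this]
  have [measurable]: "(\<lambda>(c, x). F (\<Phi> (x(j := c)) B)) \<in> borel_measurable (M \<Otimes>\<^sub>M P (B - {j}))"
    by (simp add: split_beta')
  have bd2: "\<bar>\<integral>x. F (\<Phi> (x(j := c)) B) \<partial>P (B - {j})\<bar> \<le> K" if "c \<in> space M" for c
  proof -
    have "(\<lambda>x. F (\<Phi> (x(j := c)) B)) \<in> borel_measurable (P (B - {j}))"
      using that by measurable
    then have "integrable (P (B - {j})) (\<lambda>x. F (\<Phi> (x(j := c)) B))"
      by (rule integrable_P) (rule FK)
    then have "(\<integral>x. \<bar>F (\<Phi> (x(j := c)) B)\<bar> \<partial>P (B - {j})) \<le> K"
      using FK by (intro J.integral_le_const) auto
    then show ?thesis by (rule order_trans[OF integral_abs_bound])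
  qed
  show "integrable M (\<lambda>c. f c * (\<integral>x. F (\<Phi> (x(j := c)) B) \<partial>P (B - {j})))"
  proof (intro integrable_const_bound[of _ "L * K"] AE_I2)
    fix c assume c: "c \<in> space M"
    show "norm (f c * (\<integral>x. F (\<Phi> (x(j := c)) B) \<partial>P (B - {j}))) \<le> L * K"
      unfolding real_norm_def abs_mult using f(2)[of c] bd2[OF c] by (intro mult_mono) auto
  qed measurable
qed

text \<open>Bound on the L1 norm of a cluster with one pinned and n free vertices. Removing the root
  gives T (m + 1) = (m + 1) E \<delta> times the binomial convolution of T with itself at m;
  division by the factorial turns this into the Catalan recursion.\<close>

definition T :: "nat \<Rightarrow> real" where
  "T n = fact n * catalan n * (E * \<delta>) ^ n"

lemma T_nonneg: "0 \<le> T n"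
  unfolding T_def using catalan_nonneg E_nonneg delta_nonneg by (intro mult_nonneg_nonneg zero_le_power) auto

lemma binomial_T:
  assumes "k \<le> m"
  shows "real (m choose k) * (T k * T (m - k)) = fact m * (catalan k * catalan (m - k)) * (E * \<delta>) ^ m"
proof -
  have "real (m choose k) * (T k * T (m - k)) = (fact k * fact (m - k) * real (m choose k)) *
     (catalan k * catalan (m - k)) * ((E * \<delta>) ^ k * (E * \<delta>) ^ (m - k))"
    unfolding T_def by (simp only: mult_ac)
  also have "fact k * fact (m - k) * real (m choose k) = fact m"
    using binomial_fact_lemma[OF assms] by (metis of_nat_fact of_nat_mult)
  also have "(E * \<delta>) ^ k * (E * \<delta>) ^ (m - k) = (E * \<delta>) ^ m"
    using assms by (simp add: power_add[symmetric])
  finally show ?thesis .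
qed

lemma sum_binomial_T: "(\<Sum>k\<le>m. real (m choose k) * (T k * T (m - k))) = fact m * catalan (Suc m) * (E * \<delta>) ^ m"
  unfolding catalan_Suc sum_distrib_left sum_distrib_right
  by (intro sum.cong refl) (simp add: binomial_T)

lemma marked_bound:
  fixes f :: "'a \<Rightarrow> real"
  assumes f: "f \<in> borel_measurable M" "\<And>x. \<bar>f x\<bar> \<le> L" "\<And>x. 0 \<le> f x" and "finite B" "j \<in> B"
    and T: "\<And>c. c \<in> space M \<Longrightarrow> (\<integral>x. \<bar>\<Phi> (x(j := c)) B\<bar> \<partial>P (B - {j})) \<le> t"
  shows "(\<integral>x. f (x j) * \<bar>\<Phi> x B\<bar> \<partial>P B) \<le> (\<integral>c. f c \<partial>M) * t"
proof -
  have "(\<integral>x. f (x j) * \<bar>\<Phi> x B\<bar> \<partial>P B) = (\<integral>c. f c * (\<integral>x. \<bar>\<Phi> (x(j := c)) B\<bar> \<partial>P (B - {j})) \<partial>M)"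
    by (rule integral_marked[OF f(1,2) assms(4,5), of abs]) auto
  also have "\<dots> \<le> (\<integral>c. f c * t \<partial>M)"
    using integral_marked(3)[OF f(1,2) assms(4,5), of abs] integrable_M[OF f(1,2)] f(3) T
    by (intro integral_mono) (auto intro!: mult_left_mono)
  finally show ?thesis by simp
qed

lemma cluster_pinned_expand:
  assumes V: "finite V" "v \<notin> V" "w \<in> V"
  shows "\<Phi> (x(v := b)) (insert v V) = (\<Sum>B\<in>{B. B \<subseteq> V \<and> w \<in> B}.
    ((\<Prod>j\<in>B. 1 + g b (x j)) - 1) * \<Phi> x B * \<Phi> (x(v := b)) (insert v (V - B)))"
proof (subst cluster_remove_root[OF _ V], rule g_sym, intro sum.cong refl)
  fix B assume B: "B \<in> {B. B \<subseteq> V \<and> w \<in> B}"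
  then have "\<Phi> (x(v := b)) B = \<Phi> x B"
    using V by (intro cluster_cong) auto
  moreover have "(\<Prod>j\<in>B. 1 + g ((x(v := b)) v) ((x(v := b)) j)) = (\<Prod>j\<in>B. 1 + g b (x j))"
    using B V by (intro prod.cong) auto
  ultimately show "((\<Prod>j\<in>B. 1 + g ((x(v := b)) v) ((x(v := b)) j)) - 1) * \<Phi> (x(v := b)) B * \<Phi> (x(v := b)) (insert v (V - B))
     = ((\<Prod>j\<in>B. 1 + g b (x j)) - 1) * \<Phi> x B * \<Phi> (x(v := b)) (insert v (V - B))" by simp
qed

text \<open>The first-order bound on the factor of the block B marks one vertex j of B. Given the
  position of j, the cluster on B is pinned there and falls under the induction hypothesis;
  integrating |g| over that position yields \<delta>. The remaining cluster is again pinned at v,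
  has fewer free vertices, and is independent of B.\<close>

lemma cluster_L1_bound:
  assumes "finite V" "v \<notin> V" "card V < N" "b \<in> space M"
  shows "(\<integral>x. \<bar>\<Phi> (x(v := b)) (insert v V)\<bar> \<partial>P V) \<le> T (card V)"
  using assms
proof (induction "card V" arbitrary: V v b rule: less_induct)
  case less
  interpret I: prob_space "P I" for I by (rule prob_space_P)
  show ?case
  proof (cases "V = {}")
    case True
    then show ?thesis by (simp add: T_def)
  next
    case False
    then obtain w where w: "w \<in> V" by auto
    obtain m where m: "card V = Suc m"
      using False less.prems by (metis card_0_eq not0_implies_Suc)
    let ?R = "{B. B \<subseteq> V \<and> w \<in> B}"
    let ?X = "\<lambda>B x. \<Phi> (x(v := b)) (insert v (V - B))"
    let ?h = "\<lambda>B j x. (\<bar>g b (x j)\<bar> * \<bar>\<Phi> x B\<bar>) * \<bar>?X B x\<bar>"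
    have fin: "finite B" "v \<notin> B" "card B \<le> N" if "B \<in> ?R" for B
      using that less.prems card_mono[of V B] by (auto intro: finite_subset)
    have pw: "\<bar>\<Phi> (x(v := b)) (insert v V)\<bar> \<le> (\<Sum>B\<in>?R. \<Sum>j\<in>B. E * ?h B j x)" for x
    proof -
      have "\<bar>\<Phi> (x(v := b)) (insert v V)\<bar> \<le> (\<Sum>B\<in>?R. (E * (\<Sum>j\<in>B. \<bar>g b (x j)\<bar>)) * \<bar>\<Phi> x B\<bar> * \<bar>?X B x\<bar>)"
        unfolding cluster_pinned_expand[OF less.prems(1,2) w]
      proof (intro order_trans[OF sum_abs] sum_mono)
        fix B assume B: "B \<in> ?R"
        have "\<bar>(\<Prod>j\<in>B. 1 + g b (x j)) - 1\<bar> \<le> E * (\<Sum>j\<in>B. \<bar>g b (x j)\<bar>)"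
          using fin[OF B] g_ge
          by (intro prod_minus_1_bound prod_le_E) (auto intro: finite_subset order_trans[OF card_mono])
        then show "\<bar>((\<Prod>j\<in>B. 1 + g b (x j)) - 1) * \<Phi> x B * ?X B x\<bar>
          \<le> (E * (\<Sum>j\<in>B. \<bar>g b (x j)\<bar>)) * \<bar>\<Phi> x B\<bar> * \<bar>?X B x\<bar>"
          by (auto simp: abs_mult intro!: mult_right_mono)
      qed
      also have "\<dots> = (\<Sum>B\<in>?R. \<Sum>j\<in>B. E * ?h B j x)"
        unfolding sum_distrib_left sum_distrib_right by (simp only: mult.assoc)
      finally show ?thesis .
    qed
    have main: "integrable (P V) (?h B j) \<and> (\<integral>x. ?h B j x \<partial>P V) \<le> \<delta> * T (card B - 1) * T (card V - card B)"
      if B: "B \<in> ?R" and j: "j \<in> B" for B j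
    proof -
      note [measurable] = less.prems(4)
      obtain K where K: "\<And>x. \<bar>\<Phi> x B\<bar> \<le> K" "K \<ge> 0" using cluster_bounded fin[OF B] by blast
      obtain L where L: "\<And>x. \<bar>\<Phi> x (insert v (V - B))\<bar> \<le> L" "L \<ge> 0"
        using cluster_bounded[of "insert v (V - B)"] less.prems by blast
      have V: "V = B \<union> (V - B)" using B by auto
      have [measurable]: "(\<lambda>x. x j) \<in> measurable (P B) M" using j by simp
      have m1: "(\<lambda>x. \<bar>g b (x j)\<bar> * \<bar>\<Phi> x B\<bar>) \<in> borel_measurable (P B)"
        using fin[OF B] by measurable auto
      have r1: "\<bar>g b (restrict x B j)\<bar> * \<bar>\<Phi> (restrict x B) B\<bar> = \<bar>g b (x j)\<bar> * \<bar>\<Phi> x B\<bar>" for x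
        using j by (simp add: cluster_restrict restrict_apply' del: restrict_apply)
      have m2: "(\<lambda>x. \<bar>?X B x\<bar>) \<in> borel_measurable (P (V - B))"
        using cluster_pinned_measurable[OF less.prems(4), of "V - B" v] less.prems by simp
      have r2: "?X B (restrict x (V - B)) = ?X B x" for x
        by (intro cluster_cong) auto
      have bd: "\<bar>\<bar>g b (x j)\<bar> * \<bar>\<Phi> x B\<bar>\<bar> \<le> (1 + \<kappa>) * K" for x
        using g_bounded K kappa by (auto simp: abs_mult intro!: mult_mono)
      have A: "B \<inter> (V - B) = {}" "finite B" "finite (V - B)" using less.prems fin[OF B] by auto
      note times = integral_P_times[where F = "\<lambda>x. \<bar>g b (x j)\<bar> * \<bar>\<Phi> x B\<bar>" and H = "\<lambda>x. \<bar>?X B x\<bar>",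
        OF A m1 bd r1 m2, of L]
      have cB: "card B \<ge> 1" using j fin[OF B] by (metis One_nat_def Suc_leI card_gt_0_iff empty_iff)
      have cV: "card B \<le> card V" using B less.prems by (auto intro: card_mono)
      have "(\<integral>x. \<bar>g b (x j)\<bar> * \<bar>\<Phi> x B\<bar> \<partial>P B) \<le> (\<integral>c. \<bar>g b c\<bar> \<partial>M) * T (card B - 1)"
      proof (rule marked_bound[of "\<lambda>c. \<bar>g b c\<bar>" "1 + \<kappa>"])
        fix c assume c: "c \<in> space M"
        have "(\<integral>x. \<bar>\<Phi> (x(j := c)) (insert j (B - {j}))\<bar> \<partial>P (B - {j})) \<le> T (card (B - {j}))"
          using less.prems fin[OF B] j c cV cB by (intro less.hyps) auto
        then show "(\<integral>x. \<bar>\<Phi> (x(j := c)) B\<bar> \<partial>P (B - {j})) \<le> T (card B - 1)"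
          using j fin[OF B] by (simp add: insert_absorb)
      qed (use less.prems(4) fin[OF B] j g_bounded in auto)
      also have "\<dots> \<le> \<delta> * T (card B - 1)"
        using g_L1[OF less.prems(4)] T_nonneg by (intro mult_right_mono)
      finally have I1: "(\<integral>x. \<bar>g b (x j)\<bar> * \<bar>\<Phi> x B\<bar> \<partial>P B) \<le> \<delta> * T (card B - 1)" .
      have "(\<integral>x. \<bar>?X B x\<bar> \<partial>P (V - B)) \<le> T (card (V - B))"
        using less.prems B fin[OF B] cB cV by (intro less.hyps) (auto simp: card_Diff_subset)
      also have "card (V - B) = card V - card B"
        using B fin[OF B] by (intro card_Diff_subset) auto
      finally have I2: "(\<integral>x. \<bar>?X B x\<bar> \<partial>P (V - B)) \<le> T (card V - card B)" .
      have "integrable (P V) (?h B j)" using times(2) L r2 V by simp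
      moreover have "(\<integral>x. ?h B j x \<partial>P V) = (\<integral>x. \<bar>g b (x j)\<bar> * \<bar>\<Phi> x B\<bar> \<partial>P B) * (\<integral>x. \<bar>?X B x\<bar> \<partial>P (V - B))"
        using times(1) L r2 V by simp
      moreover have "\<dots> \<le> (\<delta> * T (card B - 1)) * T (card V - card B)"
        using I1 I2 T_nonneg delta_nonneg by (intro mult_mono) auto
      ultimately show ?thesis by simp
    qed
    have "(\<integral>x. \<bar>\<Phi> (x(v := b)) (insert v V)\<bar> \<partial>P V) \<le> (\<integral>x. (\<Sum>B\<in>?R. \<Sum>j\<in>B. E * ?h B j x) \<partial>P V)"
    proof (rule integral_mono)
      obtain L where L: "\<And>x. \<bar>\<Phi> x (insert v V)\<bar> \<le> L" "L \<ge> 0"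
        using cluster_bounded[of "insert v V"] less.prems by blast
      show "integrable (P V) (\<lambda>x. \<bar>\<Phi> (x(v := b)) (insert v V)\<bar>)"
        using cluster_pinned_measurable[OF less.prems(4,1), of v] L by (intro integrable_P) auto
    qed (use main pw in \<open>auto intro!: integrable_sum integrable_mult_right\<close>)
    also have "\<dots> = (\<Sum>B\<in>?R. \<Sum>j\<in>B. E * (\<integral>x. ?h B j x \<partial>P V))"
      using main by (simp add: Bochner_Integration.integral_sum integrable_sum integrable_mult_right)
    also have "\<dots> \<le> (\<Sum>B\<in>?R. \<Sum>j\<in>B. E * (\<delta> * T (card B - 1) * T (card V - card B)))"
      using main E_nonneg by (intro sum_mono mult_left_mono) auto
    also have "\<dots> = (\<Sum>B\<in>?R. real (card B) * (E * (\<delta> * T (card B - 1) * T (card V - card B))))"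
      by simp
    also have "\<dots> = (\<Sum>k\<le>m. real (m choose k) * (real (Suc k) * (E * (\<delta> * T k * T (m - k)))))"
      by (subst sum_rooted_card[OF less.prems(1) w m]) (simp add: m)
    \<comment> \<open>\<open>Suc k\<close> counts the choices of the marked vertex. Replacing it by
      \<open>Suc m\<close> is what completes \<open>fact m\<close> to
      \<open>fact (Suc m)\<close>.\<close>
    also have "\<dots> \<le> (\<Sum>k\<le>m. real (m choose k) * (real (Suc m) * (E * (\<delta> * T k * T (m - k)))))"
      using T_nonneg E_nonneg delta_nonneg
      by (intro sum_mono mult_left_mono mult_right_mono mult_nonneg_nonneg) auto
    also have "\<dots> = real (Suc m) * (E * \<delta>) * (\<Sum>k\<le>m. real (m choose k) * (T k * T (m - k)))"
      by (simp add: sum_distrib_left mult_ac)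
    also have "\<dots> = T (card V)"
      unfolding sum_binomial_T by (simp add: m T_def)
    finally show ?thesis .
  qed
qed

end

section \<open>Means of clusters and of the pair product\<close>

context homogeneous_gas
begin

lemma cluster_L1_bound':
  assumes "finite B" "j \<in> B" "card B \<le> N" "c \<in> space M"
  shows "(\<integral>x. \<bar>\<Phi> (x(j := c)) B\<bar> \<partial>P (B - {j})) \<le> T (card B - 1)"
proof -
  have "card (B - {j}) < N"
    using assms card_gt_0_iff[of B] by auto
  then show ?thesis
    using cluster_L1_bound[of "B - {j}" j c] assms by (simp add: insert_absorb)
qed

text \<open>A symmetry that takes b to c, applied to every free coordinate at once, preserves the
  product measure and all the weights.\<close>

lemma cluster_pinned_mean_const:
  assumes "finite V" "v \<notin> V" "b \<in> space M" "c \<in> space M"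
  shows "(\<integral>x. \<Phi> (x(v := b)) (insert v V) \<partial>P V) = (\<integral>x. \<Phi> (x(v := c)) (insert v V) \<partial>P V)"
proof -
  obtain \<tau> where [measurable]: "\<tau> \<in> measurable M M" and \<tau>: "distr M M \<tau> = M" "\<tau> b = c"
    "\<And>u v. u \<in> space M \<Longrightarrow> v \<in> space M \<Longrightarrow> g (\<tau> u) (\<tau> v) = g u v"
    using homogeneous[OF assms(3,4)] by blast
  have "distr (P V) (P V) (compose V \<tau>) = PiM V (\<lambda>_. distr M M \<tau>)"
    using assms by (intro distr_PiM_finite_prob_space') (auto intro: prob_space_axioms)
  then have D: "distr (P V) (P V) (compose V \<tau>) = P V" by (simp add: \<tau>)
  have "compose V \<tau> \<in> measurable (P V) (P V)"
    unfolding compose_def by (intro measurable_restrict) measurable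
  then have "(\<integral>x. \<Phi> (x(v := c)) (insert v V) \<partial>distr (P V) (P V) (compose V \<tau>))
    = (\<integral>x. \<Phi> ((compose V \<tau> x)(v := c)) (insert v V) \<partial>P V)"
    using assms by (intro integral_distr cluster_pinned_measurable) auto
  also have "\<dots> = (\<integral>x. \<Phi> (x(v := b)) (insert v V) \<partial>P V)"
  proof (intro Bochner_Integration.integral_cong refl cluster_cong)
    fix x i j assume x: "x \<in> space (P V)" and i: "i \<in> insert v V" and j: "j \<in> insert v V"
    have *: "((compose V \<tau> x)(v := c)) i = \<tau> ((x(v := b)) i)" "(x(v := b)) i \<in> space M"
      if "i \<in> insert v V" for i
      using that x \<tau>(2) assms by (auto simp: compose_def space_PiM)
    show "g (((compose V \<tau> x)(v := c)) i) (((compose V \<tau> x)(v := c)) j) = g ((x(v := b)) i) ((x(v := b)) j)"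
      using *[OF i] *[OF j] \<tau>(3) by simp
  qed
  finally show ?thesis by (simp add: D)
qed

text \<open>
  By homogeneity the mean of a cluster pinned at one vertex does not depend on the position of
  that vertex, so it factors out and leaves $\int g = 0$.
\<close>

lemma first_order_vanishes:
  assumes "b \<in> space M" "finite B" "j \<in> B"
  shows "(\<integral>x. g b (x j) * \<Phi> x B \<partial>P B) = 0"
proof -
  note [measurable] = assms(1)
  have "(\<integral>x. g b (x j) * \<Phi> x B \<partial>P B) = (\<integral>c. g b c * (\<integral>x. \<Phi> (x(j := c)) B \<partial>P (B - {j})) \<partial>M)"
    using assms g_bounded by (intro integral_marked(1)[where F = "\<lambda>x. x" and L = "1 + \<kappa>"]) auto
  also have "\<dots> = (\<integral>c. g b c * (\<integral>x. \<Phi> (x(j := b)) B \<partial>P (B - {j})) \<partial>M)"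
  proof (rule Bochner_Integration.integral_cong[OF refl])
    fix c assume "c \<in> space M"
    from cluster_pinned_mean_const[OF _ _ this assms(1), of "B - {j}" j] assms
    have "(\<integral>x. \<Phi> (x(j := c)) B \<partial>P (B - {j})) = (\<integral>x. \<Phi> (x(j := b)) B \<partial>P (B - {j}))"
      by (simp add: insert_absorb)
    then show "g b c * (\<integral>x. \<Phi> (x(j := c)) B \<partial>P (B - {j})) = g b c * (\<integral>x. \<Phi> (x(j := b)) B \<partial>P (B - {j}))"
      by simp
  qed
  finally show ?thesis using g_mean[OF assms(1)] by simp
qed

text \<open>
  The second-order terms $|g_{vj}||g_{vk}|$ are split by Cauchy--Schwarz before integrating: the
  loss of the factor \<open>card B\<close> is harmless, and no two-point function of the cluster is needed.
\<close>

lemma root_block_bound: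
  assumes "b \<in> space M" "finite B" "B \<noteq> {}" "card B \<le> N"
  shows "\<bar>\<integral>x. ((\<Prod>j\<in>B. 1 + g b (x j)) - 1) * \<Phi> x B \<partial>P B\<bar> \<le> E * (real (card B))\<^sup>2 * a * T (card B - 1)"
    and "integrable (P B) (\<lambda>x. ((\<Prod>j\<in>B. 1 + g b (x j)) - 1) * \<Phi> x B)"
    and "\<And>x. \<bar>(\<Prod>j\<in>B. 1 + g b (x j)) - 1\<bar> \<le> E"
proof -
  note [measurable] = assms(1)
  have [measurable]: "(\<lambda>x. x j) \<in> measurable (P B) M" if "j \<in> B" for j using that by simp
  have [measurable]: "(\<lambda>x. \<Phi> x B) \<in> borel_measurable (P B)"
    using assms by (intro cluster_measurable) auto
  let ?p = "\<lambda>x. (\<Prod>j\<in>B. 1 + g b (x j)) - 1" and ?s = "\<lambda>x. \<Sum>j\<in>B. g b (x j)"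
  have prod: "0 \<le> (\<Prod>j\<in>B. 1 + g b (x j))" "(\<Prod>j\<in>B. 1 + g b (x j)) \<le> E" for x
  proof -
    show "0 \<le> (\<Prod>j\<in>B. 1 + g b (x j))"
      using g_ge[of b] by (intro prod_nonneg ballI) (smt (verit))
    show "(\<Prod>j\<in>B. 1 + g b (x j)) \<le> E" by (intro prod_le_E assms)
  qed
  show p: "\<bar>?p x\<bar> \<le> E" for x using prod[of x] E_ge_1 by (simp add: abs_le_iff)
  obtain K where K: "\<And>x. \<bar>\<Phi> x B\<bar> \<le> K" "K \<ge> 0" using cluster_bounded assms by blast
  have pm: "?p \<in> borel_measurable (P B)" by measurable
  have "\<bar>?p x * \<Phi> x B\<bar> \<le> E * K" for x
    using p K E_nonneg by (auto simp: abs_mult intro!: mult_mono)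
  then show int: "integrable (P B) (\<lambda>x. ?p x * \<Phi> x B)"
    using pm by (intro integrable_P) measurable
  have g1: "integrable (P B) (\<lambda>x. g b (x j) * \<Phi> x B)" if "j \<in> B" for j
    by (rule integral_marked(2)[where F = "\<lambda>x. x" and f = "g b" and L = "1 + \<kappa>"])
      (use assms that in \<open>simp_all add: g_bounded\<close>)
  have sq: "\<bar>(g b x)\<^sup>2\<bar> \<le> (1 + \<kappa>)\<^sup>2" for x
    using power_mono[OF g_bounded[of b x], of 2] by simp
  have g2: "integrable (P B) (\<lambda>x. (g b (x j))\<^sup>2 * \<bar>\<Phi> x B\<bar>)" if "j \<in> B" for j
    by (rule integral_marked(2)[where F = abs and f = "\<lambda>x. (g b x)\<^sup>2" and L = "(1 + \<kappa>)\<^sup>2"])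
      (use assms that sq in simp_all)
  have s: "integrable (P B) (\<lambda>x. ?s x * \<Phi> x B)" "(\<integral>x. ?s x * \<Phi> x B \<partial>P B) = 0"
    using g1 first_order_vanishes[OF assms(1,2)]
    by (auto simp: sum_distrib_right Bochner_Integration.integral_sum)
  have "\<bar>\<integral>x. ?p x * \<Phi> x B \<partial>P B\<bar> = \<bar>\<integral>x. ?p x * \<Phi> x B - ?s x * \<Phi> x B \<partial>P B\<bar>"
    using int s by simp
  also have "\<bar>(\<integral>x. ?p x * \<Phi> x B - ?s x * \<Phi> x B \<partial>P B)\<bar> \<le> (\<integral>x. \<bar>?p x * \<Phi> x B - ?s x * \<Phi> x B\<bar> \<partial>P B)"
    by (rule integral_abs_bound)
  also have "\<dots> \<le> (\<integral>x. (\<Sum>j\<in>B. E * real (card B) * ((g b (x j))\<^sup>2 * \<bar>\<Phi> x B\<bar>)) \<partial>P B)"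
  proof (intro integral_mono integrable_abs Bochner_Integration.integrable_diff int s Bochner_Integration.integrable_sum)
    fix x
    have "\<bar>?p x - ?s x\<bar> \<le> E * (\<Sum>j\<in>B. \<bar>g b (x j)\<bar>)\<^sup>2"
      using assms g_ge
      by (intro prod_minus_linear_bound prod_le_E) (auto intro: finite_subset order_trans[OF card_mono])
    also have "\<dots> \<le> E * ((\<Sum>j\<in>B. (g b (x j))\<^sup>2) * real (card B))"
      using sum_squared_le_sum_of_squares[of "\<lambda>j. \<bar>g b (x j)\<bar>" B] E_nonneg
      by (intro mult_left_mono) auto
    finally have "\<bar>?p x - ?s x\<bar> * \<bar>\<Phi> x B\<bar> \<le> E * ((\<Sum>j\<in>B. (g b (x j))\<^sup>2) * real (card B)) * \<bar>\<Phi> x B\<bar>"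
      by (intro mult_right_mono) auto
    also have "\<bar>?p x - ?s x\<bar> * \<bar>\<Phi> x B\<bar> = \<bar>?p x * \<Phi> x B - ?s x * \<Phi> x B\<bar>"
      unfolding abs_mult[symmetric] left_diff_distrib ..
    also have "E * ((\<Sum>j\<in>B. (g b (x j))\<^sup>2) * real (card B)) * \<bar>\<Phi> x B\<bar>
        = (\<Sum>j\<in>B. E * real (card B) * ((g b (x j))\<^sup>2 * \<bar>\<Phi> x B\<bar>))"
      by (simp add: sum_distrib_left sum_distrib_right mult_ac)
    finally show "\<bar>?p x * \<Phi> x B - ?s x * \<Phi> x B\<bar> \<le> (\<Sum>j\<in>B. E * real (card B) * ((g b (x j))\<^sup>2 * \<bar>\<Phi> x B\<bar>))" .
  qed (use g2 in auto)
  also have "\<dots> = (\<Sum>j\<in>B. E * real (card B) * (\<integral>x. (g b (x j))\<^sup>2 * \<bar>\<Phi> x B\<bar> \<partial>P B))"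
    using g2 by (subst Bochner_Integration.integral_sum) auto
  also have "\<dots> \<le> (\<Sum>j\<in>B. E * real (card B) * (a * T (card B - 1)))"
  proof (intro sum_mono mult_left_mono)
    fix j assume j: "j \<in> B"
    have "(\<integral>x. (g b (x j))\<^sup>2 * \<bar>\<Phi> x B\<bar> \<partial>P B) \<le> (\<integral>c. (g b c)\<^sup>2 \<partial>M) * T (card B - 1)"
      using sq assms j cluster_L1_bound'
      by (intro marked_bound[of "\<lambda>c. (g b c)\<^sup>2" "(1 + \<kappa>)\<^sup>2"]) auto
    also have "\<dots> \<le> a * T (card B - 1)"
      using g_L2[OF assms(1)] T_nonneg by (intro mult_right_mono)
    finally show "(\<integral>x. (g b (x j))\<^sup>2 * \<bar>\<Phi> x B\<bar> \<partial>P B) \<le> a * T (card B - 1)" .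
  qed (use E_nonneg in auto)
  finally show "\<bar>\<integral>x. ?p x * \<Phi> x B \<partial>P B\<bar> \<le> E * (real (card B))\<^sup>2 * a * T (card B - 1)"
    by (simp add: power2_eq_square mult_ac)
qed

text \<open>Bound on the mean of a cluster with m + 2 vertices; the shift is there because the
  smallest nontrivial cluster is a pair. Compared with T (m + 1), one factor \<delta> has been
  replaced by (m + 1) a.\<close>

definition D :: "nat \<Rightarrow> real" where
  "D m = E * (real (Suc m))\<^sup>2 * a * (fact m * catalan (Suc m) * (E * \<delta>) ^ m)"

text \<open>With v pinned, the block B and the rest are independent, so the integral factorises
  before absolute values are taken. The cancellation is thus spent on B alone, and the rest can be
  estimated in L1. A single removal of the root suffices, without induction.\<close>

lemma cluster_pinned_mean_bound:
  assumes "finite V" "v \<notin> V" "card V = Suc m" "Suc m < N" "b \<in> space M"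
  shows "\<bar>\<integral>x. \<Phi> (x(v := b)) (insert v V) \<partial>P V\<bar> \<le> D m"
proof -
  obtain w where w: "w \<in> V" using assms by force
  let ?R = "{B. B \<subseteq> V \<and> w \<in> B}"
  let ?X = "\<lambda>B x. \<Phi> (x(v := b)) (insert v (V - B))"
  let ?p = "\<lambda>B x. ((\<Prod>j\<in>B. 1 + g b (x j)) - 1) * \<Phi> x B"
  have fin: "finite B" "v \<notin> B" "card B \<le> N" "B \<noteq> {}" if "B \<in> ?R" for B
    using that assms card_mono[of V B] by (auto intro: finite_subset)
  note eq = cluster_pinned_expand[OF assms(1,2) w]
  have main: "integrable (P V) (\<lambda>x. ?p B x * ?X B x) \<and>
      \<bar>\<integral>x. ?p B x * ?X B x \<partial>P V\<bar> \<le> E * (real (card B))\<^sup>2 * a * T (card B - 1) * T (card V - card B)"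
    if B: "B \<in> ?R" for B
  proof -
    note rb = root_block_bound[OF assms(5) fin(1)[OF B] fin(4)[OF B] fin(3)[OF B]]
    obtain K where K: "\<And>x. \<bar>\<Phi> x B\<bar> \<le> K" "K \<ge> 0" using cluster_bounded fin[OF B] by blast
    obtain L where L: "\<And>x. \<bar>\<Phi> x (insert v (V - B))\<bar> \<le> L" "L \<ge> 0"
      using cluster_bounded[of "insert v (V - B)"] assms by blast
    have V: "V = B \<union> (V - B)" using B by auto
    have m1: "?p B \<in> borel_measurable (P B)" using rb(2) by auto
    have r1: "?p B (restrict x B) = ?p B x" for x
      by (simp add: cluster_restrict restrict_apply' del: restrict_apply cong: prod.cong)
    have m2: "?X B \<in> borel_measurable (P (V - B))"
      using cluster_pinned_measurable[OF assms(5), of "V - B" v] assms by simp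
    have r2: "?X B (restrict x (V - B)) = ?X B x" for x
      by (intro cluster_cong) auto
    have bd: "\<bar>?p B x\<bar> \<le> E * K" for x
      using rb(3) K E_nonneg by (auto simp: abs_mult intro!: mult_mono)
    have A: "B \<inter> (V - B) = {}" "finite B" "finite (V - B)" using assms fin[OF B] by auto
    note times = integral_P_times[where F = "?p B" and H = "?X B", OF A m1 bd r1 m2 L(1) r2]
    have "\<bar>\<integral>x. ?X B x \<partial>P (V - B)\<bar> \<le> T (card V - card B)"
    proof -
      have "(\<integral>x. \<bar>?X B x\<bar> \<partial>P (V - B)) \<le> T (card (V - B))"
        using assms B by (intro cluster_L1_bound) (auto intro: le_less_trans[OF card_mono[of V]])
      also have "card (V - B) = card V - card B"
        using B fin[OF B] by (intro card_Diff_subset) auto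
      finally show ?thesis by (rule order_trans[OF integral_abs_bound])
    qed
    moreover have "\<bar>\<integral>x. ?p B x * ?X B x \<partial>P V\<bar> = \<bar>\<integral>x. ?p B x \<partial>P B\<bar> * \<bar>\<integral>x. ?X B x \<partial>P (V - B)\<bar>"
      using times(1) V by (simp add: abs_mult)
    moreover have "integrable (P V) (\<lambda>x. ?p B x * ?X B x)" using times(2) V by simp
    ultimately show ?thesis
      using rb(1) T_nonneg E_nonneg a_nonneg by (auto intro!: mult_mono)
  qed
  have "\<bar>\<integral>x. \<Phi> (x(v := b)) (insert v V) \<partial>P V\<bar> = \<bar>\<Sum>B\<in>?R. \<integral>x. ?p B x * ?X B x \<partial>P V\<bar>"
    using main unfolding eq by (subst Bochner_Integration.integral_sum) auto
  also have "\<dots> \<le> (\<Sum>B\<in>?R. E * (real (card B))\<^sup>2 * a * T (card B - 1) * T (card V - card B))"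
    using main by (intro order_trans[OF sum_abs] sum_mono) auto
  also have "\<dots> = (\<Sum>k\<le>m. real (m choose k) * (E * (real (Suc k))\<^sup>2 * a * T k * T (m - k)))"
    by (subst sum_rooted_card[OF assms(1) w assms(3)]) (simp add: assms(3))
  also have "\<dots> \<le> (\<Sum>k\<le>m. real (m choose k) * (E * (real (Suc m))\<^sup>2 * a * T k * T (m - k)))"
    using T_nonneg E_nonneg a_nonneg
    by (intro sum_mono mult_left_mono mult_right_mono power_mono mult_nonneg_nonneg) auto
  also have "\<dots> = E * (real (Suc m))\<^sup>2 * a * (\<Sum>k\<le>m. real (m choose k) * (T k * T (m - k)))"
    by (simp add: sum_distrib_left mult_ac)
  also have "\<dots> = D m" unfolding sum_binomial_T by (simp add: D_def)
  finally show ?thesis .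
qed

lemma cluster_mean_bound:
  assumes "finite V" "card V = Suc (Suc m)" "Suc (Suc m) \<le> N"
  shows "\<bar>\<integral>x. \<Phi> x V \<partial>P V\<bar> \<le> D m"
proof -
  obtain v where v: "v \<in> V" using assms by force
  obtain b where b: "b \<in> space M" using not_empty by auto
  obtain K where K: "\<And>x. \<bar>\<Phi> x V\<bar> \<le> K" using cluster_bounded assms by blast
  have V: "insert v (V - {v}) = V" "card (V - {v}) = Suc m" using v assms by auto
  have "(\<integral>x. \<Phi> x (insert v (V - {v})) \<partial>P (insert v (V - {v})))
      = (\<integral>c. (\<integral>x. \<Phi> (x(v := c)) (insert v (V - {v})) \<partial>P (V - {v})) \<partial>M)"
    using assms K V by (intro integral_P_insert[where K = K] cluster_measurable) auto
  also have "\<dots> = (\<integral>c. (\<integral>x. \<Phi> (x(v := b)) (insert v (V - {v})) \<partial>P (V - {v})) \<partial>M)"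
    using assms b by (intro Bochner_Integration.integral_cong refl cluster_pinned_mean_const) auto
  also have "\<dots> = (\<integral>x. \<Phi> (x(v := b)) (insert v (V - {v})) \<partial>P (V - {v}))"
    by (simp add: prob_space)
  finally have "(\<integral>x. \<Phi> x V \<partial>P V) = (\<integral>x. \<Phi> (x(v := b)) (insert v (V - {v})) \<partial>P (V - {v}))"
    by (simp only: V)
  moreover have "\<bar>\<integral>x. \<Phi> (x(v := b)) (insert v (V - {v})) \<partial>P (V - {v})\<bar> \<le> D m"
    using assms b V by (intro cluster_pinned_mean_bound) auto
  ultimately show ?thesis by simp
qed

text \<open>The binomial coefficient and the factorial give a power of N, and the spare factor m + 1
  is at most 2^m. With 4^m from the Catalan numbers the terms are at most 8 E a N (8 E \<delta>
  N)^m, so the smallness condition leaves a geometric series of ratio 1/2, whose sum doubles 8 to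
  16.\<close>

lemma sum_D_bound:
  assumes small: "16 * E * \<delta> * real N \<le> 1" and "n \<le> N"
  shows "(\<Sum>m<n. real (n choose Suc m) * D m) \<le> 16 * E * a * real N"
proof -
  have "real (n choose Suc m) * D m \<le> 8 * E * a * real N * (1 / 2) ^ m" for m
  proof -
    have c: "real (n choose Suc m) * fact (Suc m) \<le> real N ^ Suc m"
    proof -
      have "(n choose Suc m) * fact (Suc m) \<le> n ^ Suc m" by (rule binomial_fact_pow)
      also have "\<dots> \<le> N ^ Suc m" using assms by (intro power_mono) auto
      finally show ?thesis by (metis of_nat_fact of_nat_le_iff of_nat_mult of_nat_power)
    qed
    have k: "real (Suc m) \<le> 2 ^ m"
      by (metis Suc_leI less_exp of_nat_le_numeral_power_cancel_iff)
    have x0: "0 \<le> E * \<delta> * real N" using E_nonneg delta_nonneg by simp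
    have "real (n choose Suc m) * D m = (real (n choose Suc m) * fact (Suc m)) *
        (real (Suc m) * (E * a) * (catalan (Suc m) * (E * \<delta>) ^ m))"
      by (simp add: D_def power2_eq_square)
    also have "\<dots> \<le> real N ^ Suc m * (2 ^ m * (E * a) * ((2 * 4 ^ Suc m) * (E * \<delta>) ^ m))"
      using c k catalan_le[of "Suc m"] E_nonneg a_nonneg delta_nonneg catalan_nonneg
      by (intro mult_mono mult_nonneg_nonneg zero_le_power order_refl) (auto simp del: power_Suc)
    also have "\<dots> = 8 * E * a * real N * (8 * (E * \<delta> * real N)) ^ m"
      by (simp add: power_mult_distrib mult_ac flip: power_mult_distrib)
    also have "\<dots> \<le> 8 * E * a * real N * (1 / 2) ^ m"
      using small x0 E_nonneg a_nonneg by (intro mult_left_mono power_mono) auto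
    finally show ?thesis .
  qed
  then have "(\<Sum>m<n. real (n choose Suc m) * D m) \<le> (\<Sum>m<n. 8 * E * a * real N * (1 / 2) ^ m)"
    by (intro sum_mono)
  also have "\<dots> = 8 * E * a * real N * (\<Sum>m<n. (1 / 2) ^ m)" by (simp add: sum_distrib_left)
  also have "(\<Sum>m<n. (1 / 2 :: real) ^ m) \<le> 2"
    by (simp add: sum_gp_strict)
  finally show ?thesis using E_nonneg a_nonneg by (simp add: mult_left_mono)
qed

text \<open>Taking off the cluster of one vertex costs a factor 1 + \<eta> \<le> exp \<eta> with
  \<eta> = 16 E a N: the 1 comes from the isolated vertex, the \<eta> from all larger clusters
  together. Iteration over the vertices gives the exponent.\<close>

lemma pair_prod_mean_bound:
  assumes small: "16 * E * \<delta> * real N \<le> 1" and "finite V" "card V \<le> N"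
  shows "(\<integral>x. \<psi> x V \<partial>P V) \<le> exp (16 * E * a * real N * real (card V))"
  using assms(2-)
proof (induction "card V" arbitrary: V rule: less_induct)
  case less
  let ?\<eta> = "16 * E * a * real N"
  have eta: "0 \<le> ?\<eta>" using E_nonneg a_nonneg by simp
  interpret I: prob_space "P I" for I by (rule prob_space_P)
  show ?case
  proof (cases "V = {}")
    case True
    then show ?thesis by simp
  next
    case False
    then obtain v where v: "v \<in> V" by auto
    obtain n where n: "card V = Suc n"
      using False less.prems by (metis card_0_eq not0_implies_Suc)
    let ?R = "{B. B \<subseteq> V \<and> v \<in> B}"
    \<comment> \<open>Mean of a cluster by size: 1 for a single vertex, \<open>D\<close> from two
      vertices on. The value at 0 is a dummy, since every block contains v.\<close>
    let ?d = "\<lambda>k. case k of Suc (Suc m) \<Rightarrow> D m | _ \<Rightarrow> 1"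
    have main: "integrable (P V) (\<lambda>x. \<Phi> x B * \<psi> x (V - B)) \<and>
        (\<integral>x. \<Phi> x B * \<psi> x (V - B) \<partial>P V) \<le> ?d (card B) * exp (?\<eta> * real n)"
      if B: "B \<in> ?R" for B
    proof -
      have fB: "finite B" using B less.prems by (auto intro: finite_subset)
      have V: "V = B \<union> (V - B)" using B by auto
      have A: "B \<inter> (V - B) = {}" "finite B" "finite (V - B)" using less.prems fB by auto
      obtain K where K: "\<And>x. \<bar>\<Phi> x B\<bar> \<le> K" using cluster_bounded fB by blast
      obtain L where L: "\<And>x. \<bar>\<psi> x (V - B)\<bar> \<le> L" using pair_prod_bounded by blast
      have m1: "(\<lambda>x. \<Phi> x B) \<in> borel_measurable (P B)"
        and m2: "(\<lambda>x. \<psi> x (V - B)) \<in> borel_measurable (P (V - B))"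
        using fB by (auto intro!: cluster_measurable pair_prod_measurable)
      note times = integral_P_times[where F = "\<lambda>x. \<Phi> x B" and H = "\<lambda>x. \<psi> x (V - B)",
        OF A m1 K cluster_restrict[OF order_refl] m2 L pair_prod_restrict[OF order_refl]]
      have cB: "1 \<le> card B" "card B \<le> Suc n"
        using B fB less.prems n card_mono[of V B] by (auto simp: Suc_le_eq card_gt_0_iff)
      have cVB: "card (V - B) = Suc n - card B"
        using B fB n by (subst card_Diff_subset) auto
      have "(\<integral>x. \<psi> x (V - B) \<partial>P (V - B)) \<le> exp (?\<eta> * real (card (V - B)))"
        using less.prems cB cVB n by (intro less.hyps) auto
      also have "\<dots> \<le> exp (?\<eta> * real n)"
        using mult_left_mono[OF _ eta, of "real (card (V - B))" "real n"] cVB cB by simp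
      finally have 1: "(\<integral>x. \<psi> x (V - B) \<partial>P (V - B)) \<le> exp (?\<eta> * real n)" .
      \<comment> \<open>Since 1 + g \<ge> 0, the mean over the remaining vertices is nonnegative;
        the absolute value is therefore needed on the cluster mean only.\<close>
      have 2: "0 \<le> (\<integral>x. \<psi> x (V - B) \<partial>P (V - B))"
        by (intro integral_nonneg_AE AE_I2 pair_prod_nonneg)
      have 3: "\<bar>\<integral>x. \<Phi> x B \<partial>P B\<bar> \<le> ?d (card B)"
      proof (cases "card B = 1")
        case True
        then obtain u where "B = {u}" using card_1_singletonE by blast
        then show ?thesis by (simp add: I.prob_space)
      next
        case False
        then obtain m where m: "card B = Suc (Suc m)"
          using cB that[of "card B - 2"] by linarith
        then show ?thesis
          using cluster_mean_bound[OF fB m] cB less.prems n by simp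
      qed
      have "(\<integral>x. \<Phi> x B * \<psi> x (V - B) \<partial>P V) = (\<integral>x. \<Phi> x B \<partial>P B) * (\<integral>x. \<psi> x (V - B) \<partial>P (V - B))"
        using times(1) V by simp
      also have "\<dots> \<le> \<bar>\<integral>x. \<Phi> x B \<partial>P B\<bar> * (\<integral>x. \<psi> x (V - B) \<partial>P (V - B))"
        using 2 by (intro mult_right_mono) auto
      also have "\<dots> \<le> ?d (card B) * exp (?\<eta> * real n)"
        using 1 2 3 by (intro mult_mono) auto
      finally show ?thesis using times(2) V by simp
    qed
    have "(\<integral>x. \<psi> x V \<partial>P V) = (\<integral>x. (\<Sum>B\<in>?R. \<Phi> x B * \<psi> x (V - B)) \<partial>P V)"
      using pair_prod_root[OF less.prems(1) v] by simp
    also have "\<dots> = (\<Sum>B\<in>?R. (\<integral>x. \<Phi> x B * \<psi> x (V - B) \<partial>P V))"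
      using main by (intro Bochner_Integration.integral_sum) auto
    also have "\<dots> \<le> (\<Sum>B\<in>?R. ?d (card B) * exp (?\<eta> * real n))"
      using main by (intro sum_mono) auto
    also have "\<dots> = (\<Sum>k\<le>n. real (n choose k) * (?d (Suc k) * exp (?\<eta> * real n)))"
      by (rule sum_rooted_card[OF less.prems(1) v n])
    also have "\<dots> = exp (?\<eta> * real n) * (1 + (\<Sum>m<n. real (n choose Suc m) * D m))"
    proof -
      have "(\<Sum>k\<le>n. real (n choose k) * (?d (Suc k) * exp (?\<eta> * real n)))
        = exp (?\<eta> * real n) * (\<Sum>k\<le>n. real (n choose k) * ?d (Suc k))"
        unfolding sum_distrib_left by (intro sum.cong refl) (simp only: mult_ac)
      also have "(\<Sum>k\<le>n. real (n choose k) * ?d (Suc k)) = 1 + (\<Sum>m<n. real (n choose Suc m) * D m)"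
        by (subst sum.atMost_shift) simp
      finally show ?thesis .
    qed
    also have "\<dots> \<le> exp (?\<eta> * real n) * (1 + ?\<eta>)"
      using sum_D_bound[OF small, of n] less.prems n by (intro mult_left_mono) auto
    also have "\<dots> \<le> exp (?\<eta> * real n) * exp ?\<eta>"
      using exp_ge_add_one_self[of ?\<eta>] by (intro mult_left_mono) auto
    also have "\<dots> = exp (?\<eta> * real (card V))"
      by (simp add: n exp_add[symmetric] algebra_simps)
    finally show ?thesis .
  qed
qed

end

section \<open>Translations of the torus\<close>

abbreviation unit_interval :: "real measure" where
  "unit_interval \<equiv> restrict_space lborel {0..<1}"

lemma space_unit_interval [simp]: "space unit_interval = {0..<1}"
  by (simp add: space_restrict_space)

lemma prob_space_unit_interval: "prob_space unit_interval"
  by (rule prob_spaceI) (simp add: emeasure_restrict_space)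

interpretation unit_interval: prob_space unit_interval
  by (rule prob_space_unit_interval)

interpretation unit_intervals: product_prob_space "\<lambda>_::nat. unit_interval" UNIV
  by unfold_locales

lemma borel_measurable_frac [measurable]: "(frac :: real \<Rightarrow> real) \<in> borel_measurable borel"
  unfolding frac_def by measurable

lemma measurable_unit_intervalI:
  assumes "f \<in> borel_measurable M"
  shows "(\<lambda>x. frac (f x)) \<in> measurable M unit_interval"
  using assms by (intro measurable_restrict_space2) (auto simp: frac_lt_1)

lemma unit_interval_borel: "f \<in> borel_measurable borel \<Longrightarrow> f \<in> borel_measurable unit_interval"
  by (rule measurable_restrict_space1) simp

text \<open>Whole periods are discarded first; the interval shifted by c = \<open>frac y\<close> is
  then cut at 0, and its left piece is moved by one period.\<close>

lemma nn_integral_unit_interval_shift: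
  assumes [measurable]: "h \<in> borel_measurable borel" and per: "\<And>x. h (x + 1) = h x"
  shows "(\<integral>\<^sup>+x. h (x - y) \<partial>unit_interval) = (\<integral>\<^sup>+x. h x \<partial>unit_interval)"
proof -
  have per': "h (x + of_int k) = h x" for x :: real and k :: int
  proof -
    interpret periodic_fun_simple' h by unfold_locales (rule per)
    show ?thesis by (rule plus_of_int)
  qed
  define c where "c = frac y"
  have c: "0 \<le> c" "c < 1" by (simp_all add: c_def frac_lt_1)
  have hc: "h (x - y) = h (x - c)" for x
    using per'[of "x - y" "\<lfloor>y\<rfloor>"] by (simp add: c_def frac_def algebra_simps)
  have "(\<integral>\<^sup>+x. h (x - y) \<partial>unit_interval) = (\<integral>\<^sup>+x. h (x - c) * indicator {0..<1} x \<partial>lborel)"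
    by (simp add: hc nn_integral_restrict_space)
  also have "\<dots> = (\<integral>\<^sup>+x. h x * indicator {0..<1} (c + x) \<partial>lborel)"
    by (subst nn_integral_real_affine[where c = 1 and t = c]) simp_all
  also have "\<dots> = (\<integral>\<^sup>+x. h x * indicator {-c..<0} x + h x * indicator {0..<1-c} x \<partial>lborel)"
    using c by (intro nn_integral_cong) (auto split: split_indicator)
  also have "\<dots> = (\<integral>\<^sup>+x. h x * indicator {-c..<0} x \<partial>lborel) + (\<integral>\<^sup>+x. h x * indicator {0..<1-c} x \<partial>lborel)"
    by (intro nn_integral_add) auto
  also have "(\<integral>\<^sup>+x. h x * indicator {-c..<0} x \<partial>lborel) = (\<integral>\<^sup>+x. h (-1 + x) * indicator {-c..<0} (-1 + x) \<partial>lborel)"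
    by (subst nn_integral_real_affine[where c = 1 and t = "-1"]) simp_all
  also have "\<dots> = (\<integral>\<^sup>+x. h x * indicator {1-c..<1} x \<partial>lborel)"
    using per[of "-1 + _"] by (intro nn_integral_cong) (auto split: split_indicator)
  also have "\<dots> + (\<integral>\<^sup>+x. h x * indicator {0..<1-c} x \<partial>lborel)
      = (\<integral>\<^sup>+x. h x * indicator {1-c..<1} x + h x * indicator {0..<1-c} x \<partial>lborel)"
    by (intro nn_integral_add[symmetric]) auto
  also have "\<dots> = (\<integral>\<^sup>+x. h x * indicator {0..<1} x \<partial>lborel)"
    using c by (intro nn_integral_cong) (auto split: split_indicator)
  finally show ?thesis by (simp add: nn_integral_restrict_space)
qed

lemma nn_integral_unit_interval_reflect:
  assumes [measurable]: "h \<in> borel_measurable borel" and per: "\<And>x. h (x + 1) = h x"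
  shows "(\<integral>\<^sup>+x. h (- x) \<partial>unit_interval) = (\<integral>\<^sup>+x. h x \<partial>unit_interval)"
proof -
  have "(\<integral>\<^sup>+x. h (- x) \<partial>unit_interval) = (\<integral>\<^sup>+x. h (- x) * indicator {0..<1} x \<partial>lborel)"
    by (simp add: nn_integral_restrict_space)
  also have "\<dots> = (\<integral>\<^sup>+x. h (- 1 + x) * indicator {0..<1} (1 - x) \<partial>lborel)"
    by (subst nn_integral_real_affine[where c = "-1" and t = 1]) simp_all
  also have "\<dots> = (\<integral>\<^sup>+x. h x * indicator {0..<1} (1 - x) \<partial>lborel)"
    using per[of "-1 + _"] by (intro nn_integral_cong) simp
  also have "\<dots> = (\<integral>\<^sup>+x. h x * indicator {0..<1} x \<partial>lborel)"
  proof (rule nn_integral_cong_AE)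
    show "AE x in lborel. h x * indicator {0..<1} (1 - x) = h x * indicator {0..<1} x"
      using AE_lborel_singleton[of 0] AE_lborel_singleton[of 1]
      by eventually_elim (auto split: split_indicator)
  qed
  finally show ?thesis by (simp add: nn_integral_restrict_space)
qed

lemma distr_unit_interval_shift: "distr unit_interval unit_interval (\<lambda>x. frac (x - y)) = unit_interval"
  and distr_unit_interval_reflect: "distr unit_interval unit_interval (\<lambda>x. frac (y - x)) = unit_interval"
proof -
  have per: "frac (x + 1 - z) = frac (x - z)" "frac (z - (x + 1)) = frac (z - x)" for x z :: real
    using frac_add_of_int_right[of "x - z" 1] frac_add_of_int_right[of "z - x" "-1"]
    by (simp_all add: algebra_simps)
  have 1: "(\<integral>\<^sup>+x. f (frac (x - z)) \<partial>unit_interval) = (\<integral>\<^sup>+x. f x \<partial>unit_interval)"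
    if [measurable]: "f \<in> borel_measurable borel" for f z
  proof -
    have "(\<integral>\<^sup>+x. f (frac (x - z)) \<partial>unit_interval) = (\<integral>\<^sup>+x. f (frac x) \<partial>unit_interval)"
      by (rule nn_integral_unit_interval_shift[where h = "\<lambda>x. f (frac x)"]) (simp_all add: frac_1_eq)
    also have "\<dots> = (\<integral>\<^sup>+x. f x \<partial>unit_interval)"
      by (intro nn_integral_cong) (simp add: space_restrict_space)
    finally show ?thesis .
  qed
  have 2: "(\<integral>\<^sup>+x. f (frac (z - x)) \<partial>unit_interval) = (\<integral>\<^sup>+x. f x \<partial>unit_interval)"
    if [measurable]: "f \<in> borel_measurable borel" for f z
  proof -
    have "(\<integral>\<^sup>+x. f (frac (z - x)) \<partial>unit_interval) = (\<integral>\<^sup>+x. f (frac (- (x - z))) \<partial>unit_interval)"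
      by simp
    also have "\<dots> = (\<integral>\<^sup>+x. f (frac (- x)) \<partial>unit_interval)"
      using per(2)[of 0] by (intro nn_integral_unit_interval_shift[where h = "\<lambda>x. f (frac (- x))"]) simp_all
    also have "\<dots> = (\<integral>\<^sup>+x. f (frac x) \<partial>unit_interval)"
      by (rule nn_integral_unit_interval_reflect[where h = "\<lambda>x. f (frac x)"]) (simp_all add: frac_1_eq)
    also have "\<dots> = (\<integral>\<^sup>+x. f x \<partial>unit_interval)"
      by (intro nn_integral_cong) (simp add: space_restrict_space)
    finally show ?thesis .
  qed
  have *: "distr unit_interval unit_interval F = unit_interval"
    if F: "F \<in> measurable unit_interval unit_interval"
      and eq: "\<And>f. f \<in> borel_measurable borel \<Longrightarrow> (\<integral>\<^sup>+x. f (F x) \<partial>unit_interval) = (\<integral>\<^sup>+x. f x \<partial>unit_interval)" for F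
  proof (rule measure_eqI)
    fix A assume "A \<in> sets (distr unit_interval unit_interval F)"
    then have A: "A \<in> sets unit_interval" by simp
    then have [measurable]: "A \<in> sets borel" by (auto simp: sets_restrict_space)
    have "emeasure (distr unit_interval unit_interval F) A = (\<integral>\<^sup>+x. indicator A x \<partial>distr unit_interval unit_interval F)"
      using A by simp
    also have "\<dots> = (\<integral>\<^sup>+x. indicator A (F x) \<partial>unit_interval)"
      using F A by (intro nn_integral_distr) auto
    also have "\<dots> = emeasure unit_interval A"
      using eq[of "indicator A"] A by simp
    finally show "emeasure (distr unit_interval unit_interval F) A = emeasure unit_interval A" .
  qed simp
  show "distr unit_interval unit_interval (\<lambda>x. frac (x - y)) = unit_interval"
    by (intro * measurable_unit_intervalI unit_interval_borel 1) measurable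
  show "distr unit_interval unit_interval (\<lambda>x. frac (y - x)) = unit_interval"
    by (intro * measurable_unit_intervalI unit_interval_borel 2) measurable
qed

lemma distr_PiM_components:
  assumes "finite I" "\<And>i. prob_space (M i)" and f: "\<And>i. i \<in> I \<Longrightarrow> f i \<in> measurable (M i) (M i)"
    and distr: "\<And>i. i \<in> I \<Longrightarrow> distr (M i) (M i) (f i) = M i"
  shows "distr (PiM I M) (PiM I M) (\<lambda>x. \<lambda>i\<in>I. f i (x i)) = PiM I M"
proof -
  interpret product_prob_space M UNIV using assms(2) by (intro product_prob_spaceI)
  have [measurable]: "(\<lambda>x. \<lambda>i\<in>I. f i (x i)) \<in> measurable (PiM I M) (PiM I M)"
    using f by (intro measurable_restrict) (auto intro: measurable_compose[OF measurable_component_singleton])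
  show ?thesis
  proof (rule PiM_eqI[OF \<open>finite I\<close>])
    fix A assume A: "\<And>i. i \<in> I \<Longrightarrow> A i \<in> sets (M i)"
    have "emeasure (distr (PiM I M) (PiM I M) (\<lambda>x. \<lambda>i\<in>I. f i (x i))) (Pi\<^sub>E I A)
      = emeasure (PiM I M) ((\<lambda>x. \<lambda>i\<in>I. f i (x i)) -` Pi\<^sub>E I A \<inter> space (PiM I M))"
      using A \<open>finite I\<close> by (intro emeasure_distr sets_PiM_I_finite) auto
    also have "(\<lambda>x. \<lambda>i\<in>I. f i (x i)) -` Pi\<^sub>E I A \<inter> space (PiM I M) = Pi\<^sub>E I (\<lambda>i. f i -` A i \<inter> space (M i))"
      by (auto simp: space_PiM PiE_iff)
    also have "emeasure (PiM I M) \<dots> = (\<Prod>i\<in>I. emeasure (M i) (f i -` A i \<inter> space (M i)))"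
      using A f \<open>finite I\<close> by (intro emeasure_PiM) (auto intro: measurable_sets)
    also have "\<dots> = (\<Prod>i\<in>I. emeasure (M i) (A i))"
    proof (intro prod.cong refl)
      fix i assume i: "i \<in> I"
      have "emeasure (M i) (f i -` A i \<inter> space (M i)) = emeasure (distr (M i) (M i) (f i)) (A i)"
        using A[OF i] f[OF i] by (simp add: emeasure_distr)
      then show "emeasure (M i) (f i -` A i \<inter> space (M i)) = emeasure (M i) (A i)"
        by (simp add: distr[OF i])
    qed
    finally show "emeasure (distr (PiM I M) (PiM I M) (\<lambda>x. \<lambda>i\<in>I. f i (x i))) (Pi\<^sub>E I A) = (\<Prod>i\<in>I. emeasure (M i) (A i))" .
  qed simp
qed

section \<open>The torus as a group with invariant measure\<close>

lemma space_torus: "space (torus d) = (\<Pi>\<^sub>E i\<in>{..<d}. {0..<1})"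
  by (simp add: torus_def space_PiM)

lemma prob_space_torus: "prob_space (torus d)"
  unfolding torus_def by (intro prob_space_PiM prob_space_unit_interval)

lemma torus_component: "k < d \<Longrightarrow> (\<lambda>x. x k) \<in> borel_measurable (torus d)"
  unfolding torus_def
  by (rule measurable_compose[of "\<lambda>x. x k" _ unit_interval "\<lambda>x. x"]) (simp_all add: unit_interval_borel)

lemma measurable_torusI:
  assumes "\<And>k. k < d \<Longrightarrow> f k \<in> borel_measurable M"
  shows "(\<lambda>x. \<lambda>k\<in>{..<d}. frac (f k x)) \<in> measurable M (torus d)"
  unfolding torus_def using assms by (intro measurable_restrict measurable_unit_intervalI) auto

lemma torus_diff_measurable [measurable (raw)]:
  assumes [measurable]: "f \<in> measurable M (torus d)" "g \<in> measurable M (torus d)"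
  shows "(\<lambda>x. torus_diff d (f x) (g x)) \<in> measurable M (torus d)"
  unfolding torus_diff_def
  by (intro measurable_torusI borel_measurable_diff measurable_compose[OF assms(1) torus_component]
    measurable_compose[OF assms(2) torus_component])

lemma torus_uminus_measurable [measurable (raw)]:
  assumes [measurable]: "f \<in> measurable M (torus d)"
  shows "(\<lambda>x. torus_uminus d (f x)) \<in> measurable M (torus d)"
  unfolding torus_uminus_def
  by (intro measurable_torusI borel_measurable_uminus measurable_compose[OF assms(1) torus_component])

lemma distr_torus_diff_left: "distr (torus d) (torus d) (\<lambda>x. torus_diff d x y) = torus d"
  and distr_torus_diff_right: "distr (torus d) (torus d) (\<lambda>x. torus_diff d y x) = torus d"
proof -
  note * = distr_PiM_components[OF finite_lessThan prob_space_unit_interval]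
  have m: "(\<lambda>x. frac (x - z)) \<in> measurable unit_interval unit_interval"
    "(\<lambda>x. frac (z - x)) \<in> measurable unit_interval unit_interval" for z
    by (intro measurable_unit_intervalI unit_interval_borel; measurable)+
  show "distr (torus d) (torus d) (\<lambda>x. torus_diff d x y) = torus d"
    unfolding torus_def torus_diff_def by (intro * m distr_unit_interval_shift)
  show "distr (torus d) (torus d) (\<lambda>x. torus_diff d y x) = torus d"
    unfolding torus_def torus_diff_def by (intro * m distr_unit_interval_reflect)
qed

lemma frac_cong_diff: "x - x' \<in> \<int> \<Longrightarrow> frac x = frac x'" for x x' :: real
  by (metis diff_add_cancel frac_add_int_left)

lemma frac_minus_Ints: "frac x - x \<in> \<int>" "x - frac x \<in> \<int>" for x :: real
  by (simp_all add: frac_def)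

lemma torus_diff_swap: "torus_diff d y x = torus_uminus d (torus_diff d x y)"
  by (auto simp: torus_diff_def torus_uminus_def frac_neg_frac)

lemma torus_uminus_uminus: "x \<in> space (torus d) \<Longrightarrow> torus_uminus d (torus_uminus d x) = x"
  by (auto simp: torus_uminus_def frac_neg_frac space_torus PiE_iff extensional_def fun_eq_iff)

lemma torus_diff_in_space: "torus_diff d x y \<in> space (torus d)"
  by (auto simp: torus_diff_def space_torus frac_lt_1)

lemma torus_diff_diff_cancel: "torus_diff d (torus_diff d x t) (torus_diff d y t) = torus_diff d x y"
proof -
  have "frac (frac (x k - t k) - frac (y k - t k)) = frac (x k - y k)" for k
  proof (rule frac_cong_diff)
    have "(frac (x k - t k) - (x k - t k)) - (frac (y k - t k) - (y k - t k)) \<in> \<int>"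
      by (intro Ints_diff frac_minus_Ints)
    then show "frac (x k - t k) - frac (y k - t k) - (x k - y k) \<in> \<int>" by (simp add: algebra_simps)
  qed
  then show ?thesis by (auto simp: torus_diff_def)
qed

lemma torus_diff_diff_self:
  assumes "y \<in> space (torus d)"
  shows "torus_diff d x (torus_diff d x y) = y"
proof -
  have "frac (x k - frac (x k - y k)) = frac (y k)" for k
    by (simp add: frac_diff_simp)
  then show ?thesis using assms
    by (auto simp: torus_diff_def space_torus PiE_iff extensional_def fun_eq_iff)
qed

text \<open>Integrating over x i with x j frozen reduces this to translation invariance. It gives
  every pair energy mean zero and carries null sets of the torus over to the configuration
  space.\<close>

lemma distr_torus_diff_components:
  assumes "finite I" "i \<in> I" "j \<in> I" "i \<noteq> j"
  shows "distr (PiM I (\<lambda>_. torus d)) (torus d) (\<lambda>x. torus_diff d (x i) (x j)) = torus d"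
proof (rule measure_eqI)
  interpret T: prob_space "torus d" by (rule prob_space_torus)
  interpret TM: product_prob_space "\<lambda>_. torus d" UNIV by unfold_locales
  interpret J: prob_space "PiM (I - {i}) (\<lambda>_. torus d)" by (intro prob_space_PiM prob_space_torus)
  let ?P = "PiM I (\<lambda>_. torus d)" and ?f = "\<lambda>x. torus_diff d (x i) (x j)"
  have f: "?f \<in> measurable ?P (torus d)"
    using assms by (intro torus_diff_measurable) auto
  fix A assume "A \<in> sets (distr ?P (torus d) ?f)"
  then have [measurable]: "A \<in> sets (torus d)" by simp
  have I: "insert i (I - {i}) = I" using assms by auto
  have "emeasure (distr ?P (torus d) ?f) A = (\<integral>\<^sup>+x. indicator A x \<partial>distr ?P (torus d) ?f)" by simp
  also have "\<dots> = (\<integral>\<^sup>+x. indicator A (?f x) \<partial>PiM (insert i (I - {i})) (\<lambda>_. torus d))"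
    unfolding I using f by (subst nn_integral_distr) auto
  also have "\<dots> = (\<integral>\<^sup>+x. (\<integral>\<^sup>+y. indicator A (torus_diff d y (x j)) \<partial>torus d) \<partial>PiM (I - {i}) (\<lambda>_. torus d))"
    using f assms by (subst TM.product_nn_integral_insert) (auto simp: I intro!: measurable_compose[OF f])
  also have "\<dots> = (\<integral>\<^sup>+x. emeasure (torus d) A \<partial>PiM (I - {i}) (\<lambda>_. torus d))"
  proof (intro nn_integral_cong)
    fix x assume "x \<in> space (PiM (I - {i}) (\<lambda>_. torus d))"
    then have [measurable]: "x j \<in> space (torus d)" using assms by (auto simp: space_PiM)
    have "(\<integral>\<^sup>+y. indicator A (torus_diff d y (x j)) \<partial>torus d)
      = (\<integral>\<^sup>+y. indicator A y \<partial>distr (torus d) (torus d) (\<lambda>y. torus_diff d y (x j)))"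
      by (subst nn_integral_distr) auto
    then show "(\<integral>\<^sup>+y. indicator A (torus_diff d y (x j)) \<partial>torus d) = emeasure (torus d) A"
      by (simp add: distr_torus_diff_left)
  qed
  finally show "emeasure (distr ?P (torus d) ?f) A = emeasure (torus d) A"
    by (simp add: J.emeasure_space_1)
qed simp

section \<open>Reduction to a bounded centered kernel\<close>

text \<open>Quadratic near 0, where the square of exp(-u) - 1 is of that order, and linear at
  infinity, so that it is integrable for every integrable u.\<close>

definition quad_lin :: "real \<Rightarrow> real" where
  "quad_lin u = min (u\<^sup>2) \<bar>u\<bar>"

lemma quad_lin_nonneg: "0 \<le> quad_lin u"
  by (simp add: quad_lin_def)

lemma quad_lin_measurable [measurable]: "quad_lin \<in> borel_measurable borel"
  unfolding quad_lin_def by measurable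

text \<open>The lower bound on u keeps exp(-u) bounded. The first estimate feeds the L1 smallness,
  the second the second-order term, and the third shows that the mean of exp(-u) exceeds 1 only to
  second order when u has mean zero.\<close>

lemma exp_minus_bounds:
  fixes u :: real
  assumes "-1 \<le> u"
  shows "\<bar>exp (- u) - 1\<bar> \<le> 2 * \<bar>u\<bar>" and "(exp (- u) - 1)\<^sup>2 \<le> 4 * quad_lin u"
    and "exp (- u) - 1 + u \<le> quad_lin u"
proof -
  consider "u < 0" | "0 \<le> u" "u \<le> 1" | "1 < u" by linarith
  then have "\<bar>exp (- u) - 1\<bar> \<le> 2 * \<bar>u\<bar> \<and> (exp (- u) - 1)\<^sup>2 \<le> 4 * quad_lin u \<and>
      exp (- u) - 1 + u \<le> quad_lin u"
  proof cases
    case 1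
    then have u: "exp (- u) \<le> 1 - u + u\<^sup>2" "1 \<le> exp (- u)"
      using exp_bound[of "- u"] assms by auto
    have sq: "u\<^sup>2 \<le> \<bar>u\<bar>"
      using mult_left_le[of "- u" "- u"] 1 assms by (simp add: power2_eq_square)
    have "\<bar>exp (- u) - 1\<bar> \<le> 2 * \<bar>u\<bar>" using u sq 1 by simp
    moreover from power_mono[OF this, of 2] have "(exp (- u) - 1)\<^sup>2 \<le> 4 * u\<^sup>2"
      by (simp add: power_mult_distrib)
    ultimately show ?thesis using u sq by (simp add: quad_lin_def)
  next
    case 2
    \<comment> \<open>Division by 1 + u is enough because (1 - u + u^2)(1 + u) = 1 + u^3 is at least
      1.\<close>
    have "exp (- u) * (1 + u) \<le> exp (- u) * exp u"
      using exp_ge_add_one_self[of u] by (intro mult_left_mono) auto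
    also have "\<dots> \<le> (1 - u + u\<^sup>2) * (1 + u)"
      using 2 by (simp add: exp_minus power2_eq_square algebra_simps)
    finally have u: "exp (- u) \<le> 1 - u + u\<^sup>2" using 2 by simp
    have l: "1 - u \<le> exp (- u)" "exp (- u) \<le> 1" using exp_ge_add_one_self[of "- u"] 2 by auto
    have sq: "u\<^sup>2 \<le> u" using 2 by (simp add: power2_eq_square mult_left_le)
    have "\<bar>exp (- u) - 1\<bar> \<le> \<bar>u\<bar>" using l 2 by simp
    moreover from power_mono[OF this, of 2] have "(exp (- u) - 1)\<^sup>2 \<le> u\<^sup>2" by simp
    ultimately show ?thesis using u l sq 2 zero_le_power2[of u] by (simp add: quad_lin_def)
  next
    case 3
    have l: "0 \<le> exp (- u)" "exp (- u) \<le> 1" using 3 by auto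
    have sq: "u \<le> u\<^sup>2" using 3 by (simp add: power2_eq_square)
    have "\<bar>exp (- u) - 1\<bar> \<le> 1" using l by simp
    moreover from power_mono[OF this, of 2] have "(exp (- u) - 1)\<^sup>2 \<le> 1" by simp
    moreover have "\<bar>exp (- u) - 1\<bar> \<le> 2 * \<bar>u\<bar>" "exp (- u) - 1 + u \<le> u" using l 3 by linarith+
    moreover have "quad_lin u = u" using sq 3 by (simp add: quad_lin_def min_def)
    ultimately show ?thesis using 3 by linarith
  qed
  then show "\<bar>exp (- u) - 1\<bar> \<le> 2 * \<bar>u\<bar>" "(exp (- u) - 1)\<^sup>2 \<le> 4 * quad_lin u"
    "exp (- u) - 1 + u \<le> quad_lin u" by auto
qed

lemma sum_off_diagonal:
  fixes w :: "nat \<Rightarrow> nat \<Rightarrow> real"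
  assumes "\<And>i j. w i j = w j i" "finite V"
  shows "(\<Sum>i\<in>V. \<Sum>j\<in>V - {i}. w i j) = 2 * (\<Sum>i\<in>V. \<Sum>j\<in>{j\<in>V. i < j}. w i j)"
proof -
  have "(\<Sum>j\<in>V - {i}. w i j) = (\<Sum>j\<in>{j\<in>V. i < j}. w i j) + (\<Sum>j\<in>{j\<in>V. j < i}. w i j)" for i
  proof -
    have eq: "V - {i} = {j\<in>V. i < j} \<union> {j\<in>V. j < i}" by auto
    show ?thesis unfolding eq using assms(2) by (intro sum.union_disjoint) auto
  qed
  moreover have "(\<Sum>i\<in>V. \<Sum>j\<in>{j\<in>V. j < i}. w i j) = (\<Sum>j\<in>V. \<Sum>i\<in>{i\<in>V. j < i}. w i j)"
    by (rule sum.swap_restrict[OF assms(2,2)])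
  moreover have "\<dots> = (\<Sum>i\<in>V. \<Sum>j\<in>{j\<in>V. i < j}. w i j)"
    by (intro sum.cong refl assms(1))
  ultimately show ?thesis by (simp add: sum.distrib)
qed

text \<open>Evenness and the lower bound hold at every point here, since the abstract gas asks for
  pointwise symmetry and bounds of g. The constant 1/128 makes 16 E \<delta> N at most 1 for E = 2
  and \<delta> N = 4 \<beta> times the L1 norm of W.\<close>

locale regular_potential =
  fixes d N :: nat and W :: "(nat \<Rightarrow> real) \<Rightarrow> real" and \<beta> L :: real
  assumes N: "1 \<le> N" and beta: "0 < \<beta>" and L: "0 \<le> L"
    and W_int: "integrable (torus d) W" and W_mean: "(\<integral>x. W x \<partial>torus d) = 0"
    and W_even: "x \<in> space (torus d) \<Longrightarrow> W (torus_uminus d x) = W x"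
    and W_ge: "- L \<le> W x"
    and small: "\<beta> * ((\<integral>x. \<bar>W x\<bar> \<partial>torus d) + L) \<le> 1 / 128"
begin

definition u :: "(nat \<Rightarrow> real) \<Rightarrow> real" where "u x = \<beta> * W x / real N"

definition F :: "(nat \<Rightarrow> real) \<Rightarrow> real" where "F x = exp (- u x)"

definition m :: real where "m = (\<integral>x. F x \<partial>torus d)"

abbreviation Q :: real where "Q \<equiv> (\<integral>x. quad_lin (u x) \<partial>torus d)"

sublocale T: prob_space "torus d" by (rule prob_space_torus)

sublocale TP: prob_space "PiM I (\<lambda>_. torus d)" for I :: "nat set"
  by (intro prob_space_PiM prob_space_torus)

lemma W_measurable [measurable]: "W \<in> borel_measurable (torus d)"
  using W_int by auto

lemma u_measurable [measurable]: "u \<in> borel_measurable (torus d)"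
  unfolding u_def by measurable

lemma F_measurable [measurable]: "F \<in> borel_measurable (torus d)"
  unfolding F_def by measurable

lemma beta_norms_le: "\<beta> * L \<le> 1 / 128" "\<beta> * (\<integral>x. \<bar>W x\<bar> \<partial>torus d) \<le> 1 / 128"
proof -
  have "0 \<le> \<beta> * L" "0 \<le> \<beta> * (\<integral>x. \<bar>W x\<bar> \<partial>torus d)" using beta L by auto
  with small show "\<beta> * L \<le> 1 / 128" "\<beta> * (\<integral>x. \<bar>W x\<bar> \<partial>torus d) \<le> 1 / 128"
    by (simp_all add: distrib_left)
qed

lemma u_ge: "- (\<beta> * L / real N) \<le> u x"
  using mult_left_mono[OF W_ge[of x], of \<beta>] beta N by (simp add: u_def divide_right_mono minus_divide_left del: minus_divide_left[symmetric])

lemma beta_L_div_N: "\<beta> * L / real N \<le> 1" "0 \<le> \<beta> * L / real N"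
  using beta_norms_le N beta L by (auto simp: divide_le_eq)

lemma u_ge_1: "-1 \<le> u x"
  using u_ge[of x] beta_L_div_N by linarith

lemma F_bounds: "0 < F x" "F x \<le> exp (\<beta> * L / real N)" "F x \<le> 3"
proof -
  show 1: "F x \<le> exp (\<beta> * L / real N)" using u_ge[of x] by (simp add: F_def)
  have "exp (\<beta> * L / real N) \<le> exp 1" using beta_L_div_N by simp
  with 1 exp_le show "F x \<le> 3" by linarith
qed (simp add: F_def)

lemma u_int: "integrable (torus d) u"
  unfolding u_def using W_int by simp

lemma u_mean: "(\<integral>x. u x \<partial>torus d) = 0"
  unfolding u_def using W_mean by simp

lemma quad_lin_int: "integrable (torus d) (\<lambda>x. quad_lin (u x))"
  by (rule Bochner_Integration.integrable_bound[OF u_int]) (auto simp: quad_lin_def)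

lemma integrable_T: "f \<in> borel_measurable (torus d) \<Longrightarrow> (\<And>x. \<bar>f x\<bar> \<le> K) \<Longrightarrow> integrable (torus d) f"
  for f :: "(nat \<Rightarrow> real) \<Rightarrow> real"
  by (intro T.integrable_const_bound[of _ K]) auto

lemma F_int: "integrable (torus d) F"
proof (rule integrable_T[where K = 3])
  show "\<bar>F x\<bar> \<le> 3" for x using F_bounds(1,3)[of x] by linarith
qed simp

text \<open>As u has mean zero, it can be added inside the integral: m - 1 is the mean of exp(-u) -
  1 + u, which is nonnegative and at most \<open>quad_lin u\<close>.\<close>

lemma m_bounds: "1 \<le> m" "m - 1 \<le> Q" "m - 1 \<le> (\<integral>x. \<bar>F x - 1\<bar> \<partial>torus d)"
proof -
  have 1: "m - 1 = (\<integral>x. F x - 1 + u x \<partial>torus d)"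
    using F_int u_int u_mean by (simp add: m_def T.prob_space)
  have "0 \<le> (\<integral>x. F x - 1 + u x \<partial>torus d)"
  proof (intro integral_nonneg_AE AE_I2)
    fix x show "0 \<le> F x - 1 + u x" using exp_ge_add_one_self[of "- u x"] by (simp add: F_def)
  qed
  with 1 show "1 \<le> m" by simp
  show "m - 1 \<le> Q"
    unfolding 1 using exp_minus_bounds(3)[OF u_ge_1] F_int[unfolded F_def] u_int quad_lin_int
    by (intro integral_mono Bochner_Integration.integrable_add Bochner_Integration.integrable_diff) (auto simp: F_def)
  have "m - 1 = (\<integral>x. F x - 1 \<partial>torus d)"
    using F_int by (simp add: m_def T.prob_space)
  also have "\<dots> \<le> (\<integral>x. \<bar>F x - 1\<bar> \<partial>torus d)"
    using F_int by (intro integral_mono) auto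
  finally show "m - 1 \<le> (\<integral>x. \<bar>F x - 1\<bar> \<partial>torus d)" .
qed

lemma divide_m_le: "0 \<le> z \<Longrightarrow> z / m \<le> z"
  using m_bounds(1) mult_left_mono[of 1 m z] by (simp add: divide_le_eq)

definition g :: "(nat \<Rightarrow> real) \<Rightarrow> (nat \<Rightarrow> real) \<Rightarrow> real" where
  "g x y = F (torus_diff d x y) / m - 1"

lemma integral_torus_diff:
  fixes f :: "(nat \<Rightarrow> real) \<Rightarrow> real"
  assumes [measurable]: "f \<in> borel_measurable (torus d)" "x \<in> space (torus d)"
  shows "(\<integral>y. f (torus_diff d x y) \<partial>torus d) = (\<integral>y. f y \<partial>torus d)"
proof -
  have "(\<integral>y. f (torus_diff d x y) \<partial>torus d) = (\<integral>y. f y \<partial>distr (torus d) (torus d) (\<lambda>y. torus_diff d x y))"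
    by (subst integral_distr) auto
  then show ?thesis by (simp add: distr_torus_diff_right)
qed

lemma F_even: "F (torus_diff d x y) = F (torus_diff d y x)"
  using W_even[OF torus_diff_in_space, of x y] torus_diff_swap[of d y x] by (simp add: F_def u_def)

text \<open>One factor 2 is the price of recentring from 1 to m, because m - 1 is at most the L1
  norm of F - 1; the other comes from |exp(-u) - 1| \<le> 2 |u|.\<close>

lemma deviation_L1: "(\<integral>y. \<bar>F y / m - 1\<bar> \<partial>torus d) \<le> 4 * \<beta> / real N * (\<integral>x. \<bar>W x\<bar> \<partial>torus d)"
proof -
  have "(\<integral>y. \<bar>F y / m - 1\<bar> \<partial>torus d) \<le> (\<integral>y. \<bar>F y - 1\<bar> + (m - 1) \<partial>torus d)"
  proof (rule integral_mono)
    have "\<bar>\<bar>F y / m - 1\<bar>\<bar> \<le> 4" for y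
    proof -
      have "0 \<le> F y / m" "F y / m \<le> F y"
        using m_bounds(1) F_bounds(1)[of y] by (auto intro: divide_m_le)
      then show ?thesis using F_bounds(3)[of y] by linarith
    qed
    then show "integrable (torus d) (\<lambda>y. \<bar>F y / m - 1\<bar>)" by (intro integrable_T) auto
    show "integrable (torus d) (\<lambda>y. \<bar>F y - 1\<bar> + (m - 1))" using F_int by simp
    fix y
    have "\<bar>F y / m - 1\<bar> = \<bar>F y - m\<bar> / m" using m_bounds(1) by (simp add: field_simps abs_divide)
    also have "\<dots> \<le> \<bar>F y - m\<bar>" by (rule divide_m_le) simp
    finally show "\<bar>F y / m - 1\<bar> \<le> \<bar>F y - 1\<bar> + (m - 1)" using m_bounds(1) by linarith
  qed
  also have "\<dots> \<le> 2 * (\<integral>y. \<bar>F y - 1\<bar> \<partial>torus d)"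
    using F_int m_bounds(3) by (simp add: T.prob_space)
  also have "(\<integral>y. \<bar>F y - 1\<bar> \<partial>torus d) \<le> (\<integral>y. 2 * \<bar>u y\<bar> \<partial>torus d)"
    using F_int[unfolded F_def] u_int exp_minus_bounds(1)[OF u_ge_1] by (intro integral_mono) (auto simp: F_def)
  also have "\<dots> = 2 * \<beta> / real N * (\<integral>x. \<bar>W x\<bar> \<partial>torus d)"
    using beta by (simp add: u_def abs_mult)
  finally show ?thesis by simp
qed

text \<open>Recentring costs nothing in L2: the mean m minimises the quadratic deviation, so m may
  be replaced by 1. Division by m \<ge> 1 only helps.\<close>

lemma deviation_L2: "(\<integral>y. (F y / m - 1)\<^sup>2 \<partial>torus d) \<le> 4 * Q"
proof -
  have F2: "integrable (torus d) (\<lambda>y. (F y)\<^sup>2)"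
  proof (rule integrable_T[where K = "3\<^sup>2"])
    fix x show "\<bar>(F x)\<^sup>2\<bar> \<le> 3\<^sup>2"
      unfolding abs_power2 using F_bounds(1,3)[of x] by (intro power_mono) auto
  qed simp
  have exp: "(F y - c)\<^sup>2 = (F y)\<^sup>2 - 2 * c * F y + c\<^sup>2" for y c
    by (simp add: power2_eq_square algebra_simps)
  have Fc: "integrable (torus d) (\<lambda>y. (F y - c)\<^sup>2)"
    "(\<integral>y. (F y - c)\<^sup>2 \<partial>torus d) = (\<integral>y. (F y)\<^sup>2 \<partial>torus d) - 2 * c * m + c\<^sup>2" for c
    unfolding exp using F2 F_int by (simp_all add: m_def T.prob_space)
  have "(F y / m - 1)\<^sup>2 \<le> (F y - m)\<^sup>2" for y
  proof -
    have "\<bar>F y / m - 1\<bar> = \<bar>F y - m\<bar> / m" using m_bounds(1) by (simp add: field_simps abs_divide)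
    also have "\<dots> \<le> \<bar>F y - m\<bar>" by (rule divide_m_le) simp
    finally show ?thesis by (rule power2_le_iff_abs_le[THEN iffD2, rotated, of "F y / m - 1" "\<bar>F y - m\<bar>", simplified])
  qed
  then have "(\<integral>y. (F y / m - 1)\<^sup>2 \<partial>torus d) \<le> (\<integral>y. (F y - m)\<^sup>2 \<partial>torus d)"
    by (intro integral_mono' Fc) auto
  also have "\<dots> \<le> (\<integral>y. (F y - 1)\<^sup>2 \<partial>torus d)"
    using zero_le_power2[of "m - 1"] by (simp only: Fc) (simp add: power2_eq_square algebra_simps)
  also have "\<dots> \<le> (\<integral>y. 4 * quad_lin (u y) \<partial>torus d)"
    using Fc quad_lin_int exp_minus_bounds(2)[OF u_ge_1] by (intro integral_mono) (auto simp: F_def)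
  finally show ?thesis by simp
qed

text \<open>The upper bound on g is chosen so that N factors multiply up to exp(\<beta> L), which is
  at most 2 by the smallness of \<beta> L. Homogeneity is witnessed by the translation by the
  difference of the two points.\<close>

lemma homogeneous_gas_torus: "homogeneous_gas (torus d) g N (exp (\<beta> * L / real N) - 1) 2
    (4 * \<beta> / real N * (\<integral>x. \<bar>W x\<bar> \<partial>torus d)) (4 * Q)"
proof
  have "(\<lambda>p. g (fst p) (snd p)) \<in> borel_measurable (torus d \<Otimes>\<^sub>M torus d)"
    unfolding g_def by measurable
  then show "case_prod g \<in> borel_measurable (torus d \<Otimes>\<^sub>M torus d)" by (simp add: split_beta')
  fix x y
  show "g x y = g y x" unfolding g_def by (subst F_even) simp
  show "-1 \<le> g x y" using F_bounds(1) m_bounds(1) by (simp add: g_def less_imp_le)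
  have "F z / m \<le> F z" for z
    using F_bounds(1)[of z] by (intro divide_m_le) simp
  then show "g x y \<le> exp (\<beta> * L / real N) - 1"
    unfolding g_def using F_bounds(2) order_trans by (simp add: algebra_simps) blast
  show "0 \<le> exp (\<beta> * L / real N) - 1" using beta_L_div_N by simp
  have "(1 + (exp (\<beta> * L / real N) - 1)) ^ N = exp (\<beta> * L)"
    using N by (simp flip: exp_of_nat_mult)
  also have "\<dots> \<le> exp (1/128)" using beta_norms_le by simp
  also have "\<dots> \<le> 1 + 1 / 128 + (1 / 128)\<^sup>2" by (rule exp_bound) auto
  also have "\<dots> \<le> 2" by (simp add: power2_eq_square)
  finally show "(1 + (exp (\<beta> * L / real N) - 1)) ^ N \<le> 2" by simp
next
  fix x assume x [measurable]: "x \<in> space (torus d)"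
  have [measurable]: "(\<lambda>y. F y / m - 1) \<in> borel_measurable (torus d)" by measurable
  show "(\<integral>y. g x y \<partial>torus d) = 0"
    unfolding g_def using x m_bounds(1) F_int integral_torus_diff[of "\<lambda>y. F y / m - 1" x]
    by (simp add: m_def[symmetric] T.prob_space)
  show "(\<integral>y. \<bar>g x y\<bar> \<partial>torus d) \<le> 4 * \<beta> / real N * (\<integral>x. \<bar>W x\<bar> \<partial>torus d)"
    unfolding g_def using x deviation_L1 integral_torus_diff[of "\<lambda>y. \<bar>F y / m - 1\<bar>" x] by simp
  show "(\<integral>y. (g x y)\<^sup>2 \<partial>torus d) \<le> 4 * Q"
    unfolding g_def using x deviation_L2 integral_torus_diff[of "\<lambda>y. (F y / m - 1)\<^sup>2" x] by simp
next
  fix x y assume x: "x \<in> space (torus d)" and y: "y \<in> space (torus d)"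
  define t where "t = torus_diff d x y"
  have [measurable]: "t \<in> space (torus d)" unfolding t_def by (rule torus_diff_in_space)
  show "\<exists>\<tau>\<in>measurable (torus d) (torus d). distr (torus d) (torus d) \<tau> = torus d \<and> \<tau> x = y \<and>
      (\<forall>u\<in>space (torus d). \<forall>v\<in>space (torus d). g (\<tau> u) (\<tau> v) = g u v)"
  proof (intro bexI[of _ "\<lambda>z. torus_diff d z t"] conjI ballI)
    show "distr (torus d) (torus d) (\<lambda>z. torus_diff d z t) = torus d" by (rule distr_torus_diff_left)
    show "torus_diff d x t = y" unfolding t_def by (rule torus_diff_diff_self[OF y])
  qed (simp_all add: g_def torus_diff_diff_cancel)
qed

definition S :: "(nat \<Rightarrow> nat \<Rightarrow> real) \<Rightarrow> real" where
  "S x = - (\<beta> / (2 * real N)) * (\<Sum>i\<in>{1..N}. \<Sum>j\<in>{1..N} - {i}. W (torus_diff d (x i) (x j)))"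

lemma exp_S: "exp (S x) = (\<Prod>i\<in>{1..N}. \<Prod>j\<in>{j\<in>{1..N}. i < j}. F (torus_diff d (x i) (x j)))"
proof -
  have ev: "W (torus_diff d (x i) (x j)) = W (torus_diff d (x j) (x i))" for i j
    using W_even[OF torus_diff_in_space, of "x i" "x j"] torus_diff_swap[of d "x j" "x i"] by simp
  have "S x = (\<Sum>i\<in>{1..N}. \<Sum>j\<in>{j\<in>{1..N}. i < j}. - u (torus_diff d (x i) (x j)))"
    unfolding S_def by (subst sum_off_diagonal) (use ev in \<open>auto simp: u_def sum_distrib_left sum_negf\<close>)
  then show ?thesis by (simp add: exp_sum F_def)
qed

lemma torus_diff_components [measurable]:
  "i \<in> {1..N} \<Longrightarrow> j \<in> {1..N} \<Longrightarrow> (\<lambda>x. torus_diff d (x i) (x j)) \<in> measurable (PiM {1..N} (\<lambda>_. torus d)) (torus d)"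
  by (intro torus_diff_measurable) auto

lemma S_measurable: "S \<in> borel_measurable (PiM {1..N} (\<lambda>_. torus d))"
  unfolding S_def by (intro borel_measurable_times borel_measurable_const borel_measurable_sum
    measurable_compose[OF torus_diff_components W_measurable]) auto

lemma W_components:
  assumes "i \<in> {1..N}" "j \<in> {1..N} - {i}"
  shows "integrable (PiM {1..N} (\<lambda>_. torus d)) (\<lambda>x. W (torus_diff d (x i) (x j)))"
    and "(\<integral>x. W (torus_diff d (x i) (x j)) \<partial>PiM {1..N} (\<lambda>_. torus d)) = 0"
proof -
  have D: "distr (PiM {1..N} (\<lambda>_. torus d)) (torus d) (\<lambda>x. torus_diff d (x i) (x j)) = torus d"
    using assms by (intro distr_torus_diff_components) auto
  have m: "(\<lambda>x. torus_diff d (x i) (x j)) \<in> measurable (PiM {1..N} (\<lambda>_. torus d)) (torus d)"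
    using assms by simp
  show "integrable (PiM {1..N} (\<lambda>_. torus d)) (\<lambda>x. W (torus_diff d (x i) (x j)))"
    using integrable_distr_eq[OF m W_measurable] W_int D by simp
  show "(\<integral>x. W (torus_diff d (x i) (x j)) \<partial>PiM {1..N} (\<lambda>_. torus d)) = 0"
    using integral_distr[OF m W_measurable] W_mean D by simp
qed

lemma exp_S_integrable: "integrable (PiM {1..N} (\<lambda>_. torus d)) (\<lambda>x. exp (S x))"
proof (rule TP.integrable_const_bound[where B = "\<Prod>i\<in>{1..N}. \<Prod>j\<in>{j\<in>{1..N}. i < j}. 3"])
  have "exp (S x) \<le> (\<Prod>i\<in>{1..N}. \<Prod>j\<in>{j\<in>{1..N}. i < j}. 3)" for x
    unfolding exp_S using F_bounds(3) less_imp_le[OF F_bounds(1)]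
    by (intro prod_mono conjI prod_nonneg ballI)
  then show "AE x in PiM {1..N} (\<lambda>_. torus d). norm (exp (S x)) \<le> (\<Prod>i\<in>{1..N}. \<Prod>j\<in>{j\<in>{1..N}. i < j}. 3)"
    by simp
  show "(\<lambda>x. exp (S x)) \<in> borel_measurable (PiM {1..N} (\<lambda>_. torus d))"
    using S_measurable by measurable
qed

text \<open>Jensen's inequality in the form exp S \<ge> 1 + S; every pair term of S has mean
  zero.\<close>

lemma partition_ge_1: "1 \<le> partition_function d W N \<beta>"
proof -
  let ?P = "PiM {1..N} (\<lambda>_. torus d)"
  have int: "integrable ?P S" "(\<integral>x. S x \<partial>?P) = 0"
    unfolding S_def using W_components
    by (auto simp only: Bochner_Integration.integral_sum Bochner_Integration.integrable_sum
      integral_mult_right_zero sum.neutral_const mult_zero_right cong: sum.cong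
      intro!: integrable_mult_right Bochner_Integration.integrable_sum)
  have "1 = (\<integral>x. 1 + S x \<partial>?P)" using int by (simp add: TP.prob_space)
  also have "\<dots> \<le> (\<integral>x. exp (S x) \<partial>?P)"
    using int exp_S_integrable by (intro integral_mono) auto
  finally show ?thesis by (simp add: partition_function_def S_def)
qed

text \<open>The constant is 129 = 16 * 2 * 4 + 1: the cluster bound with E = 2 and a = 4 Q, plus the
  power of m, whose exponent, the number of pairs, is at most N^2 while m \<le> exp Q.\<close>

lemma partition_le: "partition_function d W N \<beta> \<le> exp (129 * (real N)\<^sup>2 * Q)"
proof -
  let ?P = "PiM {1..N} (\<lambda>_. torus d)"
  interpret G: homogeneous_gas "torus d" g N "exp (\<beta> * L / real N) - 1" 2
    "4 * \<beta> / real N * (\<integral>x. \<bar>W x\<bar> \<partial>torus d)" "4 * Q" by (rule homogeneous_gas_torus)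
  define e where "e = (\<Sum>i\<in>{1..N}. card {j\<in>{1..N}. i < j})"
  have Q0: "0 \<le> Q" by (intro integral_nonneg_AE AE_I2 quad_lin_nonneg)
  have psi: "exp (S x) = m ^ e * G.\<psi> x {1..N}" for x
  proof -
    have "1 + g y z = F (torus_diff d y z) / m" for y z by (simp add: g_def)
    then show ?thesis
      using m_bounds(1) by (simp add: exp_S pair_prod_def prod_dividef e_def power_sum)
  qed
  have "16 * 2 * (4 * \<beta> / real N * (\<integral>x. \<bar>W x\<bar> \<partial>torus d)) * real N \<le> 1"
    using beta_norms_le N by simp
  from G.pair_prod_mean_bound[OF this, of "{1..N}"]
  have 1: "(\<integral>x. G.\<psi> x {1..N} \<partial>?P) \<le> exp (16 * 2 * (4 * Q) * real N * real N)" by simp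
  have "card {j\<in>{1..N}. i < j} \<le> card {1..N}" for i by (intro card_mono) auto
  then have "card {j\<in>{1..N}. i < j} \<le> N" for i by simp
  then have "e \<le> (\<Sum>i\<in>{1..N}. N)"
    unfolding e_def by (intro sum_mono)
  then have e: "e \<le> N\<^sup>2" by (simp add: power2_eq_square)
  have "m \<le> exp Q" using m_bounds(2) exp_ge_add_one_self[of Q] by linarith
  then have "m ^ e \<le> exp Q ^ e" using m_bounds(1) by (intro power_mono) auto
  also have "\<dots> \<le> exp Q ^ N\<^sup>2" using e Q0 by (intro power_increasing) auto
  also have "\<dots> = exp ((real N)\<^sup>2 * Q)" by (simp flip: exp_of_nat_mult)
  finally have 2: "m ^ e \<le> exp ((real N)\<^sup>2 * Q)" .
  have "partition_function d W N \<beta> = (\<integral>x. exp (S x) \<partial>?P)"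
    by (simp add: partition_function_def S_def)
  also have "\<dots> = m ^ e * (\<integral>x. G.\<psi> x {1..N} \<partial>?P)" by (simp add: psi)
  also have "\<dots> \<le> exp ((real N)\<^sup>2 * Q) * exp (16 * 2 * (4 * Q) * real N * real N)"
    using 1 2 by (intro mult_mono integral_nonneg_AE AE_I2 G.pair_prod_nonneg) auto
  also have "\<dots> = exp (129 * (real N)\<^sup>2 * Q)"
    by (simp add: exp_add[symmetric] power2_eq_square algebra_simps)
  finally show ?thesis .
qed

end

text \<open>W enters only through differences of distinct coordinates, which are uniformly
  distributed on the torus, and there are finitely many of them. The potential may therefore be
  altered on a null set.\<close>

lemma partition_function_cong_AE:
  assumes [measurable]: "W \<in> borel_measurable (torus d)" "W' \<in> borel_measurable (torus d)"
    and ae: "AE x in torus d. W x = W' x"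
  shows "partition_function d W N \<beta> = partition_function d W' N \<beta>"
proof -
  let ?P = "PiM {1..N} (\<lambda>_. torus d)"
  have m: "(\<lambda>x. torus_diff d (x i) (x j)) \<in> measurable ?P (torus d)" if "i \<in> {1..N}" "j \<in> {1..N} - {i}" for i j
    using that by (intro torus_diff_measurable) auto
  have *: "AE x in ?P. W (torus_diff d (x i) (x j)) = W' (torus_diff d (x i) (x j))"
    if ij: "i \<in> {1..N}" "j \<in> {1..N} - {i}" for i j
  proof -
    have "distr ?P (torus d) (\<lambda>x. torus_diff d (x i) (x j)) = torus d"
      using ij by (intro distr_torus_diff_components) auto
    then have "AE x in distr ?P (torus d) (\<lambda>x. torus_diff d (x i) (x j)). W x = W' x"
      by (simp only: ae)
    then show ?thesis using m[OF ij] by (subst (asm) AE_distr_iff) auto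
  qed
  have "AE x in ?P. \<forall>i\<in>{1..N}. \<forall>j\<in>{1..N} - {i}. W (torus_diff d (x i) (x j)) = W' (torus_diff d (x i) (x j))"
    using * by (intro AE_finite_allI) auto
  moreover have "(\<lambda>x. exp (- (\<beta> / (2 * real N)) * (\<Sum>i\<in>{1..N}. \<Sum>j\<in>{1..N} - {i}. V (torus_diff d (x i) (x j)))))
    \<in> borel_measurable ?P" if "V \<in> borel_measurable (torus d)" for V
    by (intro borel_measurable_exp[THEN measurable_compose[rotated]] borel_measurable_times borel_measurable_const
        borel_measurable_sum measurable_compose[OF m that]) auto
  ultimately show ?thesis
    unfolding partition_function_def
    by (intro integral_cong_AE) (auto elim!: eventually_mono intro!: arg_cong[where f = exp] sum.cong simp del: mult_cancel_left)
qed

lemma (in prob_space) esssup_abs_nonneg: "0 \<le> esssup M (\<lambda>x. ereal \<bar>f x\<bar>)"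
proof (rule ccontr)
  assume neg: "\<not> 0 \<le> esssup M (\<lambda>x. ereal \<bar>f x\<bar>)"
  have "AE x in M. False"
  proof (rule eventually_mono[OF esssup_AE[of "\<lambda>x. ereal \<bar>f x\<bar>"]])
    fix x assume "ereal \<bar>f x\<bar> \<le> esssup M (\<lambda>x. ereal \<bar>f x\<bar>)"
    moreover have "0 \<le> ereal \<bar>f x\<bar>" by simp
    ultimately show False using neg order_trans by blast
  qed
  then show False by simp
qed

lemma (in prob_space) Linf_norm_nonneg: "0 \<le> Linf_norm M f"
  unfolding Linf_norm_def by (intro real_of_ereal_pos esssup_abs_nonneg)

lemma partition_function_bounds:
  assumes W: "admissible_potential d W" and "0 < \<beta>" "1 \<le> N"
    and small: "\<beta> * (L1_norm (torus d) W + Linf_norm (torus d) (neg_part W)) \<le> 1 / 128"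
  shows "1 \<le> partition_function d W N \<beta>"
    and "partition_function d W N \<beta> \<le> exp (129 * (real N)\<^sup>2 * (\<integral>x. quad_lin (\<beta> * W x / real N) \<partial>torus d))"
proof -
  interpret T: prob_space "torus d" by (rule prob_space_torus)
  have int: "integrable (torus d) W" and mean: "(\<integral>x. W x \<partial>torus d) = 0"
    and even: "AE x in torus d. W (torus_uminus d x) = W x" and inf: "in_Linf (torus d) (neg_part W)"
    using W by (auto simp: admissible_potential_def)
  then have [measurable]: "W \<in> borel_measurable (torus d)" by auto
  define L where "L = Linf_norm (torus d) (neg_part W)"
  let ?e = "esssup (torus d) (\<lambda>x. ereal \<bar>neg_part W x\<bar>)"
  have ae0: "AE x in torus d. ereal \<bar>neg_part W x\<bar> \<le> ?e" by (rule esssup_AE)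
  have "0 \<le> ?e" "?e < \<infinity>"
    using inf by (auto simp: in_Linf_def intro: T.esssup_abs_nonneg)
  then have e: "?e = ereal L" and L: "0 \<le> L"
    unfolding L_def Linf_norm_def by (auto simp: ereal_real real_of_ereal_pos)
  have aeL: "AE x in torus d. - L \<le> W x"
    using ae0 unfolding e by eventually_elim (auto simp: neg_part_def)
  \<comment> \<open>\<open>W\<close> is even and bounded below only almost everywhere; \<open>V\<close> has both properties at every point.\<close>
  define V where "V x = max ((W x + W (torus_uminus d x)) / 2) (- L)" for x
  have [measurable]: "V \<in> borel_measurable (torus d)" unfolding V_def by measurable
  have ae: "AE x in torus d. W x = V x"
    using even aeL by eventually_elim (simp add: V_def)
  have intV: "integrable (torus d) V"
    using int ae by (subst integrable_cong_AE[of _ _ W]) auto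
  have *: "(\<integral>x. f (V x) \<partial>torus d) = (\<integral>x. f (W x) \<partial>torus d)" if [measurable]: "f \<in> borel_measurable borel" for f :: "real \<Rightarrow> real"
    using ae by (intro integral_cong_AE) (auto elim!: eventually_mono)
  interpret R: regular_potential d N V \<beta> L
  proof
    show "(\<integral>x. V x \<partial>torus d) = 0" using *[of "\<lambda>x. x"] mean by simp
    show "\<beta> * ((\<integral>x. \<bar>V x\<bar> \<partial>torus d) + L) \<le> 1 / 128" using *[of abs] small by (simp add: L_def L1_norm_def)
    show "V (torus_uminus d x) = V x" if "x \<in> space (torus d)" for x
      using that by (simp add: V_def torus_uminus_uminus add.commute)
  qed (use assms L intV in \<open>auto simp: V_def\<close>)
  have eq: "partition_function d W N \<beta> = partition_function d V N \<beta>"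
    by (rule partition_function_cong_AE[OF _ _ ae]) measurable
  show "1 \<le> partition_function d W N \<beta>" unfolding eq by (rule R.partition_ge_1)
  have "(\<lambda>w. quad_lin (\<beta> * w / real N)) \<in> borel_measurable borel" by measurable
  from *[OF this] R.partition_le
  show "partition_function d W N \<beta> \<le> exp (129 * (real N)\<^sup>2 * (\<integral>x. quad_lin (\<beta> * W x / real N) \<partial>torus d))"
    unfolding eq R.u_def by simp
qed

section \<open>Weak-type bounds\<close>

text \<open>In place of the exact layer-cake formula, the integral is bounded below on the window
  from |w|/2 to |w|, where the increasing integrand is at least 4 min(|w|/2, 1). The factor 4 is
  what makes the window alone sufficient in both regimes of \<open>quad_lin\<close>.\<close>

lemma quad_lin_le_layer:
  fixes w :: real
  shows "ennreal (quad_lin w) \<le> (\<integral>\<^sup>+t. ennreal (4 * min t 1) * indicator {0<..<\<bar>w\<bar>} t \<partial>lborel)"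
proof -
  let ?r = "\<bar>w\<bar>"
  have "quad_lin w \<le> (?r - ?r / 2) * (4 * min (?r / 2) 1)"
  proof (cases "?r \<le> 2")
    case True
    then have "(?r - ?r / 2) * (4 * min (?r / 2) 1) = w\<^sup>2"
      by (simp add: min_def power2_eq_square field_simps)
    then show ?thesis by (simp add: quad_lin_def)
  qed (simp add: quad_lin_def min_def)
  then have "ennreal (quad_lin w) \<le> ennreal (?r - ?r / 2) * ennreal (4 * min (?r / 2) 1)"
    by (subst ennreal_mult[symmetric]) (auto intro!: ennreal_leI)
  also have "\<dots> = (\<integral>\<^sup>+t. ennreal (4 * min (?r / 2) 1) * indicator {?r / 2<..<?r} t \<partial>lborel)"
    by (subst nn_integral_cmult_indicator) (auto simp: mult.commute)
  also have "\<dots> \<le> (\<integral>\<^sup>+t. ennreal (4 * min t 1) * indicator {0<..<?r} t \<partial>lborel)"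
    by (intro nn_integral_mono) (auto split: split_indicator intro!: ennreal_leI)
  finally show ?thesis .
qed

lemma ennreal_4_mult_le: "ennreal (4 * x) \<le> 4 * ennreal x" "ennreal (4 * x) \<le> 4 * ennreal x + z"
  using ennreal_mult'[of 4 x] by (auto intro: add_increasing2)

lemma ennreal_linear:
  "0 \<le> x \<Longrightarrow> 0 \<le> y \<Longrightarrow> 0 \<le> z \<Longrightarrow> 0 \<le> b \<Longrightarrow>
    ennreal 4 * ennreal x + (ennreal b * ennreal y + ennreal b * ennreal z) = ennreal (4 * x + (b * y + b * z))"
  by (simp add: ennreal_mult)

text \<open>Layer cake by Tonelli. The majorant k is left free so that each weak-type condition can
  choose its own cuts in t.\<close>

lemma (in prob_space) quad_lin_integral_le:
  fixes f :: "'a \<Rightarrow> real" and k :: "real \<Rightarrow> real"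
  assumes [measurable]: "f \<in> borel_measurable M"
    and k: "\<And>t. 0 < t \<Longrightarrow> 4 * min t 1 * measure M {x\<in>space M. \<bar>f x\<bar> > t} \<le> k t"
    and R: "(\<integral>\<^sup>+t. ennreal (k t) * indicator {0<..} t \<partial>lborel) \<le> ennreal R" "0 \<le> R"
  shows "(\<integral>x. quad_lin (f x) \<partial>M) \<le> R"
proof (rule integral_real_bounded[OF R(2)])
  interpret L: pair_sigma_finite M lborel ..
  have "(\<integral>\<^sup>+x. ennreal (quad_lin (f x)) \<partial>M)
      \<le> (\<integral>\<^sup>+x. (\<integral>\<^sup>+t. ennreal (4 * min t 1) * indicator {0<..<\<bar>f x\<bar>} t \<partial>lborel) \<partial>M)"
    by (intro nn_integral_mono quad_lin_le_layer)
  also have "\<dots> = (\<integral>\<^sup>+x. (\<integral>\<^sup>+t. ennreal (4 * min t 1) * indicator {p. 0 < snd p \<and> snd p < \<bar>f (fst p)\<bar>} (x, t) \<partial>lborel) \<partial>M)"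
    by (intro nn_integral_cong) (auto split: split_indicator)
  also have "\<dots> = (\<integral>\<^sup>+t. (\<integral>\<^sup>+x. ennreal (4 * min t 1) * indicator {p. 0 < snd p \<and> snd p < \<bar>f (fst p)\<bar>} (x, t) \<partial>M) \<partial>lborel)"
    by (rule L.Fubini'[symmetric]) measurable
  also have "\<dots> \<le> (\<integral>\<^sup>+t. ennreal (k t) * indicator {0<..} t \<partial>lborel)"
  proof (intro nn_integral_mono)
    fix t :: real
    show "(\<integral>\<^sup>+x. ennreal (4 * min t 1) * indicator {p. 0 < snd p \<and> snd p < \<bar>f (fst p)\<bar>} (x, t) \<partial>M)
        \<le> ennreal (k t) * indicator {0<..} t"
    proof (cases "0 < t")
      case True
      have "(\<integral>\<^sup>+x. ennreal (4 * min t 1) * indicator {p. 0 < snd p \<and> snd p < \<bar>f (fst p)\<bar>} (x, t) \<partial>M)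
        = (\<integral>\<^sup>+x. ennreal (4 * min t 1) * indicator {x\<in>space M. \<bar>f x\<bar> > t} x \<partial>M)"
        using True by (intro nn_integral_cong) (auto split: split_indicator)
      also have "\<dots> = ennreal (4 * min t 1) * emeasure M {x\<in>space M. \<bar>f x\<bar> > t}"
        by (subst nn_integral_cmult_indicator) auto
      also have "\<dots> = ennreal (4 * min t 1 * measure M {x\<in>space M. \<bar>f x\<bar> > t})"
        using True by (simp add: emeasure_eq_measure ennreal_mult)
      also have "\<dots> \<le> ennreal (k t)" by (intro ennreal_leI k True)
      finally show ?thesis using True by simp
    next
      case False
      then show ?thesis by simp
    qed
  qed
  also note R(1)
  finally show "(\<integral>\<^sup>+x. ennreal (quad_lin (f x)) \<partial>M) \<le> ennreal R" .
qed

lemma nn_integral_powr_Icc_0: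
  assumes "-1 < e" "0 \<le> c"
  shows "(\<integral>\<^sup>+t. ennreal (t powr e) * indicator {0..c} t \<partial>lborel) = ennreal (c powr (e + 1) / (e + 1))"
  using has_integral_powr_from_0[OF assms] by (intro nn_integral_has_integral_lebesgue') auto

lemma nn_integral_powr_atLeast:
  assumes "e < -1" "0 < c"
  shows "(\<integral>\<^sup>+t. ennreal (t powr e) * indicator {c..} t \<partial>lborel) = ennreal (- (c powr (e + 1)) / (e + 1))"
  using has_integral_powr_to_inf[OF assms] by (intro nn_integral_has_integral_lebesgue') auto

lemma nn_integral_inverse_Icc:
  assumes "0 < a" "a \<le> b"
  shows "(\<integral>\<^sup>+t. ennreal (1 / t) * indicator {a..b} t \<partial>lborel) = ennreal (ln b - ln a)"
  using assms
  by (intro nn_integral_FTC_Icc) (auto intro!: derivative_eq_intros simp: field_simps)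

section \<open>Weak-type conditions at, below and above the exponent 2\<close>

context prob_space
begin

text \<open>Below h the measure is bounded by 1; between h and 1 the integrand is of order B / t,
  whence the logarithm; above 1 the truncation makes the tail B / t^2 integrable. The cut h is later
  taken to be 1 / N, so that h^2 N^2 stays constant.\<close>

lemma quad_lin_weak_2:
  fixes f :: "'a \<Rightarrow> real"
  assumes f: "f \<in> borel_measurable M" and B: "0 \<le> B" and h: "0 < h" "h \<le> 1"
    and weak: "\<And>t. 0 < t \<Longrightarrow> measure M {x\<in>space M. \<bar>f x\<bar> > t} \<le> B / t\<^sup>2"
  shows "(\<integral>x. quad_lin (f x) \<partial>M) \<le> 2 * h\<^sup>2 + 4 * B * (ln (1 / h) + 1)"
proof (rule quad_lin_integral_le[OF f, where k = "\<lambda>t. if t \<le> h then 4 * t else if t \<le> 1 then 4 * B * (1 / t) else 4 * B * t powr (-2)"])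
  fix t :: real assume t: "0 < t"
  let ?m = "measure M {x\<in>space M. \<bar>f x\<bar> > t}"
  have m: "?m \<le> 1" "?m \<le> B / t\<^sup>2" "0 \<le> ?m" using weak[OF t] by (auto simp: measure_nonneg)
  have "4 * t * ?m \<le> 4 * t * (B / t\<^sup>2)" using m t by (intro mult_left_mono) auto
  then show "4 * min t 1 * ?m \<le> (if t \<le> h then 4 * t else if t \<le> 1 then 4 * B * (1 / t) else 4 * B * t powr (-2))"
    using t m h by (auto simp: min_def power2_eq_square powr_minus powr_numeral divide_simps mult_left_le)
next
  let ?k = "\<lambda>t. if t \<le> h then 4 * t else if t \<le> 1 then 4 * B * (1 / t) else 4 * B * t powr (-2)"
  have "(\<integral>\<^sup>+t. ennreal (?k t) * indicator {0<..} t \<partial>lborel)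
      \<le> (\<integral>\<^sup>+t. ennreal 4 * (ennreal (t powr 1) * indicator {0..h} t) + (ennreal (4 * B) * (ennreal (1 / t) * indicator {h..1} t)
        + ennreal (4 * B) * (ennreal (t powr (-2)) * indicator {1..} t)) \<partial>lborel)"
    using h B
    by (intro nn_integral_mono) (auto simp: ennreal_mult'[symmetric] ennreal_plus[symmetric] simp del: ennreal_plus split: split_indicator intro!: ennreal_leI ennreal_4_mult_le)
  also have "\<dots> = ennreal 4 * ennreal (h powr 2 / 2) + (ennreal (4 * B) * ennreal (ln 1 - ln h)
      + ennreal (4 * B) * ennreal (- (1 powr (-1)) / (-1)))"
    using nn_integral_powr_Icc_0[of 1 h] nn_integral_inverse_Icc[of h 1] nn_integral_powr_atLeast[of "-2" 1] h
    by (simp add: nn_integral_add nn_integral_cmult)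
  also have "\<dots> = ennreal (4 * (h\<^sup>2 / 2) + (4 * B * (ln 1 - ln h) + 4 * B * 1))"
    using ennreal_linear[of "h powr 2 / 2" "ln 1 - ln h" 1 "4 * B"] h B by (simp add: ennreal_mult)
  also have "4 * (h\<^sup>2 / 2) + (4 * B * (ln 1 - ln h) + 4 * B * 1) = 2 * h\<^sup>2 + 4 * B * (ln (1 / h) + 1)"
    using h by (simp add: ln_div algebra_simps)
  finally show "(\<integral>\<^sup>+t. ennreal (?k t) * indicator {0<..} t \<partial>lborel) \<le> ennreal (2 * h\<^sup>2 + 4 * B * (ln (1 / h) + 1))" .
  show "0 \<le> 2 * h\<^sup>2 + 4 * B * (ln (1 / h) + 1)"
    using h B by (intro add_nonneg_nonneg mult_nonneg_nonneg) auto
qed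

lemma weak_layer_le:
  fixes f :: "'a \<Rightarrow> real"
  assumes t: "0 < t" and weak: "measure M {x\<in>space M. \<bar>f x\<bar> > t} \<le> B * t powr (-p)"
  shows "4 * min t 1 * measure M {x\<in>space M. \<bar>f x\<bar> > t} \<le> 4 * B * t powr (1 - p)"
    and "4 * min t 1 * measure M {x\<in>space M. \<bar>f x\<bar> > t} \<le> 4 * B * t powr (-p)"
    and "4 * min t 1 * measure M {x\<in>space M. \<bar>f x\<bar> > t} \<le> 4 * t"
proof -
  let ?m = "measure M {x\<in>space M. \<bar>f x\<bar> > t}"
  have m: "?m \<le> 1" "0 \<le> ?m" by (auto simp: measure_nonneg)
  have 1: "4 * min t 1 * ?m \<le> 4 * t * ?m" "4 * min t 1 * ?m \<le> 4 * 1 * ?m"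
    using mult_right_mono[of "min t 1" t ?m] mult_right_mono[of "min t 1" 1 ?m] m(2) by simp_all
  have "t powr (1 - p) = t * t powr (-p)" using t powr_add[of t 1 "-p"] by simp
  moreover have "4 * t * ?m \<le> 4 * t * (B * t powr (-p))" "4 * t * ?m \<le> 4 * t * 1" "4 * 1 * ?m \<le> 4 * 1 * (B * t powr (-p))"
    using m t weak by (auto intro!: mult_left_mono)
  ultimately show "4 * min t 1 * ?m \<le> 4 * B * t powr (1 - p)" "4 * min t 1 * ?m \<le> 4 * B * t powr (-p)"
    "4 * min t 1 * ?m \<le> 4 * t" using 1 by (auto simp: mult_ac)
qed

text \<open>Here t^(1-p) is integrable at 0 because p < 2, and t^(-p) at infinity because p > 1, so
  a single cut at 1 is enough.\<close>

lemma quad_lin_weak_lt2: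
  fixes f :: "'a \<Rightarrow> real"
  assumes f: "f \<in> borel_measurable M" and B: "0 \<le> B" and p: "1 < p" "p < 2"
    and weak: "\<And>t. 0 < t \<Longrightarrow> measure M {x\<in>space M. \<bar>f x\<bar> > t} \<le> B * t powr (- p)"
  shows "(\<integral>x. quad_lin (f x) \<partial>M) \<le> 4 * B * (1 / (2 - p) + 1 / (p - 1))"
proof (rule quad_lin_integral_le[OF f, where k = "\<lambda>t. if t \<le> 1 then 4 * B * t powr (1 - p) else 4 * B * t powr (- p)"])
  fix t :: real assume t: "0 < t"
  show "4 * min t 1 * measure M {x\<in>space M. \<bar>f x\<bar> > t} \<le> (if t \<le> 1 then 4 * B * t powr (1 - p) else 4 * B * t powr (- p))"
    by (cases "t \<le> 1") (use weak_layer_le[OF t weak[OF t]] in \<open>simp_all only: if_True if_False simp_thms\<close>)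
next
  let ?k = "\<lambda>t. if t \<le> 1 then 4 * B * t powr (1 - p) else 4 * B * t powr (- p)"
  have "(\<integral>\<^sup>+t. ennreal (?k t) * indicator {0<..} t \<partial>lborel)
      \<le> (\<integral>\<^sup>+t. ennreal (4 * B) * (ennreal (t powr (1 - p)) * indicator {0..1} t)
        + ennreal (4 * B) * (ennreal (t powr (- p)) * indicator {1..} t) \<partial>lborel)"
    using B
    by (intro nn_integral_mono) (auto simp: ennreal_mult'[symmetric] ennreal_plus[symmetric] simp del: ennreal_plus split: split_indicator intro!: ennreal_leI)
  also have "\<dots> = ennreal (4 * B) * ennreal (1 powr (1 - p + 1) / (1 - p + 1))
      + ennreal (4 * B) * ennreal (- (1 powr (- p + 1)) / (- p + 1))"
    using nn_integral_powr_Icc_0[of "1 - p" 1] nn_integral_powr_atLeast[of "-p" 1] p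
    by (simp add: nn_integral_add nn_integral_cmult)
  also have "\<dots> = ennreal (4 * B * (1 / (2 - p)) + 4 * B * (- 1 / (1 - p)))"
    using p B by (simp add: ennreal_mult'[symmetric] ennreal_plus[symmetric] divide_nonneg_neg divide_nonpos_neg del: ennreal_plus)
  also have "- 1 / (1 - p) = 1 / (p - 1)" using p by (simp add: divide_simps)
  finally show "(\<integral>\<^sup>+t. ennreal (?k t) * indicator {0<..} t \<partial>lborel) \<le> ennreal (4 * B * (1 / (2 - p) + 1 / (p - 1)))"
    by (simp add: distrib_left)
  show "0 \<le> 4 * B * (1 / (2 - p) + 1 / (p - 1))" using p B by simp
qed

text \<open>Now t^(1-p) is integrable at infinity but not at 0. The mass sits near the cut h, below
  which the measure is bounded by 1.\<close>

lemma quad_lin_weak_gt2: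
  fixes f :: "'a \<Rightarrow> real"
  assumes f: "f \<in> borel_measurable M" and B: "0 \<le> B" and p: "2 < p" and h: "0 < h"
    and weak: "\<And>t. 0 < t \<Longrightarrow> measure M {x\<in>space M. \<bar>f x\<bar> > t} \<le> B * t powr (- p)"
  shows "(\<integral>x. quad_lin (f x) \<partial>M) \<le> 2 * h\<^sup>2 + 4 * B * (h powr (2 - p) / (p - 2))"
proof (rule quad_lin_integral_le[OF f, where k = "\<lambda>t. if t \<le> h then 4 * t else 4 * B * t powr (1 - p)"])
  fix t :: real assume t: "0 < t"
  show "4 * min t 1 * measure M {x\<in>space M. \<bar>f x\<bar> > t} \<le> (if t \<le> h then 4 * t else 4 * B * t powr (1 - p))"
    using weak_layer_le[OF t weak[OF t]] by simp
next
  let ?k = "\<lambda>t. if t \<le> h then 4 * t else 4 * B * t powr (1 - p)"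
  have "(\<integral>\<^sup>+t. ennreal (?k t) * indicator {0<..} t \<partial>lborel)
      \<le> (\<integral>\<^sup>+t. ennreal 4 * (ennreal (t powr 1) * indicator {0..h} t)
        + ennreal (4 * B) * (ennreal (t powr (1 - p)) * indicator {h..} t) \<partial>lborel)"
    using B h
    by (intro nn_integral_mono) (auto simp: ennreal_mult'[symmetric] ennreal_plus[symmetric] simp del: ennreal_plus split: split_indicator intro!: ennreal_leI ennreal_4_mult_le)
  also have "\<dots> = ennreal 4 * ennreal (h powr 2 / 2)
      + ennreal (4 * B) * ennreal (- (h powr (1 - p + 1)) / (1 - p + 1))"
    using nn_integral_powr_Icc_0[of 1 h] nn_integral_powr_atLeast[of "1 - p" h] p h
    by (simp add: nn_integral_add nn_integral_cmult)
  also have "- (h powr (1 - p + 1)) / (1 - p + 1) = h powr (2 - p) / (p - 2)"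
    using p by (simp add: divide_simps) (simp add: algebra_simps)
  also have "ennreal 4 * ennreal (h powr 2 / 2) + ennreal (4 * B) * ennreal (h powr (2 - p) / (p - 2))
      = ennreal (4 * (h\<^sup>2 / 2) + 4 * B * (h powr (2 - p) / (p - 2)))"
    using ennreal_linear[of "h powr 2 / 2" "h powr (2 - p) / (p - 2)" 0 "4 * B"] p B h by simp
  finally show "(\<integral>\<^sup>+t. ennreal (?k t) * indicator {0<..} t \<partial>lborel) \<le> ennreal (2 * h\<^sup>2 + 4 * B * (h powr (2 - p) / (p - 2)))"
    by simp
  show "0 \<le> 2 * h\<^sup>2 + 4 * B * (h powr (2 - p) / (p - 2))" using p B by simp
qed

end

lemma weak_L2_bound:
  assumes "in_weak_L2 M f" "0 < t"
  shows "measure M {x\<in>space M. \<bar>f x\<bar> > t} \<le> (weak_L2_norm M f)\<^sup>2 / t\<^sup>2"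
proof -
  let ?m = "measure M {x\<in>space M. \<bar>f x\<bar> > t}"
  have "ennreal (t * sqrt ?m) \<le> weak_L2_enorm M f"
    unfolding weak_L2_enorm_def using assms(2) by (intro SUP_upper) auto
  also have "\<dots> = ennreal (weak_L2_norm M f)"
    using assms(1) by (simp add: in_weak_L2_def weak_L2_norm_def)
  finally have "t * sqrt ?m \<le> weak_L2_norm M f"
    by (subst (asm) ennreal_le_iff) (auto simp: weak_L2_norm_def)
  then have "(t * sqrt ?m)\<^sup>2 \<le> (weak_L2_norm M f)\<^sup>2"
    using assms(2) by (intro power_mono) (auto simp: measure_nonneg)
  then show ?thesis
    using assms(2) by (simp add: power_mult_distrib measure_nonneg field_simps)
qed

section \<open>Uniqueness of Fourier coefficients\<close>

text \<open>
  The coordinates beyond $d$ are constant, so that the torus becomes a compact subset of the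
  metric space \<open>nat \<Rightarrow> complex\<close>.
\<close>

definition embed :: "nat \<Rightarrow> (nat \<Rightarrow> real) \<Rightarrow> nat \<Rightarrow> complex" where
  "embed d x = (\<lambda>k. if k < d then cis (2 * pi * x k) else 1)"

definition character :: "nat \<Rightarrow> (nat \<Rightarrow> int) \<Rightarrow> (nat \<Rightarrow> real) \<Rightarrow> complex" where
  "character d \<xi> x = cis (- 2 * pi * (\<Sum>k<d. real_of_int (\<xi> k) * x k))"

text \<open>Polynomials in the first d coordinates and their conjugates, taken as functions on the
  whole space so that continuity and Stone-Weierstrass apply there. Composed with
  \<open>embed\<close>, the monomials become multiples of characters.\<close>

inductive_set trig_poly :: "nat \<Rightarrow> ((nat \<Rightarrow> complex) \<Rightarrow> complex) set" for d where
  monomial: "(\<lambda>z. c * (\<Prod>k<d. z k ^ a k * cnj (z k) ^ b k)) \<in> trig_poly d"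
| add: "f \<in> trig_poly d \<Longrightarrow> g \<in> trig_poly d \<Longrightarrow> (\<lambda>z. f z + g z) \<in> trig_poly d"

lemma trig_poly_const: "(\<lambda>_. c) \<in> trig_poly d"
  using trig_poly.monomial[where c = c and a = "\<lambda>_. 0" and b = "\<lambda>_. 0"] by simp

lemma trig_poly_mult:
  assumes "f \<in> trig_poly d" "g \<in> trig_poly d"
  shows "(\<lambda>z. f z * g z) \<in> trig_poly d"
  using assms
proof (induction arbitrary: g rule: trig_poly.induct)
  case (monomial c a b)
  from monomial.prems show ?case
  proof (induction rule: trig_poly.induct)
    case (monomial c' a' b')
    have "(\<lambda>z. c * (\<Prod>k<d. z k ^ a k * cnj (z k) ^ b k) * (c' * (\<Prod>k<d. z k ^ a' k * cnj (z k) ^ b' k)))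
        = (\<lambda>z. (c * c') * (\<Prod>k<d. z k ^ (a k + a' k) * cnj (z k) ^ (b k + b' k)))"
      by (rule ext) (simp add: power_add prod.distrib mult_ac)
    then show ?case by (simp only: trig_poly.monomial)
  next
    case (add f g)
    then show ?case by (simp add: distrib_left trig_poly.add)
  qed
next
  case (add f h)
  then show ?case by (simp add: distrib_right trig_poly.add)
qed

lemma trig_poly_cnj:
  assumes "f \<in> trig_poly d"
  shows "(\<lambda>z. cnj (f z)) \<in> trig_poly d"
  using assms
proof (induction rule: trig_poly.induct)
  case (monomial c a b)
  have "(\<lambda>z. cnj (c * (\<Prod>k<d. z k ^ a k * cnj (z k) ^ b k))) = (\<lambda>z. cnj c * (\<Prod>k<d. z k ^ b k * cnj (z k) ^ a k))"
    by (rule ext) (simp add: cnj_prod mult.commute)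
  then show ?case by (simp only: trig_poly.monomial)
next
  case (add f g)
  then show ?case by (simp add: trig_poly.add)
qed

lemma trig_poly_coord:
  assumes "k < d"
  shows "(\<lambda>z. c * z k) \<in> trig_poly d"
proof -
  have "(\<Prod>j<d. z j ^ (if j = k then 1 else 0) * cnj (z j) ^ 0) = z k" for z :: "nat \<Rightarrow> complex"
  proof -
    have "(\<Prod>j<d. z j ^ (if j = k then 1 else 0) * cnj (z j) ^ 0) = (\<Prod>j<d. if j = k then z j else 1)"
      by (intro prod.cong) auto
    then show ?thesis using assms by simp
  qed
  then show ?thesis
    using trig_poly.monomial[where c = c and a = "\<lambda>j. if j = k then 1 else 0" and b = "\<lambda>_. 0" and d = d]
    by (simp only:)
qed

lemma continuous_on_trig_poly:
  assumes "f \<in> trig_poly d"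
  shows "continuous_on S f"
  using assms
proof (induction rule: trig_poly.induct)
  case (monomial c a b)
  have "continuous_on S (\<lambda>z :: nat \<Rightarrow> complex. z k)" for k
    by (rule continuous_on_subset[OF continuous_on_product_coordinates]) auto
  then show ?case by (intro continuous_intros)
qed (intro continuous_intros)

definition poly_circle :: "nat \<Rightarrow> (nat \<Rightarrow> complex) set" where
  "poly_circle d = PiE UNIV (\<lambda>k. if k < d then sphere 0 1 else {1})"

lemma compact_poly_circle: "compact (poly_circle d)"
proof -
  have "compactin (product_topology (\<lambda>_. euclidean) UNIV) (poly_circle d)"
    unfolding poly_circle_def compactin_PiE by auto
  then show ?thesis by (simp add: euclidean_product_topology)
qed

lemma embed_in_poly_circle: "embed d x \<in> poly_circle d"
  by (auto simp: embed_def poly_circle_def)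

text \<open>Stone-Weierstrass is applied in its real form, hence the real parts. Points are
  separated by Re z_k and Re(-i z_k) = Im z_k for some k < d, since the later coordinates are
  constant on the set.\<close>

lemma function_ring_trig_poly:
  "function_ring_on ((\<lambda>f z. Re (f z)) ` trig_poly d) (poly_circle d)"
proof
  show "compact (poly_circle d)" by (rule compact_poly_circle)
next
  fix f assume "f \<in> (\<lambda>f z. Re (f z)) ` trig_poly d"
  then show "continuous_on (poly_circle d) f"
    by (auto intro!: continuous_intros continuous_on_trig_poly)
next
  fix f g assume "f \<in> (\<lambda>f z. Re (f z)) ` trig_poly d" "g \<in> (\<lambda>f z. Re (f z)) ` trig_poly d"
  then obtain F G where F: "F \<in> trig_poly d" "f = (\<lambda>z. Re (F z))" and G: "G \<in> trig_poly d" "g = (\<lambda>z. Re (G z))"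
    by auto
  have "(\<lambda>z. f z + g z) = (\<lambda>z. Re (F z + G z))" using F G by simp
  then show "(\<lambda>z. f z + g z) \<in> (\<lambda>f z. Re (f z)) ` trig_poly d"
    using trig_poly.add[OF F(1) G(1)] by (auto intro!: image_eqI)
  \<comment> \<open>Re F Re G = Re (F G + F cnj G) / 2 shows that real parts of trigonometric
    polynomials are closed under products.\<close>
  have "(\<lambda>z. 1 / 2 * (F z * G z + F z * cnj (G z))) \<in> trig_poly d"
    by (intro trig_poly_mult trig_poly_const trig_poly.add trig_poly_cnj F G)
  moreover have "(\<lambda>z. f z * g z) = (\<lambda>z. Re (1 / 2 * (F z * G z + F z * cnj (G z))))"
    using F G by (auto simp: fun_eq_iff)
  ultimately show "(\<lambda>z. f z * g z) \<in> (\<lambda>f z. Re (f z)) ` trig_poly d"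
    by (intro image_eqI)
next
  fix c show "(\<lambda>_. c) \<in> (\<lambda>f z. Re (f z)) ` trig_poly d"
    using trig_poly_const[of "complex_of_real c" d] by (auto intro!: image_eqI)
next
  fix x y assume xy: "x \<in> poly_circle d" "y \<in> poly_circle d" "x \<noteq> y"
  then obtain k where k: "x k \<noteq> y k" by auto
  then have "k < d" using xy by (auto simp: poly_circle_def PiE_iff split: if_splits) (metis singletonD)
  from trig_poly_coord[OF this] have 1: "(\<lambda>z. Re (c * z k)) \<in> (\<lambda>f z. Re (f z)) ` trig_poly d" for c
    by (auto intro!: image_eqI)
  have "Re (1 * x k) \<noteq> Re (1 * y k) \<or> Re (-\<i> * x k) \<noteq> Re (-\<i> * y k)"
    using k by (auto simp: complex_eq_iff)
  then show "\<exists>f\<in>(\<lambda>f z. Re (f z)) ` trig_poly d. f x \<noteq> f y"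
    by (elim disjE) (rule bexI[OF _ 1[of 1]], assumption, rule bexI[OF _ 1[of "-\<i>"]], assumption)
qed

lemma cis_sum: "finite A \<Longrightarrow> cis (sum f A) = (\<Prod>k\<in>A. cis (f k))"
  by (induction A rule: finite_induct) (auto simp: cis_mult[symmetric])

lemma monomial_embed:
  "(\<Prod>k<d. embed d x k ^ a k * cnj (embed d x k) ^ b k) = character d (\<lambda>k. int (b k) - int (a k)) x"
proof -
  have "(\<Prod>k<d. embed d x k ^ a k * cnj (embed d x k) ^ b k) = (\<Prod>k<d. cis (2 * pi * ((real (a k) - real (b k)) * x k)))"
  proof (intro prod.cong refl)
    fix k assume "k \<in> {..<d}"
    have "cis t ^ a k * cnj (cis t) ^ b k = cis (real (a k) * t + real (b k) * (- t))" for t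
      unfolding cis_cnj Complex.DeMoivre cis_mult ..
    then show "embed d x k ^ a k * cnj (embed d x k) ^ b k = cis (2 * pi * ((real (a k) - real (b k)) * x k))"
      using \<open>k \<in> {..<d}\<close> by (simp add: embed_def algebra_simps)
  qed
  also have "\<dots> = cis (\<Sum>k<d. 2 * pi * ((real (a k) - real (b k)) * x k))"
    by (simp add: cis_sum)
  also have "(\<Sum>k<d. 2 * pi * ((real (a k) - real (b k)) * x k)) = - 2 * pi * (\<Sum>k<d. real_of_int (int (b k) - int (a k)) * x k)"
    by (simp add: sum_distrib_left sum_negf[symmetric] algebra_simps)
  finally show ?thesis by (simp add: character_def)
qed

lemma norm_character: "norm (character d \<xi> x) = 1"
  by (simp add: character_def)

lemma character_measurable [measurable]: "character d \<xi> \<in> borel_measurable (torus d)"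
proof -
  have [measurable]: "(\<lambda>x. \<Sum>k<d. real_of_int (\<xi> k) * x k) \<in> borel_measurable (torus d)"
    by (intro borel_measurable_sum borel_measurable_times borel_measurable_const torus_component) simp
  show ?thesis unfolding character_def cis_conv_exp by measurable
qed

lemma embed_measurable [measurable]: "embed d \<in> borel_measurable (torus d)"
proof (rule measurable_coordinatewise_then_product)
  fix k
  show "(\<lambda>x. embed d x k) \<in> borel_measurable (torus d)"
  proof (cases "k < d")
    case True
    then have [measurable]: "(\<lambda>x. x k) \<in> borel_measurable (torus d)" by (rule torus_component)
    show ?thesis using True unfolding embed_def cis_conv_exp by simp
  qed (simp add: embed_def)
qed

text \<open>
  The clamp is inactive on the unit circle; it is there for measurability, as \<open>arccos\<close> is
  unspecified outside $[-1,1]$.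
\<close>

definition angle :: "complex \<Rightarrow> real" where
  "angle c = (let a = arccos (max (- 1) (min 1 (Re c))) / (2 * pi) in if 0 \<le> Im c then a else 1 - a)"

lemma angle_cis:
  assumes "0 \<le> x" "x < 1"
  shows "angle (cis (2 * pi * x)) = x"
proof (cases "x \<le> 1 / 2")
  case True
  have 1: "0 \<le> 2 * pi * x" using assms by simp
  have 2: "2 * pi * x \<le> pi" using mult_left_mono[OF True, of "2 * pi"] by simp
  show ?thesis
    using sin_ge_zero[OF 1 2] arccos_cos[OF 1 2] by (simp add: angle_def min_absorb2 max_absorb2)
next
  case False
  have 1: "0 < 2 * pi * (1 - x)" using assms by simp
  have 2: "2 * pi * (1 - x) < pi" using mult_strict_left_mono[of "1 - x" "1 / 2" "2 * pi"] False by simp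
  have s: "sin (2 * pi * x) = - sin (2 * pi * (1 - x))" and c: "cos (2 * pi * x) = cos (2 * pi * (1 - x))"
    by (simp_all add: right_diff_distrib sin_diff cos_diff)
  have "sin (2 * pi * x) < 0" unfolding s using sin_gt_zero[OF 1 2] by simp
  moreover have "arccos (cos (2 * pi * x)) = 2 * pi * (1 - x)"
    unfolding c using 1 2 by (intro arccos_cos) auto
  ultimately show ?thesis by (simp add: angle_def min_absorb2 max_absorb2)
qed

text \<open>A Borel left inverse of \<open>embed\<close>. It exhibits every measurable set of the
  torus as the preimage under \<open>embed\<close> of a Borel set; \<open>frac\<close> only ensures
  values in the unit interval for arguments outside the image.\<close>

definition unembed :: "nat \<Rightarrow> (nat \<Rightarrow> complex) \<Rightarrow> nat \<Rightarrow> real" where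
  "unembed d z = (\<lambda>k\<in>{..<d}. frac (angle (z k)))"

lemma unembed_embed: "x \<in> space (torus d) \<Longrightarrow> unembed d (embed d x) = x"
  by (auto simp: unembed_def embed_def space_torus PiE_iff extensional_def fun_eq_iff angle_cis)

lemma unembed_measurable: "unembed d \<in> measurable borel (torus d)"
  unfolding unembed_def
proof (rule measurable_torusI)
  fix k
  have [measurable]: "(\<lambda>z :: nat \<Rightarrow> complex. z k) \<in> borel_measurable borel"
    by (intro borel_measurable_continuous_onI continuous_on_product_coordinates)
  have [measurable]: "(\<lambda>x. arccos (max (- 1) (min 1 x))) \<in> borel_measurable borel"
    by (intro borel_measurable_continuous_onI continuous_intros) auto
  show "(\<lambda>z. angle (z k)) \<in> borel_measurable borel"
    unfolding angle_def Let_def by measurable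
qed

section \<open>Densities with equal Fourier coefficients\<close>

lemma integrable_times_bounded:
  fixes f :: "'a \<Rightarrow> real" and h :: "'a \<Rightarrow> 'b :: {banach, second_countable_topology, real_normed_algebra_1}"
  assumes "integrable M f" "h \<in> borel_measurable M" "\<And>x. norm (h x) \<le> K"
  shows "integrable M (\<lambda>x. f x *\<^sub>R h x)"
proof (rule Bochner_Integration.integrable_bound[of M "\<lambda>x. K * \<bar>f x\<bar>"])
  show "AE x in M. norm (f x *\<^sub>R h x) \<le> norm (K * \<bar>f x\<bar>)"
  proof (rule AE_I2)
    fix x
    have "\<bar>f x\<bar> * norm (h x) \<le> \<bar>f x\<bar> * K" using assms(3) by (intro mult_left_mono) auto
    then show "norm (f x *\<^sub>R h x) \<le> norm (K * \<bar>f x\<bar>)" by (simp add: mult.commute)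
  qed
qed (use assms in auto)

text \<open>
  Densities are allowed on both sides in order to compare a signed density with a positive
  measure.
\<close>

locale same_fourier =
  fixes d :: nat and M1 M2 :: "(nat \<Rightarrow> real) measure" and f1 f2 :: "(nat \<Rightarrow> real) \<Rightarrow> real"
  assumes sets: "sets M1 = sets (torus d)" "sets M2 = sets (torus d)"
    and int: "integrable M1 f1" "integrable M2 f2"
    and eq: "(\<integral>x. f1 x *\<^sub>R character d \<xi> x \<partial>M1) = (\<integral>x. f2 x *\<^sub>R character d \<xi> x \<partial>M2)"
begin

lemma embed_measurable_M [measurable]: "embed d \<in> borel_measurable M1" "embed d \<in> borel_measurable M2"
  unfolding measurable_cong_sets[OF sets(1) refl] measurable_cong_sets[OF sets(2) refl]
  by (rule embed_measurable)+

lemma integral_trig_poly_eq: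
  assumes "F \<in> trig_poly d"
  shows "integrable M1 (\<lambda>x. f1 x *\<^sub>R F (embed d x)) \<and> integrable M2 (\<lambda>x. f2 x *\<^sub>R F (embed d x)) \<and>
    (\<integral>x. f1 x *\<^sub>R F (embed d x) \<partial>M1) = (\<integral>x. f2 x *\<^sub>R F (embed d x) \<partial>M2)"
  using assms
proof (induction rule: trig_poly.induct)
  case (monomial c a b)
  define \<xi> where "\<xi> = (\<lambda>k. int (b k) - int (a k))"
  have m: "character d \<xi> \<in> borel_measurable M1" "character d \<xi> \<in> borel_measurable M2"
    unfolding measurable_cong_sets[OF sets(1) refl] measurable_cong_sets[OF sets(2) refl]
    by (rule character_measurable)+
  have "integrable M1 (\<lambda>x. f1 x *\<^sub>R character d \<xi> x)" "integrable M2 (\<lambda>x. f2 x *\<^sub>R character d \<xi> x)"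
    by (intro integrable_times_bounded[where K = 1] int m; simp add: norm_character)+
  moreover have "f x *\<^sub>R (c * (\<Prod>k<d. embed d x k ^ a k * cnj (embed d x k) ^ b k))
      = c * (f x *\<^sub>R character d \<xi> x)" for f :: "(nat \<Rightarrow> real) \<Rightarrow> real" and x
    unfolding monomial_embed \<xi>_def by simp
  ultimately show ?case by (simp only: integrable_mult_right integral_mult_right_zero eq simp_thms)
next
  case (add F G)
  then show ?case by (simp add: scaleR_add_right)
qed

text \<open>A uniform approximation by trigonometric polynomials costs at most e times the total
  variation m of the two signed measures. The bound 1 on h makes the integrals exist.\<close>

lemma integral_continuous_eq:
  fixes h :: "(nat \<Rightarrow> complex) \<Rightarrow> real"
  assumes h: "continuous_on UNIV h" and b: "\<And>z. \<bar>h z\<bar> \<le> 1"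
  shows "(\<integral>x. f1 x * h (embed d x) \<partial>M1) = (\<integral>x. f2 x * h (embed d x) \<partial>M2)"
proof -
  interpret R: function_ring_on "(\<lambda>f z. Re (f z)) ` trig_poly d" "poly_circle d"
    by (rule function_ring_trig_poly)
  have [measurable]: "h \<in> borel_measurable borel" using h by (rule borel_measurable_continuous_onI)
  have hint: "integrable M1 (\<lambda>x. f1 x * h (embed d x))" "integrable M2 (\<lambda>x. f2 x * h (embed d x))"
    using int b integrable_times_bounded[of M1 f1 "\<lambda>x. h (embed d x)" 1] integrable_times_bounded[of M2 f2 "\<lambda>x. h (embed d x)" 1]
    by auto
  define m where "m = (\<integral>x. \<bar>f1 x\<bar> \<partial>M1) + (\<integral>x. \<bar>f2 x\<bar> \<partial>M2)"
  have m: "0 \<le> m" unfolding m_def by (intro add_nonneg_nonneg integral_nonneg_AE) auto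
  have bound: "\<bar>(\<integral>x. f1 x * h (embed d x) \<partial>M1) - (\<integral>x. f2 x * h (embed d x) \<partial>M2)\<bar> \<le> e * m"
    if e: "0 < e" for e
  proof -
    obtain F where F: "F \<in> trig_poly d" "\<And>z. z \<in> poly_circle d \<Longrightarrow> \<bar>h z - Re (F z)\<bar> < e"
      using R.Stone_Weierstrass_basic[OF continuous_on_subset[OF h] e] by auto
    note Fe = integral_trig_poly_eq[OF F(1)]
    have re: "integrable M1 (\<lambda>x. f1 x * Re (F (embed d x)))" "integrable M2 (\<lambda>x. f2 x * Re (F (embed d x)))"
      using Fe integrable_Re[of M1 "\<lambda>x. f1 x *\<^sub>R F (embed d x)"] integrable_Re[of M2 "\<lambda>x. f2 x *\<^sub>R F (embed d x)"]
      by simp_all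
    have "(\<integral>x. Re (f1 x *\<^sub>R F (embed d x)) \<partial>M1) = (\<integral>x. Re (f2 x *\<^sub>R F (embed d x)) \<partial>M2)"
      using Fe by (simp only: integral_Re)
    then have req: "(\<integral>x. f1 x * Re (F (embed d x)) \<partial>M1) = (\<integral>x. f2 x * Re (F (embed d x)) \<partial>M2)"
      by simp
    have diff: "\<bar>(\<integral>x. f x * h (embed d x) \<partial>M) - (\<integral>x. f x * Re (F (embed d x)) \<partial>M)\<bar> \<le> e * (\<integral>x. \<bar>f x\<bar> \<partial>M)"
      if "integrable M f" "integrable M (\<lambda>x. f x * h (embed d x))" "integrable M (\<lambda>x. f x * Re (F (embed d x)))"
      for M and f :: "(nat \<Rightarrow> real) \<Rightarrow> real"
    proof -
      have "\<bar>(\<integral>x. f x * h (embed d x) - f x * Re (F (embed d x)) \<partial>M)\<bar>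
          \<le> (\<integral>x. \<bar>f x * h (embed d x) - f x * Re (F (embed d x))\<bar> \<partial>M)"
        by (rule integral_abs_bound)
      also have "\<dots> \<le> (\<integral>x. e * \<bar>f x\<bar> \<partial>M)"
      proof (rule integral_mono)
        fix x
        have "\<bar>f x * h (embed d x) - f x * Re (F (embed d x))\<bar> = \<bar>f x\<bar> * \<bar>h (embed d x) - Re (F (embed d x))\<bar>"
          by (simp add: abs_mult[symmetric] right_diff_distrib)
        also have "\<dots> \<le> \<bar>f x\<bar> * e"
          by (intro mult_left_mono less_imp_le[OF F(2)] embed_in_poly_circle) auto
        finally show "\<bar>f x * h (embed d x) - f x * Re (F (embed d x))\<bar> \<le> e * \<bar>f x\<bar>" by (simp add: mult.commute)
      qed (use that in auto)
      finally show ?thesis using that by simp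
    qed
    show ?thesis
      using diff[OF int(1) hint(1) re(1)] diff[OF int(2) hint(2) re(2)] req
      unfolding m_def distrib_left by linarith
  qed
  have "\<bar>(\<integral>x. f1 x * h (embed d x) \<partial>M1) - (\<integral>x. f2 x * h (embed d x) \<partial>M2)\<bar> \<le> 0 + e" if "0 < e" for e
  proof -
    have "e / (m + 1) * m \<le> e" using that m by (simp add: divide_le_eq algebra_simps)
    moreover have "0 < e / (m + 1)" using that m by simp
    ultimately show ?thesis using bound[of "e / (m + 1)"] by simp
  qed
  then have "\<bar>(\<integral>x. f1 x * h (embed d x) \<partial>M1) - (\<integral>x. f2 x * h (embed d x) \<partial>M2)\<bar> \<le> 0"
    by (rule field_le_epsilon)
  then show ?thesis by simp
qed

text \<open>The indicator of a closed set is the limit of the continuous functions max(0, 1 - n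
  dist), which are dominated by 1.\<close>

lemma integral_closed_eq:
  assumes A: "closed A"
  shows "(\<integral>x. f1 x * indicator A (embed d x) \<partial>M1) = (\<integral>x. f2 x * indicator A (embed d x) \<partial>M2)"
proof (cases "A = {}")
  case False
  define h where "h n z = max 0 (1 - real n * infdist z A)" for n :: nat and z
  have lim: "(\<lambda>n. h n z) \<longlonglongrightarrow> indicator A z" for z
  proof (cases "z \<in> A")
    case True
    then show ?thesis by (simp add: h_def)
  next
    case z: False
    then have "0 < infdist z A" using A False infdist_pos_not_in_closed by blast
    then obtain n0 :: nat where n0: "1 < real n0 * infdist z A"
      using reals_Archimedean3 by blast
    have "h n z = 0" if "n0 \<le> n" for n
    proof -
      have "real n0 * infdist z A \<le> real n * infdist z A"
        using that by (intro mult_right_mono) (auto simp: infdist_nonneg)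
      then show ?thesis using n0 by (simp add: h_def)
    qed
    then have "eventually (\<lambda>n. h n z = 0) sequentially" by (auto simp: eventually_sequentially)
    then show ?thesis using z by (simp add: tendsto_eventually)
  qed
  have hb: "\<bar>h n z\<bar> \<le> 1" for n z by (simp add: h_def infdist_nonneg)
  have hc: "continuous_on UNIV (h n)" for n unfolding h_def by (intro continuous_intros)
  have [measurable]: "h n \<in> borel_measurable borel" for n using hc by (rule borel_measurable_continuous_onI)
  have [measurable]: "A \<in> sets borel" using A by auto
  have conv: "(\<lambda>n. \<integral>x. f x * h n (embed d x) \<partial>M) \<longlonglongrightarrow> (\<integral>x. f x * indicator A (embed d x) \<partial>M)"
    if f: "integrable M f" and [measurable]: "embed d \<in> borel_measurable M"
    for M and f :: "(nat \<Rightarrow> real) \<Rightarrow> real"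
  proof (rule integral_dominated_convergence[where w = "\<lambda>x. \<bar>f x\<bar>"])
    note [measurable] = borel_measurable_integrable[OF f]
    show "(\<lambda>x. f x * indicator A (embed d x)) \<in> borel_measurable M" by measurable
    show "(\<lambda>x. f x * h n (embed d x)) \<in> borel_measurable M" for n by measurable
    show "AE x in M. (\<lambda>n. f x * h n (embed d x)) \<longlonglongrightarrow> f x * indicator A (embed d x)"
      by (intro AE_I2 tendsto_mult tendsto_const lim)
    show "AE x in M. norm (f x * h n (embed d x)) \<le> \<bar>f x\<bar>" for n
      using hb by (intro AE_I2) (simp add: abs_mult mult_left_le)
  qed (use f in auto)
  show ?thesis
    using LIMSEQ_unique[OF conv[OF int(1) embed_measurable_M(1)]] conv[OF int(2) embed_measurable_M(2)]
      integral_continuous_eq[OF hc hb] by simp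
qed simp

text \<open>The densities may change sign, so uniqueness of positive measures does not apply
  directly. The sets on which the two integrals agree form a Dynkin system, and the closed sets
  generate the Borel sets and are stable under intersection.\<close>

lemma integral_borel_eq:
  assumes "A \<in> sets borel"
  shows "(\<integral>x. f1 x * indicator A (embed d x) \<partial>M1) = (\<integral>x. f2 x * indicator A (embed d x) \<partial>M2)"
proof -
  have borel: "sigma_sets UNIV {A :: (nat \<Rightarrow> complex) set. closed A} = sets borel"
    by (simp add: borel_eq_closed)
  have ind: "integrable M (\<lambda>x. f x * indicator A (embed d x))"
    if "integrable M f" "embed d \<in> borel_measurable M" "A \<in> sets borel" for M and f :: "(nat \<Rightarrow> real) \<Rightarrow> real" and A
  proof -
    note [measurable] = that(2,3)
    have "integrable M (\<lambda>x. f x *\<^sub>R (indicator A (embed d x) :: real))"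
      using that(1) by (intro integrable_times_bounded[where K = 1]) (auto simp: indicator_def)
    then show ?thesis by simp
  qed
  have "Int_stable {A :: (nat \<Rightarrow> complex) set. closed A}" by (auto simp: Int_stable_def)
  moreover have "{A :: (nat \<Rightarrow> complex) set. closed A} \<subseteq> Pow UNIV" by simp
  moreover have "A \<in> sigma_sets UNIV {A. closed A}" using assms borel by simp
  ultimately show ?thesis
  proof (induction rule: sigma_sets_induct_disjoint)
    case (basic A)
    then show ?case using integral_closed_eq by simp
  next
    case (compl A)
    then have "integrable M1 (\<lambda>x. f1 x * indicator A (embed d x))" "integrable M2 (\<lambda>x. f2 x * indicator A (embed d x))"
      using int borel by (auto intro!: ind)
    moreover have "f x * indicator (UNIV - A) (embed d x) = f x - f x * indicator A (embed d x)" for f :: "(nat \<Rightarrow> real) \<Rightarrow> real" and x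
      by (simp split: split_indicator)
    \<comment> \<open>Equality of the total integrals is the closed-set case for
      \<open>UNIV\<close>.\<close>
    ultimately show ?case
      using compl integral_closed_eq[of UNIV] int by simp
  next
    case (union A)
    then have A: "A i \<in> sets borel" for i using borel by auto
    have conv: "(\<lambda>n. \<Sum>i<n. \<integral>x. f x * indicator (A i) (embed d x) \<partial>M)
        \<longlonglongrightarrow> (\<integral>x. f x * indicator (\<Union>i. A i) (embed d x) \<partial>M)"
      if f: "integrable M f" and em: "embed d \<in> borel_measurable M" for M and f :: "(nat \<Rightarrow> real) \<Rightarrow> real"
    proof -
      note [measurable] = borel_measurable_integrable[OF f] em A
      have un: "(\<Sum>i<n. f x * indicator (A i) (embed d x)) = f x * indicator (\<Union>i<n. A i) (embed d x)" for n x
        unfolding sum_distrib_left[symmetric]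
        using union(1) by (subst indicator_UN_disjoint) (auto intro: disjoint_family_on_mono)
      have "(\<lambda>n. \<integral>x. (\<Sum>i<n. f x * indicator (A i) (embed d x)) \<partial>M)
        \<longlonglongrightarrow> (\<integral>x. f x * indicator (\<Union>i. A i) (embed d x) \<partial>M)"
        unfolding un
      proof (rule integral_dominated_convergence[where w = "\<lambda>x. \<bar>f x\<bar>"])
        show "AE x in M. (\<lambda>n. f x * indicator (\<Union>i<n. A i) (embed d x)) \<longlonglongrightarrow> f x * indicator (\<Union>i. A i) (embed d x)"
          by (intro AE_I2 tendsto_mult tendsto_const LIMSEQ_indicator_UN)
        show "AE x in M. norm (f x * indicator (\<Union>i<n. A i) (embed d x)) \<le> \<bar>f x\<bar>" for n
          by (intro AE_I2) (simp add: abs_mult split: split_indicator)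
        show "(\<lambda>x. f x * indicator (\<Union>i. A i) (embed d x)) \<in> borel_measurable M"
          "(\<lambda>x. f x * indicator (\<Union>i<n. A i) (embed d x)) \<in> borel_measurable M" for n
          by (intro borel_measurable_times measurable_compose[OF em borel_measurable_indicator]
            borel_measurable_integrable[OF f] sets.countable_UN sets.finite_UN; use A in auto)+
      qed (use f in \<open>auto\<close>)
      moreover have "(\<integral>x. (\<Sum>i<n. f x * indicator (A i) (embed d x)) \<partial>M)
          = (\<Sum>i<n. \<integral>x. f x * indicator (A i) (embed d x) \<partial>M)" for n
        by (intro Bochner_Integration.integral_sum ind[OF f em A])
      ultimately show ?thesis by (simp only:)
    qed
    show ?case
      using LIMSEQ_unique[OF conv[OF int(1) embed_measurable_M(1)]] conv[OF int(2) embed_measurable_M(2)] union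
      by simp
  qed simp
qed

lemma integral_indicator_eq:
  assumes "A \<in> sets (torus d)"
  shows "(\<integral>x. f1 x * indicator A x \<partial>M1) = (\<integral>x. f2 x * indicator A x \<partial>M2)"
proof -
  have sp: "space M1 = space (torus d)" "space M2 = space (torus d)"
    using sets by (auto dest: sets_eq_imp_space_eq)
  have "unembed d -` A \<in> sets borel"
    using measurable_sets[OF unembed_measurable assms] by simp
  from integral_borel_eq[OF this]
  show ?thesis
  proof (rule box_equals)
    show "(\<integral>x. f1 x * indicator (unembed d -` A) (embed d x) \<partial>M1) = (\<integral>x. f1 x * indicator A x \<partial>M1)"
      "(\<integral>x. f2 x * indicator (unembed d -` A) (embed d x) \<partial>M2) = (\<integral>x. f2 x * indicator A x \<partial>M2)"
      by (intro Bochner_Integration.integral_cong; simp add: sp indicator_vimage unembed_embed)+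
  qed
qed

end

section \<open>The periodic heat kernel\<close>

lemma measure_unit_interval [simp]: "measure unit_interval {0..<1} = 1"
  using unit_interval.prob_space by simp

definition theta_tail :: "real \<Rightarrow> real" where
  "theta_tail t = (\<Sum>n. exp (- t * (real (Suc n))\<^sup>2))"

text \<open>Jacobi theta series, that is, the heat kernel of the circle, with time scaled so that
  the coefficient at k is exp(-t k^2) without a factor 4 pi^2.\<close>

definition theta :: "real \<Rightarrow> real \<Rightarrow> real" where
  "theta t x = 1 + 2 * (\<Sum>n. exp (- t * (real (Suc n))\<^sup>2) * cos (2 * pi * real (Suc n) * x))"

lemma geometric_exp:
  assumes "0 < r"
  shows "summable (\<lambda>n. exp (- r * real (Suc n)))" "(\<Sum>n. exp (- r * real (Suc n))) = 1 / (exp r - 1)"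
proof -
  have eq: "exp (- r * real (Suc n)) = exp (- r) * exp (- r) ^ n" for n
    by (simp add: exp_of_nat_mult[symmetric] exp_add[symmetric] algebra_simps)
  have "(\<lambda>n. exp (- r) * exp (- r) ^ n) sums (exp (- r) * (1 / (1 - exp (- r))))"
    using assms by (intro sums_mult geometric_sums) simp
  moreover have "exp (- r) * (1 / (1 - exp (- r))) = 1 / (exp r - 1)"
    using assms by (simp add: exp_minus field_simps)
  ultimately show "summable (\<lambda>n. exp (- r * real (Suc n)))" "(\<Sum>n. exp (- r * real (Suc n))) = 1 / (exp r - 1)"
    unfolding eq by (auto simp: sums_iff)
qed

lemma summable_theta_tail:
  assumes "0 < t"
  shows "summable (\<lambda>n. exp (- t * (real (Suc n))\<^sup>2))"
proof (rule summable_comparison_test'[OF geometric_exp(1)[OF assms], of 0])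
  fix n :: nat
  have "t * real (Suc n) \<le> t * (real (Suc n))\<^sup>2"
    using assms by (intro mult_left_mono) (auto simp: power2_eq_square)
  then show "norm (exp (- t * (real (Suc n))\<^sup>2)) \<le> exp (- t * real (Suc n))" by simp
qed

lemma theta_tail_nonneg: "0 < t \<Longrightarrow> 0 \<le> theta_tail t"
  unfolding theta_tail_def by (intro suminf_nonneg summable_theta_tail) auto

lemma theta_tail_le_exp:
  assumes "1 \<le> t"
  shows "theta_tail t \<le> 2 * exp (- t)"
proof -
  have t: "0 < t" using assms by simp
  have "theta_tail t \<le> (\<Sum>n. exp (- t * real (Suc n)))"
    unfolding theta_tail_def
  proof (intro suminf_le summable_theta_tail geometric_exp(1) t)
    fix n
    have "t * real (Suc n) \<le> t * (real (Suc n))\<^sup>2"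
      using t by (intro mult_left_mono) (auto simp: power2_eq_square)
    then show "exp (- t * (real (Suc n))\<^sup>2) \<le> exp (- t * real (Suc n))" by simp
  qed
  also have "\<dots> = 1 / (exp t - 1)" by (rule geometric_exp(2)[OF t])
  also have "\<dots> \<le> 2 * exp (- t)"
  proof -
    have "2 \<le> exp t" using exp_ge_add_one_self[of t] assms by linarith
    then have "1 / (exp t - 1) \<le> 1 / (exp t / 2)" by (intro frac_le) auto
    then show ?thesis by (simp add: exp_minus field_simps)
  qed
  finally show ?thesis .
qed

text \<open>Completing the square, t n^2 \<ge> sqrt t n - 1/4, reduces the Gaussian sum to a
  geometric series of rate sqrt t at the cost of exp(1/4) \<le> 2. This yields the short-time
  singularity t^(-1/2) without Poisson summation.\<close>

lemma theta_tail_le_sqrt: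
  assumes "0 < t"
  shows "theta_tail t \<le> 2 / sqrt t"
proof -
  have r: "0 < sqrt t" using assms by simp
  have "theta_tail t \<le> (\<Sum>n. 2 * exp (- sqrt t * real (Suc n)))"
    unfolding theta_tail_def
  proof (intro suminf_le summable_theta_tail summable_mult geometric_exp(1) assms r)
    fix n
    define m where "m = real (Suc n)"
    have "(sqrt t * m - 1 / 2)\<^sup>2 = t * m\<^sup>2 - sqrt t * m + 1 / 4"
      using assms by (simp only: power2_diff power_mult_distrib real_sqrt_pow2 less_imp_le) (simp add: power2_eq_square)
    moreover have "0 \<le> (sqrt t * m - 1 / 2)\<^sup>2" by simp
    ultimately have "- t * m\<^sup>2 \<le> 1 / 4 + - sqrt t * m" by simp
    then have "- t * (real (Suc n))\<^sup>2 \<le> 1 / 4 + - sqrt t * real (Suc n)"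
      by (simp only: m_def)
    then have "exp (- t * (real (Suc n))\<^sup>2) \<le> exp (1 / 4) * exp (- sqrt t * real (Suc n))"
      by (simp only: exp_add[symmetric] exp_le_cancel_iff)
    also have "exp (1 / 4 :: real) \<le> 1 + 1 / 4 + (1 / 4)\<^sup>2" by (rule exp_bound) auto
    also have "\<dots> \<le> 2" by (simp add: power2_eq_square)
    finally show "exp (- t * (real (Suc n))\<^sup>2) \<le> 2 * exp (- sqrt t * real (Suc n))" by simp
  qed
  also have "\<dots> = 2 * (1 / (exp (sqrt t) - 1))"
    using geometric_exp[OF r] by (simp add: suminf_mult)
  also have "\<dots> \<le> 2 * (1 / sqrt t)"
  proof -
    have "sqrt t \<le> exp (sqrt t) - 1" using exp_ge_add_one_self[of "sqrt t"] by linarith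
    then show ?thesis using r by (intro mult_left_mono divide_left_mono mult_pos_pos) linarith+
  qed
  finally show ?thesis by simp
qed

lemma summable_theta:
  assumes "0 < t"
  shows "summable (\<lambda>n. \<bar>exp (- t * (real (Suc n))\<^sup>2) * cos (2 * pi * real (Suc n) * x)\<bar>)"
  by (rule summable_comparison_test'[OF summable_theta_tail[OF assms], of 0])
    (simp add: abs_mult mult_left_le)

lemma theta_minus_1:
  assumes "0 < t"
  shows "\<bar>theta t x - 1\<bar> \<le> 2 * theta_tail t"
proof -
  have "\<bar>\<Sum>n. exp (- t * (real (Suc n))\<^sup>2) * cos (2 * pi * real (Suc n) * x)\<bar>
      \<le> (\<Sum>n. \<bar>exp (- t * (real (Suc n))\<^sup>2) * cos (2 * pi * real (Suc n) * x)\<bar>)"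
    by (rule summable_rabs[OF summable_theta[OF assms]])
  also have "\<dots> \<le> theta_tail t"
    unfolding theta_tail_def
    by (intro suminf_le summable_theta summable_theta_tail assms) (simp add: abs_mult mult_left_le)
  finally show ?thesis by (simp add: theta_def abs_mult)
qed

lemma theta_measurable [measurable]: "(\<lambda>p. theta (fst p) (snd p)) \<in> borel_measurable (borel \<Otimes>\<^sub>M borel)"
  unfolding theta_def by measurable

lemma theta_measurable' [measurable (raw)]:
  "f \<in> borel_measurable M \<Longrightarrow> g \<in> borel_measurable M \<Longrightarrow> (\<lambda>x. theta (f x) (g x)) \<in> borel_measurable M"
  using measurable_compose[OF measurable_Pair theta_measurable, of f M g] by simp

lemma cis_measurable [measurable]: "cis \<in> borel_measurable borel"
  unfolding cis_conv_exp[abs_def] by measurable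

lemma cis_add_int: "cis (2 * pi * real_of_int k + x) = cis x"
  by (simp add: cis_mult[symmetric] cis_multiple_2pi)

lemma cis_frac: "cis (2 * pi * real_of_int k * frac y) = cis (2 * pi * real_of_int k * y)"
proof -
  have "2 * pi * real_of_int k * y = 2 * pi * real_of_int (k * \<lfloor>y\<rfloor>) + 2 * pi * real_of_int k * frac y"
    by (simp add: frac_def algebra_simps)
  then show ?thesis using cis_add_int[of "k * \<lfloor>y\<rfloor>"] by metis
qed

lemma integral_cis_unit_interval:
  "(\<integral>x. cis (2 * pi * real_of_int k * x) \<partial>unit_interval) = (if k = 0 then 1 else 0)"
proof (cases "k = 0")
  case True
  then show ?thesis by simp
next
  case False
  \<comment> \<open>Translation by half a period changes the sign of the integrand.\<close>
  let ?f = "\<lambda>x. cis (2 * pi * real_of_int k * x)" and ?y = "1 / (2 * real_of_int k)"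
  have "(\<integral>x. ?f x \<partial>unit_interval) = (\<integral>x. ?f x \<partial>distr unit_interval unit_interval (\<lambda>x. frac (x - ?y)))"
    by (simp only: distr_unit_interval_shift)
  also have "\<dots> = (\<integral>x. ?f (frac (x - ?y)) \<partial>unit_interval)"
    by (intro integral_distr measurable_unit_intervalI unit_interval_borel) measurable
  also have "\<dots> = (\<integral>x. - ?f x \<partial>unit_interval)"
  proof (intro Bochner_Integration.integral_cong refl)
    fix x
    have "?f (frac (x - ?y)) = cis (2 * pi * real_of_int k * x - pi)"
      unfolding cis_frac right_diff_distrib using False by simp
    then show "?f (frac (x - ?y)) = - ?f x" by (simp add: cis_divide[symmetric])
  qed
  finally show ?thesis using False by (simp add: eq_neg_iff_add_eq_0)
qed

lemma integral_theta:
  assumes t: "0 < t"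
  shows "(\<integral>x. theta t x *\<^sub>R cis (- 2 * pi * real_of_int k * x) \<partial>unit_interval) = of_real (exp (- t * (real_of_int k)\<^sup>2))"
    and "integrable unit_interval (\<lambda>x. theta t x *\<^sub>R cis (- 2 * pi * real_of_int k * x))"
proof -
  let ?e = "\<lambda>n. exp (- t * (real (Suc n))\<^sup>2)"
  let ?c = "\<lambda>n x. (2 * (?e n * cos (2 * pi * real (Suc n) * x))) *\<^sub>R cis (- 2 * pi * real_of_int k * x)"
  have m: "f \<in> borel_measurable unit_interval" if "f \<in> borel_measurable borel" for f :: "real \<Rightarrow> complex"
    using that by (rule unit_interval_borel)
  have cm: "?c n \<in> borel_measurable unit_interval" for n by (rule m) measurable
  have cis1: "cis (- 2 * pi * real_of_int k * x) = cis (2 * pi * real_of_int (- k) * x)" for x by simp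
  have split: "?c n x = ?e n * (cis (2 * pi * real_of_int (int (Suc n) - k) * x) + cis (2 * pi * real_of_int (- int (Suc n) - k) * x))" for n x
  proof -
    have "complex_of_real (2 * cos y) = cis y + cis (- y)" for y by (simp add: complex_eq_iff)
    then have "?c n x = ?e n * ((cis (2 * pi * real (Suc n) * x) + cis (- (2 * pi * real (Suc n) * x))) * cis (- 2 * pi * real_of_int k * x))"
      by (simp add: scaleR_conv_of_real mult_ac)
    also have "\<dots> = ?e n * (cis (2 * pi * real_of_int (int (Suc n) - k) * x) + cis (2 * pi * real_of_int (- int (Suc n) - k) * x))"
      by (simp add: distrib_right cis_mult algebra_simps)
    finally show ?thesis .
  qed
  have cisint: "integrable unit_interval (\<lambda>x. cis (2 * pi * real_of_int j * x))" for j
    by (rule unit_interval.integrable_const_bound[where B = 1]) (auto intro!: unit_interval_borel)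
  have cint: "integrable unit_interval (?c n)" for n
    unfolding split by (intro integrable_mult_right Bochner_Integration.integrable_add cisint)
  \<comment> \<open>Frequency k is met at the index n with n + 1 = |k|. For k = 0 the subtraction
    truncates to the index 0, where the inner case supplies the value 0; the constant term of theta
    accounts for that frequency.\<close>
  have cval: "(\<integral>x. ?c n x \<partial>unit_interval) = (if n = nat \<bar>k\<bar> - 1 then (if k = 0 then 0 else of_real (exp (- t * (real_of_int k)\<^sup>2))) else 0)" for n
  proof -
    have "(\<integral>x. ?c n x \<partial>unit_interval) = ?e n * ((if int (Suc n) - k = 0 then 1 else 0) + (if - int (Suc n) - k = 0 then 1 else 0))"
      unfolding split using cisint
      by (simp add: integral_cis_unit_interval Bochner_Integration.integral_add del: of_int_diff of_int_minus)
    also have "\<dots> = (if n = nat \<bar>k\<bar> - 1 then (if k = 0 then 0 else of_real (exp (- t * (real_of_int k)\<^sup>2))) else 0)"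
    proof (cases k "0 :: int" rule: linorder_cases)
      case less
      then have "- int (Suc n) - k = 0 \<longleftrightarrow> n = nat \<bar>k\<bar> - 1" "int (Suc n) - k \<noteq> 0" by auto
      moreover have "real (Suc n) = - real_of_int k" if "n = nat \<bar>k\<bar> - 1"
        using that less by simp
      ultimately show ?thesis using less by auto
    next
      case greater
      then have "int (Suc n) - k = 0 \<longleftrightarrow> n = nat \<bar>k\<bar> - 1" "- int (Suc n) - k \<noteq> 0" by auto
      moreover have "real (Suc n) = real_of_int k" if "n = nat \<bar>k\<bar> - 1"
        using that greater by simp
      ultimately show ?thesis using greater by auto
    qed auto
    finally show ?thesis .
  qed
  have nb: "norm (?c n x) \<le> 2 * ?e n" for n x
    by (simp add: abs_mult mult_left_le)
  have sm: "summable (\<lambda>n. norm (?c n x))" for x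
    by (rule summable_comparison_test'[OF summable_mult[OF summable_theta_tail[OF t], of 2], of 0]) (use nb in auto)
  have si: "summable (\<lambda>n. \<integral>x. norm (?c n x) \<partial>unit_interval)"
  proof (rule summable_comparison_test'[OF summable_mult[OF summable_theta_tail[OF t], of 2], of 0])
    fix n
    have "(\<integral>x. norm (?c n x) \<partial>unit_interval) \<le> (\<integral>x. 2 * ?e n \<partial>unit_interval)"
      by (rule integral_mono[OF integrable_norm[OF cint] _ nb]) simp
    moreover have "0 \<le> (\<integral>x. norm (?c n x) \<partial>unit_interval)" by simp
    ultimately show "norm (\<integral>x. norm (?c n x) \<partial>unit_interval) \<le> 2 * ?e n"
      by simp
  qed
  have eq: "theta t x *\<^sub>R cis (- 2 * pi * real_of_int k * x) = cis (2 * pi * real_of_int (- k) * x) + (\<Sum>n. ?c n x)" for x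
  proof -
    have "summable (\<lambda>n. ?e n * cos (2 * pi * real (Suc n) * x))"
      by (rule summable_rabs_cancel[OF summable_theta[OF t]])
    note sm2 = summable_mult[OF this, of 2] and mult2 = suminf_mult[OF this, of 2]
    have "(\<Sum>n. ?c n x) = (2 * (\<Sum>n. ?e n * cos (2 * pi * real (Suc n) * x))) *\<^sub>R cis (- 2 * pi * real_of_int k * x)"
      unfolding mult2[symmetric] by (rule suminf_scaleR_left[OF sm2, symmetric])
    then show ?thesis by (simp add: theta_def scaleR_add_left)
  qed
  have ss: "integrable unit_interval (\<lambda>x. \<Sum>n. ?c n x)"
    "(\<integral>x. (\<Sum>n. ?c n x) \<partial>unit_interval) = (\<Sum>n. \<integral>x. ?c n x \<partial>unit_interval)"
    using cint sm si by (auto intro!: integrable_suminf integral_suminf)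
  show "integrable unit_interval (\<lambda>x. theta t x *\<^sub>R cis (- 2 * pi * real_of_int k * x))"
    unfolding eq using ss(1) cisint by (intro Bochner_Integration.integrable_add)
  have "(\<integral>x. theta t x *\<^sub>R cis (- 2 * pi * real_of_int k * x) \<partial>unit_interval)
      = (if - k = 0 then 1 else 0) + (\<Sum>n. \<integral>x. ?c n x \<partial>unit_interval)"
    unfolding eq by (subst Bochner_Integration.integral_add[OF cisint ss(1)]) (simp only: ss(2) integral_cis_unit_interval)
  also have "(\<Sum>n. \<integral>x. ?c n x \<partial>unit_interval) = (if k = 0 then 0 else of_real (exp (- t * (real_of_int k)\<^sup>2)))"
    unfolding cval by (rule sums_unique[symmetric], rule sums_single)
  finally show "(\<integral>x. theta t x *\<^sub>R cis (- 2 * pi * real_of_int k * x) \<partial>unit_interval) = of_real (exp (- t * (real_of_int k)\<^sup>2))"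
    by simp
qed

section \<open>The heat kernel of the d-dimensional torus\<close>

definition heat :: "nat \<Rightarrow> real \<Rightarrow> (nat \<Rightarrow> real) \<Rightarrow> real" where
  "heat d t x = (\<Prod>k<d. theta t (x k))"

lemma prod_minus_1_le:
  fixes c :: "nat \<Rightarrow> real"
  assumes "\<And>k. \<bar>c k - 1\<bar> \<le> r" "0 \<le> r"
  shows "\<bar>(\<Prod>k<d. c k) - 1\<bar> \<le> (1 + r) ^ d - 1"
proof (induction d)
  case (Suc d)
  have "\<bar>(\<Prod>k<Suc d. c k) - 1\<bar> = \<bar>((\<Prod>k<d. c k) - 1) * c d + (c d - 1)\<bar>"
    by (simp add: algebra_simps)
  also have "\<dots> \<le> ((1 + r) ^ d - 1) * (1 + r) + r"
  proof (intro order_trans[OF abs_triangle_ineq] add_mono assms)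
    have "\<bar>c d\<bar> \<le> 1 + r" using assms(1)[of d] by linarith
    then show "\<bar>((\<Prod>k<d. c k) - 1) * c d\<bar> \<le> ((1 + r) ^ d - 1) * (1 + r)"
      unfolding abs_mult using Suc assms(2) by (intro mult_mono) auto
  qed
  also have "\<dots> = (1 + r) ^ Suc d - 1" by (simp add: algebra_simps)
  finally show ?case .
qed simp

lemma power_minus_1_le:
  fixes x :: real
  assumes "0 \<le> x" "x \<le> 3"
  shows "(1 + x) ^ d - 1 \<le> x * 5 ^ d"
proof (induction d)
  case (Suc d)
  have "(1 + x) ^ Suc d - 1 = (1 + x) * ((1 + x) ^ d - 1) + x" by (simp add: algebra_simps)
  also have "\<dots> \<le> 4 * (x * 5 ^ d) + x * 5 ^ d"
  proof (intro add_mono mult_mono)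
    show "x \<le> x * 5 ^ d" using assms(1) mult_left_mono[of 1 "5 ^ d" x] by simp
  qed (use assms Suc in auto)
  finally show ?case by simp
qed (use assms in simp)

text \<open>A single power of t has to serve all times. For t \<le> 1 each of the d factors is at
  most 5 / sqrt t; for t \<ge> 1 the deviation from 1 decays exponentially, which beats the
  power.\<close>

lemma heat_bound:
  obtains K where "0 < K" "\<And>t x. 0 < t \<Longrightarrow> \<bar>heat d t x - 1\<bar> \<le> K * t powr (- (real d / 2))"
proof
  let ?K = "4 * 5 ^ d * (real d ^ d + 1)"
  show "0 < ?K" by (simp add: add_nonneg_pos)
  fix t :: real and x :: "nat \<Rightarrow> real" assume t: "0 < t"
  have le: "\<bar>heat d t x - 1\<bar> \<le> (1 + 2 * theta_tail t) ^ d - 1"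
    unfolding heat_def using theta_minus_1[OF t] theta_tail_nonneg[OF t] by (intro prod_minus_1_le) auto
  have pt: "t powr (- (real d / 2)) = (1 / sqrt t) ^ d"
    using t by (simp add: powr_minus powr_half_sqrt[symmetric] powr_powr powr_realpow[symmetric] power_one_over inverse_eq_divide)
  show "\<bar>heat d t x - 1\<bar> \<le> ?K * t powr (- (real d / 2))"
  proof (cases "t \<le> 1")
    case True
    have "sqrt t \<le> 1" using True t by simp
    then have "1 \<le> 1 / sqrt t" using t by (simp add: field_simps)
    then have "1 + 2 * theta_tail t \<le> 5 * (1 / sqrt t)"
      using theta_tail_le_sqrt[OF t] by simp
    then have "(1 + 2 * theta_tail t) ^ d \<le> (5 * (1 / sqrt t)) ^ d"
      using theta_tail_nonneg[OF t] by (intro power_mono) auto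
    also have "\<dots> = 5 ^ d * t powr (- (real d / 2))" by (simp only: power_mult_distrib pt)
    also have "\<dots> \<le> ?K * t powr (- (real d / 2))" by (intro mult_right_mono) auto
    finally show ?thesis using le by linarith
  next
    case False
    then have t1: "1 \<le> t" by simp
    have e1: "exp (- t) \<le> 1 / 2"
    proof -
      have "2 \<le> exp t" using exp_ge_add_one_self[of t] t1 by linarith
      then have "1 / exp t \<le> 1 / 2" by (intro divide_left_mono) auto
      then show ?thesis by (simp add: exp_minus field_simps)
    qed
    have "(1 + 2 * theta_tail t) ^ d - 1 \<le> (2 * theta_tail t) * 5 ^ d"
      using theta_tail_nonneg[OF t] theta_tail_le_exp[OF t1] e1 by (intro power_minus_1_le) auto
    also have "\<dots> \<le> (4 * exp (- t)) * 5 ^ d"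
      using theta_tail_le_exp[OF t1] by (intro mult_right_mono) auto
    also have "exp (- t) \<le> (real d ^ d + 1) * t powr (- (real d / 2))"
    proof -
      \<comment> \<open>From (1 + t / d)^d \<le> exp t. The summand 1 in the constant covers d =
        0.\<close>
      have "t ^ d \<le> (real d ^ d + 1) * exp t"
      proof (cases "d = 0")
        case False
        have "(t / real d) ^ d \<le> (1 + t / real d) ^ d" using t by (intro power_mono) auto
        also have "\<dots> \<le> exp t"
          using False t by (intro exp_ge_one_plus_x_over_n_power_n) auto
        finally have "t ^ d \<le> real d ^ d * exp t"
          using False by (simp add: power_divide field_simps)
        then show ?thesis by (simp add: distrib_right add_increasing2)
      next
        case True
        have "1 \<le> exp t" using t by simp
        then have "1 \<le> 2 * exp t" by linarith
        then show ?thesis using True by simp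
      qed
      moreover have "t powr (real d / 2) \<le> t ^ d"
        using t1 powr_mono[of "real d / 2" "real d" t] by (simp add: powr_realpow)
      ultimately have "t powr (real d / 2) \<le> (real d ^ d + 1) * exp t" by linarith
      then show ?thesis using t by (simp add: exp_minus powr_minus field_simps)
    qed
    finally have "(1 + 2 * theta_tail t) ^ d - 1 \<le> 4 * ((real d ^ d + 1) * t powr (- (real d / 2))) * 5 ^ d"
      by simp
    with le show ?thesis by (simp add: mult_ac)
  qed
qed

lemma heat_measurable [measurable]:
  "(\<lambda>p. heat d (snd p) (fst p)) \<in> borel_measurable (torus d \<Otimes>\<^sub>M lborel)"
  unfolding heat_def
proof (intro borel_measurable_prod theta_measurable')
  fix k assume "k \<in> {..<d}"
  then show "(\<lambda>p. fst p k) \<in> borel_measurable (torus d \<Otimes>\<^sub>M lborel)"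
    by (intro measurable_compose[OF measurable_fst torus_component]) auto
qed measurable

lemma integral_heat_character:
  assumes t: "0 < t"
  shows "(\<integral>x. heat d t x *\<^sub>R character d \<xi> x \<partial>torus d) = of_real (exp (- t * (freq_norm d \<xi>)\<^sup>2))"
proof -
  have "heat d t x *\<^sub>R character d \<xi> x = (\<Prod>k<d. theta t (x k) *\<^sub>R cis (- 2 * pi * real_of_int (\<xi> k) * x k))" for x
    by (simp add: heat_def character_def scaleR_conv_of_real prod.distrib sum_distrib_left cis_sum mult.assoc)
  then have "(\<integral>x. heat d t x *\<^sub>R character d \<xi> x \<partial>torus d)
      = (\<integral>x. (\<Prod>k<d. theta t (x k) *\<^sub>R cis (- 2 * pi * real_of_int (\<xi> k) * x k)) \<partial>torus d)"
    by (simp only:)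
  also have "\<dots> = (\<Prod>k<d. \<integral>x. theta t x *\<^sub>R cis (- 2 * pi * real_of_int (\<xi> k) * x) \<partial>unit_interval)"
    unfolding torus_def using integral_theta(2)[OF t] by (intro unit_intervals.product_integral_prod) auto
  also have "\<dots> = (\<Prod>k<d. of_real (exp (- t * (real_of_int (\<xi> k))\<^sup>2)))"
    by (simp only: integral_theta(1)[OF t])
  also have "\<dots> = of_real (exp (- t * (freq_norm d \<xi>)\<^sup>2))"
    by (simp add: freq_norm_def sum_nonneg exp_sum[symmetric] sum_distrib_left sum_negf[symmetric] of_real_prod[symmetric] del: of_real_prod)
  finally show ?thesis .
qed

lemma integral_character:
  "(\<integral>x. character d \<xi> x \<partial>torus d) = (if \<forall>k<d. \<xi> k = 0 then 1 else 0)"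
proof -
  have "(\<integral>x. character d \<xi> x \<partial>torus d) = (\<integral>x. (\<Prod>k<d. cis (2 * pi * real_of_int (- \<xi> k) * x k)) \<partial>torus d)"
    by (simp add: character_def sum_distrib_left cis_sum[symmetric] sum_negf mult.assoc)
  also have "\<dots> = (\<Prod>k<d. \<integral>x. cis (2 * pi * real_of_int (- \<xi> k) * x) \<partial>unit_interval)"
    unfolding torus_def
    by (intro unit_intervals.product_integral_prod unit_interval.integrable_const_bound[where B = 1])
      (auto intro!: unit_interval_borel)
  also have "\<dots> = (if \<forall>k<d. \<xi> k = 0 then 1 else 0)"
    by (simp only: integral_cis_unit_interval) auto
  finally show ?thesis .
qed

section \<open>Weak type of the Riesz kernel\<close>

lemma character_eq_prod: "character d \<xi> x = (\<Prod>k<d. cis (2 * pi * real_of_int (- \<xi> k) * x k))"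
proof -
  have "- 2 * pi * (\<Sum>k<d. real_of_int (\<xi> k) * x k) = (\<Sum>k<d. 2 * pi * real_of_int (- \<xi> k) * x k)"
    by (simp add: sum_distrib_left sum_negf[symmetric] mult.assoc)
  then show ?thesis by (simp only: character_def cis_sum[OF finite_lessThan])
qed

lemma Gamma_scaled:
  fixes a l :: real
  assumes a: "0 < a" and l: "0 < l"
  shows "has_bochner_integral lborel (\<lambda>t. indicator {0..} t * (t powr (a - 1) * exp (- t * l))) (Gamma a * l powr (- a))"
proof (rule has_bochner_integral_nn_integral)
  let ?f = "\<lambda>t. ennreal (t powr (a - 1) / exp t) * indicator {0..} t"
  have "ennreal (Gamma a) = (\<integral>\<^sup>+t. ?f t \<partial>lborel)"
    using Gamma_integral_real[OF a] by (intro nn_integral_has_integral_lebesgue'[symmetric]) auto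
  also have "\<dots> = ennreal l * (\<integral>\<^sup>+t. ?f (0 + l * t) \<partial>lborel)"
    using l by (subst nn_integral_real_affine[where c = l and t = 0]) auto
  also have "(\<integral>\<^sup>+t. ?f (0 + l * t) \<partial>lborel) = (\<integral>\<^sup>+t. ennreal (l powr (a - 1)) *
      ennreal (indicator {0..} t * (t powr (a - 1) * exp (- t * l))) \<partial>lborel)"
    using l by (intro nn_integral_cong)
      (auto simp: powr_mult exp_minus divide_inverse mult_ac ennreal_mult'[symmetric] zero_le_mult_iff split: split_indicator)
  also have "\<dots> = ennreal (l powr (a - 1)) * (\<integral>\<^sup>+t. ennreal (indicator {0..} t * (t powr (a - 1) * exp (- t * l))) \<partial>lborel)"
    by (intro nn_integral_cmult) measurable
  finally have G: "ennreal (Gamma a) = ennreal (l powr a) * (\<integral>\<^sup>+t. ennreal (indicator {0..} t * (t powr (a - 1) * exp (- t * l))) \<partial>lborel)"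
    using l powr_add[of l 1 "a - 1"] by (simp add: mult.assoc[symmetric] ennreal_mult'[symmetric])
  have "ennreal (l powr (- a)) * ennreal (Gamma a) = (\<integral>\<^sup>+t. ennreal (indicator {0..} t * (t powr (a - 1) * exp (- t * l))) \<partial>lborel)"
    unfolding G using l by (simp add: mult.assoc[symmetric] ennreal_mult'[symmetric] powr_add[symmetric])
  then show "(\<integral>\<^sup>+t. ennreal (indicator {0..} t * (t powr (a - 1) * exp (- t * l))) \<partial>lborel) = ennreal (Gamma a * l powr (- a))"
    using a Gamma_real_pos[OF a] by (simp add: ennreal_mult'[symmetric] mult.commute)
  show "0 \<le> Gamma a * l powr (- a)" using Gamma_real_pos[OF a] by simp
qed (auto simp: indicator_def)

text \<open>
  With $a = (d-s)/2$, the Riesz coefficients satisfy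
  $\Gamma(a)|\xi|^{s-d} = \int_0^\infty t^{a-1} e^{-t|\xi|^2}\,dt$.  The part $t \ge \varepsilon$
  of the integral belongs to the bounded function \<open>low\<close>, while the part $t < \varepsilon$ is
  the Fourier transform of the positive measure \<open>\<nu>\<close>, a mixture of wrapped Gaussians.
\<close>

locale riesz_split =
  fixes d :: nat and s K \<epsilon> :: real
  assumes s: "0 < s" "s < real d" and eps: "0 < \<epsilon>" and K: "0 < K"
    and heat_le: "0 < t \<Longrightarrow> \<bar>heat d t x - 1\<bar> \<le> K * t powr (- (real d / 2))"
begin

definition a :: real where "a = (real d - s) / 2"

lemma a_pos: "0 < a" using s by (simp add: a_def)

text \<open>K times the integral of t^(-s/2 - 1) over t \<ge> \<epsilon>; the exponent is a - 1 from
  the Gamma integral minus d/2 from the heat kernel bound. It bounds \<open>low\<close>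
  uniformly.\<close>

definition \<Lambda> :: real where "\<Lambda> = K * (2 / s * \<epsilon> powr (- (s / 2)))"

text \<open>The total mass of \<open>\<tau>\<close>, hence of \<open>\<nu>\<close>. It is also the
  zero-frequency coefficient by which \<open>\<nu>\<close> differs from
  \<open>Gamma a * W - low\<close>.\<close>

definition q :: real where "q = (\<integral>t. indicator {0..<\<epsilon>} t * t powr (a - 1) \<partial>lborel)"

text \<open>Subtracting 1 from the heat kernel removes its zero frequency; without this the integral
  over large t would diverge.\<close>

definition low_weight :: "(nat \<Rightarrow> real) \<Rightarrow> real \<Rightarrow> real" where
  "low_weight x t = indicator {\<epsilon>..} t * (t powr (a - 1) * (heat d t x - 1))"

definition low :: "(nat \<Rightarrow> real) \<Rightarrow> real" where "low x = (\<integral>t. low_weight x t \<partial>lborel)"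

sublocale T: prob_space "torus d" by (rule prob_space_torus)

sublocale TL: pair_sigma_finite "torus d" lborel ..

lemma q_bounds: "0 \<le> q" "q \<le> \<epsilon> powr a / a"
  and q_integrable: "integrable lborel (\<lambda>t. indicator {0..<\<epsilon>} t * t powr (a - 1))"
proof -
  have "has_bochner_integral lborel (\<lambda>t. t powr (a - 1) * indicator {0..\<epsilon>} t) (\<epsilon> powr a / a)"
  proof (rule has_bochner_integral_nn_integral)
    show "(\<integral>\<^sup>+t. ennreal (t powr (a - 1) * indicator {0..\<epsilon>} t) \<partial>lborel) = ennreal (\<epsilon> powr a / a)"
      using nn_integral_powr_Icc_0[of "a - 1" \<epsilon>] a_pos eps by (simp add: ennreal_mult' ennreal_indicator)
  qed (use a_pos in auto)
  then have i: "integrable lborel (\<lambda>t. t powr (a - 1) * indicator {0..\<epsilon>} t)"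
    "(\<integral>t. t powr (a - 1) * indicator {0..\<epsilon>} t \<partial>lborel) = \<epsilon> powr a / a"
    by (auto simp: has_bochner_integral_iff)
  show int: "integrable lborel (\<lambda>t. indicator {0..<\<epsilon>} t * t powr (a - 1))"
    by (rule Bochner_Integration.integrable_bound[OF i(1)]) (auto split: split_indicator)
  show "0 \<le> q" unfolding q_def by (intro integral_nonneg_AE) auto
  show "q \<le> \<epsilon> powr a / a"
    unfolding q_def i(2)[symmetric] by (intro integral_mono int i(1)) (auto split: split_indicator)
qed

lemma tail_integral: "has_bochner_integral lborel (\<lambda>t. K * (indicator {\<epsilon>..} t * t powr (- (s / 2) - 1))) \<Lambda>"
proof -
  have "has_bochner_integral lborel (\<lambda>t. indicator {\<epsilon>..} t * t powr (- (s / 2) - 1)) (2 / s * \<epsilon> powr (- (s / 2)))"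
  proof (rule has_bochner_integral_nn_integral)
    show "(\<integral>\<^sup>+t. ennreal (indicator {\<epsilon>..} t * t powr (- (s / 2) - 1)) \<partial>lborel) = ennreal (2 / s * \<epsilon> powr (- (s / 2)))"
      using nn_integral_powr_atLeast[of "- (s / 2) - 1" \<epsilon>] s eps
      by (simp add: ennreal_mult' ennreal_indicator mult.commute)
  qed (use s in auto)
  then show ?thesis unfolding \<Lambda>_def by (rule has_bochner_integral_mult_right)
qed

lemma low_weight_bound: "\<bar>low_weight x t\<bar> \<le> K * (indicator {\<epsilon>..} t * t powr (- (s / 2) - 1))"
proof (cases "\<epsilon> \<le> t")
  case True
  then have t: "0 < t" using eps by simp
  have "t powr (a - 1) * \<bar>heat d t x - 1\<bar> \<le> t powr (a - 1) * (K * t powr (- (real d / 2)))"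
    by (intro mult_left_mono heat_le t) auto
  also have "\<dots> = K * (t powr (a - 1) * t powr (- (real d / 2)))" by simp
  also have "t powr (a - 1) * t powr (- (real d / 2)) = t powr (- (s / 2) - 1)"
  proof -
    have "a - 1 + - (real d / 2) = - (s / 2) - 1" by (simp add: a_def field_simps)
    then show ?thesis by (simp only: powr_add[symmetric])
  qed
  finally show ?thesis using True by (simp add: low_weight_def abs_mult)
qed (simp add: low_weight_def)

lemma low_weight_measurable [measurable]: "(\<lambda>p. low_weight (fst p) (snd p)) \<in> borel_measurable (torus d \<Otimes>\<^sub>M lborel)"
  unfolding low_weight_def by measurable

lemma low_weight_measurable': "x \<in> space (torus d) \<Longrightarrow> low_weight x \<in> borel_measurable lborel"
  using measurable_compose[OF measurable_Pair1' low_weight_measurable, of x] by simp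

lemma low_weight_integrable:
  assumes x: "x \<in> space (torus d)"
  shows "integrable lborel (low_weight x)"
proof (rule Bochner_Integration.integrable_bound)
  show "integrable lborel (\<lambda>t. K * (indicator {\<epsilon>..} t * t powr (- (s / 2) - 1)))"
    using tail_integral by (simp add: has_bochner_integral_iff)
  show "AE t in lborel. norm (low_weight x t) \<le> norm (K * (indicator {\<epsilon>..} t * t powr (- (s / 2) - 1)))"
    unfolding real_norm_def by (intro AE_I2 order_trans[OF low_weight_bound abs_ge_self])
qed (rule low_weight_measurable'[OF x])

lemma low_measurable [measurable]: "low \<in> borel_measurable (torus d)"
  unfolding low_def by (intro lborel.borel_measurable_lebesgue_integral) (simp add: split_beta')

lemma low_bound:
  assumes x: "x \<in> space (torus d)"
  shows "\<bar>low x\<bar> \<le> \<Lambda>"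
proof -
  have "\<bar>low x\<bar> \<le> (\<integral>t. \<bar>low_weight x t\<bar> \<partial>lborel)"
    unfolding low_def by (rule integral_abs_bound)
  also have "\<dots> \<le> (\<integral>t. K * (indicator {\<epsilon>..} t * t powr (- (s / 2) - 1)) \<partial>lborel)"
    using low_weight_integrable[OF x] tail_integral low_weight_bound
    by (intro integral_mono) (auto simp: has_bochner_integral_iff)
  also have "\<dots> = \<Lambda>" using tail_integral by (simp add: has_bochner_integral_iff)
  finally show ?thesis .
qed

lemma low_integrable: "integrable (torus d) low"
  using low_bound by (intro T.integrable_const_bound[of _ \<Lambda>]) auto

lemma fourier_low:
  "(\<integral>x. low x *\<^sub>R character d \<xi> x \<partial>torus d) = of_real (\<integral>t. indicator {\<epsilon>..} t *
     (t powr (a - 1) * (exp (- t * (freq_norm d \<xi>)\<^sup>2) - (if \<forall>k<d. \<xi> k = 0 then 1 else 0))) \<partial>lborel)"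
proof -
  let ?F = "\<lambda>x t. low_weight x t *\<^sub>R character d \<xi> x"
  have m: "case_prod ?F \<in> borel_measurable (torus d \<Otimes>\<^sub>M lborel)"
    unfolding split_beta' by measurable
  have int: "integrable (torus d \<Otimes>\<^sub>M lborel) (case_prod ?F)"
  proof (rule integrableI_bounded[OF m])
    have "(\<integral>\<^sup>+p. ennreal (norm (case_prod ?F p)) \<partial>(torus d \<Otimes>\<^sub>M lborel)) = (\<integral>\<^sup>+x. (\<integral>\<^sup>+t. ennreal (norm (?F x t)) \<partial>lborel) \<partial>torus d)"
      using m by (subst lborel.nn_integral_fst[symmetric]) auto
    also have "\<dots> \<le> (\<integral>\<^sup>+x. (\<integral>\<^sup>+t. ennreal (K * (indicator {\<epsilon>..} t * t powr (- (s / 2) - 1))) \<partial>lborel) \<partial>torus d)"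
      using low_weight_bound by (intro nn_integral_mono ennreal_leI) (simp add: norm_character)
    also have "\<dots> = (\<integral>\<^sup>+x. ennreal \<Lambda> \<partial>torus d)"
      using tail_integral K
      by (subst nn_integral_eq_integral) (auto simp: has_bochner_integral_iff split: split_indicator)
    also have "\<dots> < \<infinity>" by (simp add: T.emeasure_space_1)
    finally show "(\<integral>\<^sup>+p. ennreal (norm (case_prod ?F p)) \<partial>(torus d \<Otimes>\<^sub>M lborel)) < \<infinity>" .
  qed
  have "(\<integral>x. low x *\<^sub>R character d \<xi> x \<partial>torus d) = (\<integral>x. (\<integral>t. ?F x t \<partial>lborel) \<partial>torus d)"
    using low_weight_integrable by (intro Bochner_Integration.integral_cong refl) (simp add: low_def)
  also have "\<dots> = (\<integral>t. (\<integral>x. ?F x t \<partial>torus d) \<partial>lborel)"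
    by (rule TL.Fubini_integral[OF int, symmetric])
  also have "\<dots> = (\<integral>t. of_real (indicator {\<epsilon>..} t *
     (t powr (a - 1) * (exp (- t * (freq_norm d \<xi>)\<^sup>2) - (if \<forall>k<d. \<xi> k = 0 then 1 else 0)))) \<partial>lborel)"
  proof (intro Bochner_Integration.integral_cong refl)
    fix t :: real
    show "(\<integral>x. ?F x t \<partial>torus d) = of_real (indicator {\<epsilon>..} t *
     (t powr (a - 1) * (exp (- t * (freq_norm d \<xi>)\<^sup>2) - (if \<forall>k<d. \<xi> k = 0 then 1 else 0))))"
    proof (cases "\<epsilon> \<le> t")
      case True
      then have t: "0 < t" using eps by simp
      have [measurable]: "heat d t \<in> borel_measurable (torus d)"
        using measurable_compose[OF measurable_Pair2' heat_measurable, of t] by simp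
      have "\<bar>heat d t x\<bar> \<le> 1 + K * t powr (- (real d / 2))" for x
        using heat_le[OF t, of x] by linarith
      then have "integrable (torus d) (heat d t)"
        by (intro T.integrable_const_bound[of _ "1 + K * t powr (- (real d / 2))"]) auto
      then have "integrable (torus d) (\<lambda>x. heat d t x *\<^sub>R character d \<xi> x)"
        by (rule integrable_times_bounded[where K = 1]) (auto simp: norm_character)
      moreover have "integrable (torus d) (\<lambda>x. character d \<xi> x)"
        by (intro T.integrable_const_bound[of _ 1]) (auto simp: norm_character)
      moreover note i = calculation
      have "?F x t = (t powr (a - 1)) *\<^sub>R (heat d t x *\<^sub>R character d \<xi> x - character d \<xi> x)" for x
        using True by (simp add: low_weight_def scaleR_conv_of_real algebra_simps)
      then have "(\<integral>x. ?F x t \<partial>torus d) = (t powr (a - 1)) *\<^sub>R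
          ((\<integral>x. heat d t x *\<^sub>R character d \<xi> x \<partial>torus d) - (\<integral>x. character d \<xi> x \<partial>torus d))"
        using i by simp
      then show ?thesis
        unfolding integral_heat_character[OF t] integral_character using True by (auto simp: scaleR_conv_of_real)
    qed (simp add: low_weight_def)
  qed
  finally show ?thesis by (simp only: integral_complex_of_real)
qed

section \<open>The high-frequency part as a positive measure\<close>

definition \<tau> :: "real measure" where
  "\<tau> = density lborel (\<lambda>t. ennreal (indicator {0..<\<epsilon>} t * t powr (a - 1)))"

definition gaussian :: "(nat \<Rightarrow> real) measure" where
  "gaussian = PiM {..<d} (\<lambda>_. std_normal_distribution)"

text \<open>The scale makes each coordinate before wrapping a centered Gaussian of variance 2 t / (2
  pi)^2, whose characteristic function at 2 pi k is exp(-t k^2). Constructing the measure by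
  wrapping makes its positivity evident, which the cosine series of theta does not show.\<close>

definition wrap :: "real \<times> (nat \<Rightarrow> real) \<Rightarrow> nat \<Rightarrow> real" where
  "wrap p = (\<lambda>k\<in>{..<d}. frac (sqrt (2 * fst p) / (2 * pi) * snd p k))"

definition \<nu> :: "(nat \<Rightarrow> real) measure" where "\<nu> = distr (\<tau> \<Otimes>\<^sub>M gaussian) (torus d) wrap"

sublocale G: prob_space gaussian
  unfolding gaussian_def by (intro prob_space_PiM prob_space_normal_density) simp

lemma tau_total: "emeasure \<tau> (space \<tau>) = ennreal q"
  unfolding \<tau>_def q_def using q_integrable
  by (simp add: emeasure_density nn_integral_eq_integral)

sublocale tau: finite_measure \<tau>
  by (rule finite_measureI) (simp add: tau_total)

sublocale tauG: pair_sigma_finite \<tau> gaussian ..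

lemma sets_tau [measurable_cong]: "sets \<tau> = sets borel"
  by (simp add: \<tau>_def)

lemma gaussian_component: "k < d \<Longrightarrow> (\<lambda>y. y k) \<in> borel_measurable gaussian"
proof -
  assume "k < d"
  then have "(\<lambda>y. y k) \<in> measurable gaussian std_normal_distribution"
    unfolding gaussian_def by (intro measurable_component_singleton) simp
  moreover have "measurable gaussian std_normal_distribution = borel_measurable gaussian"
    by (rule measurable_cong_sets) simp_all
  ultimately show "(\<lambda>y. y k) \<in> borel_measurable gaussian" by (simp only:)
qed

lemma wrap_measurable [measurable]: "wrap \<in> measurable (\<tau> \<Otimes>\<^sub>M gaussian) (torus d)"
  unfolding wrap_def
proof (rule measurable_torusI)
  fix k assume "k < d"
  then have [measurable]: "(\<lambda>p. snd p k) \<in> borel_measurable (\<tau> \<Otimes>\<^sub>M gaussian)"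
    by (intro measurable_compose[OF measurable_snd gaussian_component])
  show "(\<lambda>p. sqrt (2 * fst p) / (2 * pi) * snd p k) \<in> borel_measurable (\<tau> \<Otimes>\<^sub>M gaussian)" by measurable
qed

lemma finite_tauG: "finite_measure (\<tau> \<Otimes>\<^sub>M gaussian)"
  by (rule finite_measureI)
    (simp add: space_pair_measure G.emeasure_pair_measure_Times tau_total G.emeasure_space_1)

lemma gaussian_character:
  assumes t: "0 \<le> t"
  shows "(\<integral>y. character d \<xi> (wrap (t, y)) \<partial>gaussian) = of_real (exp (- t * (freq_norm d \<xi>)\<^sup>2))"
proof -
  interpret S: prob_space std_normal_distribution by (rule prob_space_normal_density) simp
  interpret SS: product_prob_space "\<lambda>_::nat. std_normal_distribution" UNIV by unfold_locales
  let ?u = "\<lambda>k. 2 * pi * real_of_int (- \<xi> k) * (sqrt (2 * t) / (2 * pi))"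
  have "character d \<xi> (wrap (t, y)) = (\<Prod>k<d. iexp (?u k * y k))" for y
    unfolding character_eq_prod cis_conv_exp[symmetric]
  proof (intro prod.cong refl)
    fix k assume "k \<in> {..<d}"
    then have "cis (2 * pi * real_of_int (- \<xi> k) * wrap (t, y) k)
        = cis (2 * pi * real_of_int (- \<xi> k) * (sqrt (2 * t) / (2 * pi) * y k))"
      by (simp only: wrap_def restrict_apply' cis_frac fst_conv snd_conv)
    then show "cis (2 * pi * real_of_int (- \<xi> k) * wrap (t, y) k) = cis (?u k * y k)"
      by (simp only: mult.assoc)
  qed
  then have "(\<integral>y. character d \<xi> (wrap (t, y)) \<partial>gaussian) = (\<integral>y. (\<Prod>k<d. iexp (?u k * y k)) \<partial>gaussian)" by (simp only:)
  also have "\<dots> = (\<Prod>k<d. \<integral>y. iexp (?u k * y) \<partial>std_normal_distribution)"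
    unfolding gaussian_def
    by (intro SS.product_integral_prod S.integrable_const_bound[where B = 1]) auto
  also have "\<dots> = (\<Prod>k<d. of_real (exp (- (?u k)\<^sup>2 / 2)))"
    using char_std_normal_distribution unfolding char_def by (simp only: fun_eq_iff)
  also have "\<dots> = (\<Prod>k<d. of_real (exp (- t * (real_of_int (\<xi> k))\<^sup>2)))"
    using t by (intro prod.cong refl) (simp add: power_mult_distrib)
  also have "\<dots> = of_real (exp (- t * (freq_norm d \<xi>)\<^sup>2))"
    by (simp add: freq_norm_def sum_nonneg exp_sum[symmetric] sum_distrib_left sum_negf[symmetric] of_real_prod[symmetric] del: of_real_prod)
  finally show ?thesis .
qed

lemma fourier_nu:
  "(\<integral>x. character d \<xi> x \<partial>\<nu>) = of_real (\<integral>t. indicator {0..<\<epsilon>} t * (t powr (a - 1) * exp (- t * (freq_norm d \<xi>)\<^sup>2)) \<partial>lborel)"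
proof -
  interpret P: finite_measure "\<tau> \<Otimes>\<^sub>M gaussian" by (rule finite_tauG)
  have "(\<integral>x. character d \<xi> x \<partial>\<nu>) = (\<integral>p. character d \<xi> (wrap p) \<partial>(\<tau> \<Otimes>\<^sub>M gaussian))"
    unfolding \<nu>_def by (rule integral_distr) measurable
  also have "\<dots> = (\<integral>t. (\<integral>y. character d \<xi> (wrap (t, y)) \<partial>gaussian) \<partial>\<tau>)"
    by (intro tauG.integral_fst'[symmetric] P.integrable_const_bound[of _ 1]) (auto simp: norm_character)
  also have "\<dots> = (\<integral>t. (indicator {0..<\<epsilon>} t * t powr (a - 1)) *\<^sub>R (\<integral>y. character d \<xi> (wrap (t, y)) \<partial>gaussian) \<partial>lborel)"
  proof -
    have "(\<lambda>t. \<integral>y. character d \<xi> (wrap (t, y)) \<partial>gaussian) \<in> borel_measurable \<tau>"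
      by (intro G.borel_measurable_lebesgue_integral) measurable
    then have "(\<lambda>t. \<integral>y. character d \<xi> (wrap (t, y)) \<partial>gaussian) \<in> borel_measurable lborel"
      by (simp add: measurable_cong_sets[OF sets_tau refl])
    then show ?thesis unfolding \<tau>_def by (rule integral_density) auto
  qed
  also have "\<dots> = (\<integral>t. of_real (indicator {0..<\<epsilon>} t * (t powr (a - 1) * exp (- t * (freq_norm d \<xi>)\<^sup>2))) \<partial>lborel)"
    by (intro Bochner_Integration.integral_cong refl)
      (auto simp: gaussian_character scaleR_conv_of_real split: split_indicator)
  finally show ?thesis by (simp only: integral_complex_of_real)
qed

end

section \<open>Comparison of the kernel with the measure\<close>

context riesz_split
begin

lemma sets_nu: "sets \<nu> = sets (torus d)"
  by (simp add: \<nu>_def)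

lemma finite_nu: "finite_measure \<nu>"
  unfolding \<nu>_def by (rule finite_measure.finite_measure_distr[OF finite_tauG]) measurable

lemma freq_norm_pos:
  assumes "\<not> (\<forall>k<d. \<xi> k = 0)"
  shows "0 < freq_norm d \<xi>"
proof -
  obtain k where k: "k < d" "\<xi> k \<noteq> 0" using assms by auto
  have "0 < (real_of_int (\<xi> k))\<^sup>2" using k by simp
  also have "\<dots> \<le> (\<Sum>k<d. (real_of_int (\<xi> k))\<^sup>2)" using k by (intro member_le_sum) auto
  finally show ?thesis by (simp add: freq_norm_def)
qed

text \<open>\<open>Gamma a * W - low + q\<close> has the Fourier coefficients of
  \<open>\<nu>\<close> and therefore acts on sets as that positive measure of mass q. Its integral
  over A lies between 0 and q without any pointwise information on W, and \<open>low\<close>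
  contributes at most \<Lambda> times the measure of A.\<close>

lemma riesz_level:
  assumes W: "is_riesz_kernel d s W" and A: "A \<in> sets (torus d)"
  shows "\<bar>Gamma a * (\<integral>x. W x * indicator A x \<partial>torus d)\<bar> \<le> \<epsilon> powr a / a + \<Lambda> * measure (torus d) A"
proof -
  have Wint: "integrable (torus d) W" using W by (simp add: is_riesz_kernel_def)
  have FW: "(\<integral>x. W x *\<^sub>R character d \<xi> x \<partial>torus d)
      = (if \<forall>k<d. \<xi> k = 0 then 0 else of_real (freq_norm d \<xi> powr (s - real d)))" for \<xi>
    using W by (simp add: is_riesz_kernel_def fourier_coeff_def character_def scaleR_conv_of_real)
  interpret nu: finite_measure \<nu> by (rule finite_nu)
  \<comment> \<open>W and \<open>low\<close> have mean zero while \<open>\<nu>\<close> has mass q;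
    the constant q repairs the zero frequency and leaves the others unchanged.\<close>
  define f where "f x = Gamma a * W x - low x + q" for x
  have fint: "integrable (torus d) f"
    unfolding f_def using Wint low_integrable by simp
  have char: "integrable (torus d) (\<lambda>x. h x *\<^sub>R character d \<xi> x)" if "integrable (torus d) h" for h :: "(nat \<Rightarrow> real) \<Rightarrow> real" and \<xi>
    by (rule integrable_times_bounded[OF that, where K = 1]) (auto simp: norm_character)
  interpret F: same_fourier d "torus d" \<nu> f "\<lambda>_. 1"
  proof
    show "integrable \<nu> (\<lambda>_. 1 :: real)" by simp
    fix \<xi>
    let ?z = "\<forall>k<d. \<xi> k = 0" and ?l = "(freq_norm d \<xi>)\<^sup>2"
    have one: "integrable (torus d) (\<lambda>x. character d \<xi> x)"
      using char[of "\<lambda>_. 1" \<xi>] by simp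
    have "f x *\<^sub>R character d \<xi> x = of_real (Gamma a) * (W x *\<^sub>R character d \<xi> x) - low x *\<^sub>R character d \<xi> x
        + of_real q * character d \<xi> x" for x
      by (simp add: f_def scaleR_conv_of_real algebra_simps)
    then have "(\<integral>x. f x *\<^sub>R character d \<xi> x \<partial>torus d) = of_real (Gamma a) * (\<integral>x. W x *\<^sub>R character d \<xi> x \<partial>torus d)
        - (\<integral>x. low x *\<^sub>R character d \<xi> x \<partial>torus d) + of_real q * (\<integral>x. character d \<xi> x \<partial>torus d)"
      using char[OF Wint, of \<xi>] char[OF low_integrable, of \<xi>] one by (simp del: mult_scaleR_right)
    also have "\<dots> = (\<integral>x. character d \<xi> x \<partial>\<nu>)"
    proof (cases ?z)
      case True
      then have "freq_norm d \<xi> = 0" by (simp add: freq_norm_def)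
      then show ?thesis
        unfolding FW fourier_low fourier_nu integral_character using True by (simp add: q_def)
    next
      case False
      have n: "0 < freq_norm d \<xi>" by (rule freq_norm_pos[OF False])
      then have l: "0 < ?l" by simp
      let ?g = "\<lambda>t. t powr (a - 1) * exp (- t * ?l)"
      note G = Gamma_scaled[OF a_pos l]
      have Gi: "integrable lborel (\<lambda>t. indicator {0..} t * ?g t)" using G by (simp add: has_bochner_integral_iff)
      have i1: "integrable lborel (\<lambda>t. indicator {0..<\<epsilon>} t * ?g t)"
        by (rule Bochner_Integration.integrable_bound[OF Gi]) (auto split: split_indicator)
      have i2: "integrable lborel (\<lambda>t. indicator {\<epsilon>..} t * ?g t)"
        by (rule Bochner_Integration.integrable_bound[OF Gi]) (use eps in \<open>auto split: split_indicator\<close>)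
      have "(\<integral>t. indicator {0..} t * ?g t \<partial>lborel) = (\<integral>t. indicator {0..<\<epsilon>} t * ?g t + indicator {\<epsilon>..} t * ?g t \<partial>lborel)"
        using eps by (intro Bochner_Integration.integral_cong) (auto split: split_indicator)
      also have "\<dots> = (\<integral>t. indicator {0..<\<epsilon>} t * ?g t \<partial>lborel) + (\<integral>t. indicator {\<epsilon>..} t * ?g t \<partial>lborel)"
        by (rule Bochner_Integration.integral_add[OF i1 i2])
      finally have split: "Gamma a * ?l powr (- a) - (\<integral>t. indicator {\<epsilon>..} t * ?g t \<partial>lborel) = (\<integral>t. indicator {0..<\<epsilon>} t * ?g t \<partial>lborel)"
        using G by (simp add: has_bochner_integral_iff)
      have "?l = freq_norm d \<xi> powr 2" using n by (simp add: powr_numeral)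
      moreover have "2 * (- a) = s - real d" by (simp add: a_def field_simps)
      ultimately have "?l powr (- a) = freq_norm d \<xi> powr (s - real d)"
        by (simp only: powr_powr)
      then show ?thesis
        unfolding FW fourier_low fourier_nu integral_character split[symmetric] if_not_P[OF False]
        by simp
    qed
    finally show "(\<integral>x. f x *\<^sub>R character d \<xi> x \<partial>torus d) = (\<integral>x. 1 *\<^sub>R character d \<xi> x \<partial>\<nu>)" by simp
  qed (use sets_nu fint in auto)
  have pos: "0 \<le> (\<integral>x. f x * indicator B x \<partial>torus d)" if "B \<in> sets (torus d)" for B
    unfolding F.integral_indicator_eq[OF that] by (intro integral_nonneg_AE) auto
  have ind: "integrable (torus d) (\<lambda>x. h x * indicator B x)" if "integrable (torus d) h" "B \<in> sets (torus d)" for h :: "(nat \<Rightarrow> real) \<Rightarrow> real" and B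
    using integrable_times_bounded[OF that(1), of "\<lambda>x. indicator B x :: real" 1] that(2) by (simp add: indicator_def)
  have "(\<integral>x. f x \<partial>torus d) = q"
  proof -
    have "(\<integral>x. W x \<partial>torus d) = 0"
    proof -
      have "(\<integral>x. W x *\<^sub>R (1::complex) \<partial>torus d) = 0" using FW[of "\<lambda>_. 0"] by (simp add: character_def)
      then show ?thesis by (simp add: scaleR_conv_of_real)
    qed
    moreover have "(\<integral>x. low x \<partial>torus d) = 0"
    proof -
      have "(\<integral>x. low x *\<^sub>R (1::complex) \<partial>torus d) = 0"
        using fourier_low[of "\<lambda>_. 0"] by (simp add: character_def freq_norm_def)
      then show ?thesis by (simp add: scaleR_conv_of_real)
    qed
    ultimately show ?thesis
      using Wint low_integrable by (simp add: f_def T.prob_space)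
  qed
  moreover have "(\<integral>x. f x \<partial>torus d) = (\<integral>x. f x * indicator A x \<partial>torus d) + (\<integral>x. f x * indicator (space (torus d) - A) x \<partial>torus d)"
  proof -
    have "space (torus d) - A \<in> sets (torus d)" using A by auto
    from Bochner_Integration.integral_add[OF ind[OF fint A] ind[OF fint this]]
    have "(\<integral>x. f x * indicator A x + f x * indicator (space (torus d) - A) x \<partial>torus d)
        = (\<integral>x. f x * indicator A x \<partial>torus d) + (\<integral>x. f x * indicator (space (torus d) - A) x \<partial>torus d)" .
    moreover have "(\<integral>x. f x \<partial>torus d) = (\<integral>x. f x * indicator A x + f x * indicator (space (torus d) - A) x \<partial>torus d)"
      by (intro Bochner_Integration.integral_cong) (auto split: split_indicator)
    ultimately show ?thesis by simp
  qed
  ultimately have fA: "0 \<le> (\<integral>x. f x * indicator A x \<partial>torus d)" "(\<integral>x. f x * indicator A x \<partial>torus d) \<le> q"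
    using pos[OF A] pos[of "space (torus d) - A"] A by auto
  have oneA: "integrable (torus d) (\<lambda>x. indicator A x :: real)" "(\<integral>x. indicator A x \<partial>torus d) = measure (torus d) A"
    using A by (auto simp: T.emeasure_eq_measure)
  have lowA: "\<bar>\<integral>x. low x * indicator A x \<partial>torus d\<bar> \<le> \<Lambda> * measure (torus d) A"
  proof -
    have "\<bar>\<integral>x. low x * indicator A x \<partial>torus d\<bar> \<le> (\<integral>x. \<bar>low x * indicator A x\<bar> \<partial>torus d)"
      by (rule integral_abs_bound)
    also have "\<dots> \<le> (\<integral>x. \<Lambda> * indicator A x \<partial>torus d)"
      using ind[OF low_integrable A] oneA low_bound by (intro integral_mono) (auto split: split_indicator)
    finally show ?thesis using oneA by simp
  qed
  have "f x * indicator A x = Gamma a * (W x * indicator A x) - low x * indicator A x + q * indicator A x" for x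
    by (simp add: f_def algebra_simps)
  then have eq: "(\<integral>x. f x * indicator A x \<partial>torus d) = Gamma a * (\<integral>x. W x * indicator A x \<partial>torus d)
      - (\<integral>x. low x * indicator A x \<partial>torus d) + q * measure (torus d) A"
    using ind[OF Wint A] ind[OF low_integrable A] oneA by simp
  \<comment> \<open>The integral of f over A and q times the measure of A both lie in [0, q], so
    their difference costs q only once.\<close>
  have "0 \<le> q * measure (torus d) A" "q * measure (torus d) A \<le> q"
    using q_bounds(1) T.prob_le_1[of A] by (auto intro: mult_left_le)
  then have "\<bar>Gamma a * (\<integral>x. W x * indicator A x \<partial>torus d)\<bar> \<le> q + \<Lambda> * measure (torus d) A"
    using fA lowA eq by linarith
  then show ?thesis using q_bounds(2) by linarith
qed

end

text \<open>The level bound is optimised in the cut-off. At height t the low-frequency part is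
  absorbed once \<epsilon> is of order t^(-2/s), and what remains is \<epsilon>^a / t, of order
  t^(-2a/s - 1) = t^(-d/s). Since B is quantified before W, the constants in (iii) depend on d and s
  only.\<close>

lemma riesz_weak_type:
  assumes s: "0 < s" "s < real d"
  shows "\<exists>B\<ge>0. \<forall>W. is_riesz_kernel d s W \<longrightarrow>
    (\<forall>t>0. measure (torus d) {x\<in>space (torus d). \<bar>W x\<bar> > t} \<le> B * t powr (- (real d / s)))"
proof -
  interpret T: prob_space "torus d" by (rule prob_space_torus)
  obtain K where K: "0 < K" "\<And>t x. 0 < t \<Longrightarrow> \<bar>heat d t x - 1\<bar> \<le> K * t powr (- (real d / 2))"
    using heat_bound by blast
  define a where "a = (real d - s) / 2"
  have a: "0 < a" using s by (simp add: a_def)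
  define G where "G = (Gamma a :: real)"
  have G: "0 < G" unfolding G_def using a by (rule Gamma_real_pos)
  \<comment> \<open>The solution of K * (2 / s) * c = G / 2.\<close>
  define c where "c = G * s / (4 * K)"
  have c: "0 < c" using G s K by (simp add: c_def)
  define B where "B = 2 * (2 / (G * a) * c powr (- (2 * a / s)))"
  have level: "measure (torus d) A \<le> B / 2 * t powr (- (real d / s))"
    if W: "is_riesz_kernel d s W" and t: "0 < t" and A: "A \<in> sets (torus d)"
      and At: "t * measure (torus d) A \<le> \<bar>\<integral>x. W x * indicator A x \<partial>torus d\<bar>" for W t A
  proof -
    \<comment> \<open>The choice of \<open>\<epsilon>\<close> makes the bound on the low-frequency part half of \<open>G * t\<close>.\<close>
    define \<epsilon> where "\<epsilon> = (c * t) powr (- (2 / s))"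
    interpret R: riesz_split d s K \<epsilon>
      using s K c t by unfold_locales (auto simp: \<epsilon>_def)
    have Ra: "R.a = a" by (simp add: R.a_def a_def)
    have "\<epsilon> powr (- (s / 2)) = c * t"
      using s c t by (simp add: \<epsilon>_def powr_powr)
    then have L: "R.\<Lambda> = G * t / 2" using s K by (simp add: R.\<Lambda>_def c_def field_simps)
    have ea: "\<epsilon> powr a = (c * t) powr (- (2 * a / s))"
      by (simp add: \<epsilon>_def powr_powr)
    have "G * (t * measure (torus d) A) \<le> G * \<bar>\<integral>x. W x * indicator A x \<partial>torus d\<bar>"
      using At G by (intro mult_left_mono) auto
    also have "\<dots> \<le> \<epsilon> powr a / a + G * t / 2 * measure (torus d) A"
      using R.riesz_level[OF W A] G unfolding Ra L G_def[symmetric] by (simp add: abs_mult)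
    finally have "G * t * measure (torus d) A \<le> 2 * (\<epsilon> powr a / a)" by simp
    then have "measure (torus d) A \<le> 2 / (G * a) * ((c * t) powr (- (2 * a / s)) / t)"
      using G t a unfolding ea by (simp add: field_simps)
    also have "(c * t) powr (- (2 * a / s)) / t = c powr (- (2 * a / s)) * t powr (- (real d / s))"
    proof -
      have e: "- (2 * a / s) + - 1 = - (real d / s)" using s by (simp add: a_def field_simps)
      have "(c * t) powr (- (2 * a / s)) / t = c powr (- (2 * a / s)) * (t powr (- (2 * a / s)) * t powr (- 1))"
        using c t by (simp add: powr_mult powr_minus_divide)
      then show ?thesis by (simp only: powr_add[symmetric] e)
    qed
    finally show ?thesis by (simp add: B_def)
  qed
  have "measure (torus d) {x\<in>space (torus d). \<bar>W x\<bar> > t} \<le> B * t powr (- (real d / s))"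
    if W: "is_riesz_kernel d s W" and t: "0 < t" for W t
  proof -
    have Wint: "integrable (torus d) W" using W by (simp add: is_riesz_kernel_def)
    then have [measurable]: "W \<in> borel_measurable (torus d)" by auto
    \<comment> \<open>The two signs are treated separately: on each set W has a fixed sign, so the
      absolute value of its integral dominates t times the measure. This is why \<open>level\<close>
      is stated with B / 2.\<close>
    let ?P = "{x\<in>space (torus d). W x > t}" and ?N = "{x\<in>space (torus d). W x < - t}"
    have m: "?P \<in> sets (torus d)" "?N \<in> sets (torus d)" by measurable
    have int: "integrable (torus d) (\<lambda>x. W x * indicator A x)" if "A \<in> sets (torus d)" for A
      using integrable_times_bounded[OF Wint, of "\<lambda>x. indicator A x :: real" 1] that by (simp add: indicator_def)
    have const: "integrable (torus d) (\<lambda>x. t * indicator A x)" "(\<integral>x. t * indicator A x \<partial>torus d) = t * measure (torus d) A"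
      if "A \<in> sets (torus d)" for A
      using that by (auto simp: T.emeasure_eq_measure)
    have "t * measure (torus d) ?P \<le> (\<integral>x. W x * indicator ?P x \<partial>torus d)"
      unfolding const(2)[OF m(1), symmetric]
      by (intro integral_mono const int m) (auto split: split_indicator)
    then have 1: "measure (torus d) ?P \<le> B / 2 * t powr (- (real d / s))"
      by (intro level[OF W t m(1)]) linarith
    have "t * measure (torus d) ?N \<le> (\<integral>x. - (W x * indicator ?N x) \<partial>torus d)"
      unfolding const(2)[OF m(2), symmetric]
      by (intro integral_mono const int m integrable_minus) (auto split: split_indicator)
    then have 2: "measure (torus d) ?N \<le> B / 2 * t powr (- (real d / s))"
      by (intro level[OF W t m(2)]) simp
    have "{x\<in>space (torus d). \<bar>W x\<bar> > t} = ?P \<union> ?N" by auto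
    then have "measure (torus d) {x\<in>space (torus d). \<bar>W x\<bar> > t} \<le> measure (torus d) ?P + measure (torus d) ?N"
      using m by (simp add: measure_Un_le)
    with 1 2 show ?thesis by (simp add: field_simps)
  qed
  moreover have "0 \<le> B" using G a by (simp add: B_def)
  ultimately show ?thesis by blast
qed

text \<open>The first unit frequency has norm 1, hence coefficient 1 whatever s is, and coefficients
  are bounded by the L1 norm. With the smallness condition this forces \<beta> \<le> 1.\<close>

lemma riesz_L1_norm_ge_1:
  assumes "1 \<le> d" "is_riesz_kernel d s W"
  shows "1 \<le> L1_norm (torus d) W"
proof -
  define \<xi> :: "nat \<Rightarrow> int" where "\<xi> k = (if k = 0 then 1 else 0)" for k
  have "(\<Sum>k<d. (real_of_int (\<xi> k))\<^sup>2) = (\<Sum>k<d. if k = 0 then 1 else 0)"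
    by (intro sum.cong) (auto simp: \<xi>_def)
  then have n: "freq_norm d \<xi> = 1" using assms(1) by (simp add: freq_norm_def)
  have "\<not> (\<forall>k<d. \<xi> k = 0)" using assms(1) by (auto simp: \<xi>_def)
  then have "fourier_coeff d W \<xi> = 1" using assms(2) n by (simp add: is_riesz_kernel_def)
  then have "1 = norm (fourier_coeff d W \<xi>)" by simp
  also have "\<dots> \<le> (\<integral>x. norm (complex_of_real (W x) * cis (- 2 * pi * (\<Sum>k<d. real_of_int (\<xi> k) * x k))) \<partial>torus d)"
    unfolding fourier_coeff_def by (rule integral_norm_bound)
  also have "\<dots> = L1_norm (torus d) W" by (simp add: L1_norm_def norm_mult)
  finally show ?thesis .
qed

section \<open>Bounds on the partition function\<close>

locale small_potential =
  fixes d N :: nat and W :: "(nat \<Rightarrow> real) \<Rightarrow> real" and \<beta> :: real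
  assumes beta: "0 < \<beta>" and N: "1 \<le> N" and W: "admissible_potential d W"
    and small: "\<beta> * (L1_norm (torus d) W + Linf_norm (torus d) (neg_part W)) \<le> 1 / 128"
begin

sublocale T: prob_space "torus d" by (rule prob_space_torus)

lemma W_measurable [measurable]: "W \<in> borel_measurable (torus d)"
  using W by (auto simp: admissible_potential_def)

lemma lower: "1 \<le> partition_function d W N \<beta>"
  by (rule partition_function_bounds(1)[OF W beta N small])

lemma upper:
  assumes "(\<integral>x. quad_lin (\<beta> * W x / real N) \<partial>torus d) \<le> R"
  shows "partition_function d W N \<beta> \<le> exp (129 * (real N)\<^sup>2 * R)"
  by (rule order_trans[OF partition_function_bounds(2)[OF W beta N small]])
    (use assms in \<open>simp add: mult_left_mono\<close>)

lemma scaled_measurable: "(\<lambda>x. \<beta> * W x / real N) \<in> borel_measurable (torus d)"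
  by measurable

lemma scaled_level:
  "measure (torus d) {x\<in>space (torus d). \<bar>\<beta> * W x / real N\<bar> > t} = measure (torus d) {x\<in>space (torus d). \<bar>W x\<bar> > t * real N / \<beta>}"
proof -
  have "\<bar>\<beta> * W x / real N\<bar> > t \<longleftrightarrow> \<bar>W x\<bar> > t * real N / \<beta>" for x
    using beta N by (simp add: abs_mult field_simps)
  then show ?thesis by simp
qed

lemma L2_upper:
  assumes "in_L2 (torus d) W"
  shows "partition_function d W N \<beta> \<le> exp (129 * \<beta>\<^sup>2 * (L2_norm (torus d) W)\<^sup>2)"
proof -
  have sq: "integrable (torus d) (\<lambda>x. (\<beta> / real N)\<^sup>2 * (W x)\<^sup>2)"
    using assms by (intro integrable_mult_right) (simp add: in_L2_def)
  have le: "quad_lin (\<beta> * W x / real N) \<le> (\<beta> / real N)\<^sup>2 * (W x)\<^sup>2" for x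
    unfolding quad_lin_def by (rule order_trans[OF min.cobounded1]) (simp add: power_mult_distrib power_divide)
  have "integrable (torus d) (\<lambda>x. quad_lin (\<beta> * W x / real N))"
    by (rule Bochner_Integration.integrable_bound[OF sq])
      (use le quad_lin_nonneg in \<open>auto intro!: AE_I2 order_trans[OF le]\<close>)
  then have "(\<integral>x. quad_lin (\<beta> * W x / real N) \<partial>torus d) \<le> (\<integral>x. (\<beta> / real N)\<^sup>2 * (W x)\<^sup>2 \<partial>torus d)"
    by (intro integral_mono sq le)
  also have "\<dots> = (\<beta> / real N)\<^sup>2 * (L2_norm (torus d) W)\<^sup>2"
    by (simp add: L2_norm_def)
  finally show ?thesis using upper[of "(\<beta> / real N)\<^sup>2 * (L2_norm (torus d) W)\<^sup>2"] N
    by (simp add: power_divide mult.assoc)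
qed

lemma partition_function_1: "N = 1 \<Longrightarrow> partition_function d W N \<beta> = 1"
proof -
  interpret P: prob_space "PiM {1..N} (\<lambda>_. torus d)" by (intro prob_space_PiM prob_space_torus)
  assume "N = 1"
  then show ?thesis using P.prob_space by (simp add: partition_function_def)
qed

lemma weak_2_upper:
  assumes B: "0 \<le> B" and weak: "\<And>t. 0 < t \<Longrightarrow> measure (torus d) {x\<in>space (torus d). \<bar>W x\<bar> > t} \<le> B / t\<^sup>2"
    and C: "exp 258 + 1548 \<le> C"
  shows "partition_function d W N \<beta> \<le> C * real N powr (C * \<beta>\<^sup>2 * B)"
proof (cases "N = 1")
  \<comment> \<open>\<open>ln N + 1\<close> is bounded by a multiple of \<open>ln N\<close> only for $N \ge 2$.\<close>
  case True
  moreover have "1 \<le> C" using C exp_gt_zero[of "258 :: real"] by linarith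
  ultimately show ?thesis using partition_function_1 by simp
next
  case False
  then have N2: "2 \<le> real N" using N by linarith
  have "ln 2 \<le> ln (real N)" using N2 by simp
  moreover have "(1 / 2 :: real) \<le> ln 2" using ln2_ge_two_thirds by linarith
  ultimately have lnN: "1 / 2 \<le> ln (real N)" by linarith
  \<comment> \<open>The cut is taken at h = 1 / N, so that the first term is constant after
    multiplication by N^2.\<close>
  have "(\<integral>x. quad_lin (\<beta> * W x / real N) \<partial>torus d)
      \<le> 2 * (1 / real N)\<^sup>2 + 4 * (B * (\<beta> / real N)\<^sup>2) * (ln (1 / (1 / real N)) + 1)"
  proof (rule T.quad_lin_weak_2[OF scaled_measurable])
    fix t :: real assume t: "0 < t"
    have "measure (torus d) {x\<in>space (torus d). \<bar>W x\<bar> > t * real N / \<beta>} \<le> B / (t * real N / \<beta>)\<^sup>2"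
      using t N beta by (intro weak) simp
    also have "\<dots> = B * (\<beta> / real N)\<^sup>2 / t\<^sup>2" by (simp add: power_divide power_mult_distrib)
    finally show "measure (torus d) {x\<in>space (torus d). \<bar>\<beta> * W x / real N\<bar> > t} \<le> B * (\<beta> / real N)\<^sup>2 / t\<^sup>2"
      by (simp only: scaled_level)
  qed (use B N in auto)
  also have "2 * (1 / real N)\<^sup>2 + 4 * (B * (\<beta> / real N)\<^sup>2) * (ln (1 / (1 / real N)) + 1)
      = (2 + 4 * (B * \<beta>\<^sup>2) * (ln (real N) + 1)) / (real N)\<^sup>2"
    by (simp add: power_divide add_divide_distrib)
  finally have "(\<integral>x. quad_lin (\<beta> * W x / real N) \<partial>torus d)
      \<le> (2 + 4 * (B * \<beta>\<^sup>2) * (ln (real N) + 1)) / (real N)\<^sup>2" .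
  from upper[OF this]
  have "partition_function d W N \<beta> \<le> exp (129 * (2 + 4 * (B * \<beta>\<^sup>2) * (ln (real N) + 1)))"
    using N by simp
  \<comment> \<open>Here 258 = 129 * 2 and 1548 = 129 * 4 * 3, with ln N + 1 \<le> 3 ln N because ln
    N \<ge> 1/2.\<close>
  also have "\<dots> \<le> exp (258 + 1548 * \<beta>\<^sup>2 * B * ln (real N))"
  proof -
    have "(B * \<beta>\<^sup>2) * (ln (real N) + 1) \<le> (B * \<beta>\<^sup>2) * (3 * ln (real N))"
      using lnN B by (intro mult_left_mono) auto
    then show ?thesis by (simp add: algebra_simps)
  qed
  also have "\<dots> = exp 258 * real N powr (1548 * \<beta>\<^sup>2 * B)"
    using N2 by (simp add: exp_add powr_def)
  also have "\<dots> \<le> C * real N powr (C * \<beta>\<^sup>2 * B)"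
  proof -
    have "1548 \<le> C" "exp 258 \<le> C" "0 \<le> C" using C exp_gt_zero[of "258 :: real"] by linarith+
    then show ?thesis using B N2 by (intro mult_mono powr_mono mult_right_mono) auto
  qed
  finally show ?thesis .
qed

lemma scaled_weak:
  assumes weak: "\<And>t. 0 < t \<Longrightarrow> measure (torus d) {x\<in>space (torus d). \<bar>W x\<bar> > t} \<le> B * t powr (- p)"
    and t: "0 < t"
  shows "measure (torus d) {x\<in>space (torus d). \<bar>\<beta> * W x / real N\<bar> > t} \<le> (B * \<beta> powr p * real N powr (- p)) * t powr (- p)"
proof -
  have "measure (torus d) {x\<in>space (torus d). \<bar>W x\<bar> > t * real N / \<beta>} \<le> B * (t * real N / \<beta>) powr (- p)"
    using t N beta by (intro weak) simp
  also have "(t * real N / \<beta>) powr (- p) = t powr (- p) * real N powr (- p) * \<beta> powr p"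
    using t N beta by (simp add: powr_divide powr_mult powr_minus field_simps)
  finally show ?thesis by (simp only: scaled_level mult_ac)
qed

text \<open>The factor N^2 from the number of pairs meets N^(-p) from scaling W by \<beta> / N in
  the weak bound; this produces the power 2 - p, positive in this range.\<close>

lemma weak_lt2_upper:
  assumes B: "0 \<le> B" and p: "1 < p" "p < 2"
    and weak: "\<And>t. 0 < t \<Longrightarrow> measure (torus d) {x\<in>space (torus d). \<bar>W x\<bar> > t} \<le> B * t powr (- p)"
  shows "partition_function d W N \<beta>
    \<le> exp (516 * B * (1 / (2 - p) + 1 / (p - 1)) * \<beta> powr p * real N powr (2 - p))"
proof -
  define S where "S = 1 / (2 - p) + 1 / (p - 1)"
  have "(\<integral>x. quad_lin (\<beta> * W x / real N) \<partial>torus d) \<le> 4 * (B * \<beta> powr p * real N powr (- p)) * S"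
    unfolding S_def using B p scaled_weak[OF weak] by (intro T.quad_lin_weak_lt2[OF scaled_measurable]) auto
  from upper[OF this] have "partition_function d W N \<beta>
    \<le> exp (516 * B * S * \<beta> powr p * ((real N)\<^sup>2 * real N powr (- p)))"
    by (simp add: mult_ac)
  also have "(real N)\<^sup>2 * real N powr (- p) = real N powr (2 - p)"
    using N by (simp add: powr_numeral[symmetric] powr_add[symmetric] del: powr_numeral)
  finally show ?thesis by (simp only: S_def)
qed

text \<open>With the cut h = 1 / N both terms become independent of N: N^2 h^2 = 1 and N^2 N^(-p)
  h^(2-p) = 1. The remaining power of \<beta> is at most 1.\<close>

lemma weak_gt2_upper:
  assumes B: "0 \<le> B" and p: "2 < p" and b1: "\<beta> \<le> 1"
    and weak: "\<And>t. 0 < t \<Longrightarrow> measure (torus d) {x\<in>space (torus d). \<bar>W x\<bar> > t} \<le> B * t powr (- p)"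
  shows "partition_function d W N \<beta> \<le> exp (258 + 516 * B / (p - 2))"
proof -
  have "(\<integral>x. quad_lin (\<beta> * W x / real N) \<partial>torus d) \<le> 2 * (1 / real N)\<^sup>2
      + 4 * (B * \<beta> powr p * real N powr (- p)) * ((1 / real N) powr (2 - p) / (p - 2))"
    using B p N scaled_weak[OF weak] by (intro T.quad_lin_weak_gt2[OF scaled_measurable]) auto
  from upper[OF this] have "partition_function d W N \<beta> \<le> exp (129 * (real N)\<^sup>2 * (2 * (1 / real N)\<^sup>2
      + 4 * (B * \<beta> powr p * real N powr (- p)) * ((1 / real N) powr (2 - p) / (p - 2))))" .
  also have "129 * (real N)\<^sup>2 * (2 * (1 / real N)\<^sup>2
      + 4 * (B * \<beta> powr p * real N powr (- p)) * ((1 / real N) powr (2 - p) / (p - 2)))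
    = 258 * ((real N)\<^sup>2 * (1 / real N)\<^sup>2)
      + 516 * B / (p - 2) * \<beta> powr p * ((real N)\<^sup>2 * (real N powr (- p) * (1 / real N) powr (2 - p)))"
    by (simp add: distrib_left mult_ac)
  also have "(real N)\<^sup>2 * (1 / real N)\<^sup>2 = 1" using N by (simp add: power_one_over)
  also have "(real N)\<^sup>2 * (real N powr (- p) * (1 / real N) powr (2 - p)) = 1"
  proof -
    have "(1 / real N) powr (2 - p) = real N powr (p - 2)"
      using N by (simp add: powr_divide powr_minus_divide[symmetric])
    moreover have "(real N)\<^sup>2 = real N powr 2" using N by simp
    ultimately show ?thesis using N by (simp add: powr_add[symmetric] del: powr_numeral)
  qed
  also have "exp (258 * 1 + 516 * B / (p - 2) * \<beta> powr p * 1) \<le> exp (258 + 516 * B / (p - 2))"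
  proof -
    have "\<beta> powr p \<le> 1" using beta b1 p powr_mono2[of p \<beta> 1] by simp
    then have "516 * B / (p - 2) * \<beta> powr p \<le> 516 * B / (p - 2) * 1"
      using B p by (intro mult_left_mono) auto
    then show ?thesis by simp
  qed
  finally show ?thesis .
qed

lemma beta_le_1:
  assumes "1 \<le> d" "is_riesz_kernel d s W"
  shows "\<beta> \<le> 1"
proof -
  have "\<beta> * 1 \<le> \<beta> * (L1_norm (torus d) W + Linf_norm (torus d) (neg_part W))"
    using riesz_L1_norm_ge_1[OF assms] T.Linf_norm_nonneg[of "neg_part W"] beta
    by (intro mult_left_mono) auto
  with small show ?thesis by simp
qed

text \<open>One constant has to serve all three regimes, so it dominates the sum of their constants.
  Outside its own regime a summand may be negative, and for s = d/2 a denominator vanishes, where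
  the quotient has the value 0; the absolute values make every summand nonnegative.\<close>

lemma riesz_upper:
  assumes d: "1 \<le> d" and s: "0 < s" "s < real d" and R: "is_riesz_kernel d s W" and B: "0 \<le> B"
    and weak: "\<And>t. 0 < t \<Longrightarrow> measure (torus d) {x\<in>space (torus d). \<bar>W x\<bar> > t} \<le> B * t powr (- (real d / s))"
    and C: "exp (258 + \<bar>516 * B / (real d / s - 2)\<bar>) + (exp 258 + 1548) * (1 + B)
      + \<bar>516 * B * (1 / (2 - real d / s) + 1 / (real d / s - 1))\<bar> \<le> C"
  shows "partition_function d W N \<beta> \<le>
    (if s < real d / 2 then C
     else if s = real d / 2 then C * real N powr (C * \<beta>\<^sup>2)
     else C * exp (C * \<beta> powr (real d / s) * real N powr (2 - real d / s)))"
proof -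
  define p where "p = real d / s"
  define X where "X = \<bar>516 * B / (p - 2)\<bar>"
  define Y where "Y = (exp 258 + 1548) * (1 + B)"
  define Z where "Z = \<bar>516 * B * (1 / (2 - p) + 1 / (p - 1))\<bar>"
  have Y: "exp 258 + 1548 \<le> Y"
    unfolding Y_def using B mult_left_mono[of 1 "1 + B" "exp 258 + 1548"] by simp
  have XYZ: "0 \<le> X" "0 \<le> Z" "exp (258 + X) + Y + Z \<le> C"
    unfolding X_def Y_def Z_def p_def by (rule abs_ge_zero C)+
  have "1 \<le> Y" using Y exp_gt_zero[of "258 :: real"] by linarith
  with XYZ have CX: "exp (258 + X) \<le> C" and CY: "Y \<le> C" and CZ: "Z \<le> C" "1 \<le> C"
    using exp_gt_zero[of "258 + X"] by linarith+
  consider "s < real d / 2" | "s = real d / 2" | "real d / 2 < s" by linarith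
  then show ?thesis
  proof cases
    case 1
    then have p: "2 < p" using s by (simp add: p_def field_simps)
    have "partition_function d W N \<beta> \<le> exp (258 + 516 * B / (p - 2))"
      by (rule weak_gt2_upper[OF B p beta_le_1[OF d R] weak[folded p_def]])
    also have "\<dots> \<le> exp (258 + X)"
      unfolding X_def exp_le_cancel_iff by (intro add_left_mono abs_ge_self)
    finally show ?thesis using CX 1 by simp
  next
    case 2
    then have p: "p = 2" using s by (simp add: p_def field_simps)
    have "partition_function d W N \<beta> \<le> (exp 258 + 1548) * real N powr ((exp 258 + 1548) * \<beta>\<^sup>2 * B)"
    proof (rule weak_2_upper[OF B _ order_refl])
      fix t :: real assume t: "0 < t"
      then show "measure (torus d) {x\<in>space (torus d). \<bar>W x\<bar> > t} \<le> B / t\<^sup>2"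
        using weak[OF t, folded p_def] by (simp add: p powr_minus divide_inverse)
    qed
    also have "\<dots> \<le> C * real N powr (C * \<beta>\<^sup>2)"
    proof (rule mult_mono)
      have "(exp 258 + 1548) * B \<le> Y"
        unfolding Y_def by (intro mult_left_mono) (auto intro: add_nonneg_nonneg)
      also note CY
      finally have "(exp 258 + 1548) * B \<le> C" .
      from mult_right_mono[OF this, of "\<beta>\<^sup>2"]
      have "(exp 258 + 1548) * \<beta>\<^sup>2 * B \<le> C * \<beta>\<^sup>2" by (simp add: mult_ac)
      then show "real N powr ((exp 258 + 1548) * \<beta>\<^sup>2 * B) \<le> real N powr (C * \<beta>\<^sup>2)"
        using N by (intro powr_mono) auto
    qed (use Y CY CZ in auto)
    finally show ?thesis using 2 by simp
  next
    case 3
    then have p: "1 < p" "p < 2" using s by (auto simp: p_def field_simps)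
    have "partition_function d W N \<beta> \<le> exp (516 * B * (1 / (2 - p) + 1 / (p - 1)) * \<beta> powr p * real N powr (2 - p))"
      by (rule weak_lt2_upper[OF B p weak[folded p_def]])
    also have "\<dots> \<le> exp (C * \<beta> powr p * real N powr (2 - p))"
      using CZ by (auto simp: Z_def intro!: mult_right_mono)
    also have "\<dots> \<le> C * exp (C * \<beta> powr p * real N powr (2 - p))"
      using CZ by simp
    finally show ?thesis using 3 by (simp add: p_def)
  qed
qed

end

theorem theorem2p1:
  shows "\<exists>c::real. c > 0 \<and> (\<forall>d::nat. d \<ge> 1 \<longrightarrow>
    \<comment> \<open>(i)\<close>
    (\<exists>C::real. C > 0 \<and> (\<forall>\<beta> W.
       \<beta> > 0 \<and> admissible_potential d W \<and>
       \<beta> * (L1_norm (torus d) W + Linf_norm (torus d) (neg_part W)) \<le> c \<and>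
       in_L2 (torus d) W \<longrightarrow>
       (\<forall>N\<ge>1. 1 \<le> partition_function d W N \<beta> \<and>
          partition_function d W N \<beta> \<le> exp (C * \<beta>\<^sup>2 * (L2_norm (torus d) W)\<^sup>2)))) \<and>
    \<comment> \<open>(ii)\<close>
    (\<exists>C::real. C > 0 \<and> (\<forall>\<beta> W.
       \<beta> > 0 \<and> admissible_potential d W \<and>
       \<beta> * (L1_norm (torus d) W + Linf_norm (torus d) (neg_part W)) \<le> c \<and>
       in_weak_L2 (torus d) W \<longrightarrow>
       (\<forall>N\<ge>1. 1 \<le> partition_function d W N \<beta> \<and>
          partition_function d W N \<beta>
            \<le> C * real N powr (C * \<beta>\<^sup>2 * (weak_L2_norm (torus d) W)\<^sup>2)))) \<and>
    \<comment> \<open>(iii)\<close>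
    (\<forall>s::real. 0 < s \<and> s < real d \<longrightarrow>
      (\<exists>C::real. C > 0 \<and> (\<forall>\<beta> W.
         \<beta> > 0 \<and> admissible_potential d W \<and>
         \<beta> * (L1_norm (torus d) W + Linf_norm (torus d) (neg_part W)) \<le> c \<and>
         is_riesz_kernel d s W \<longrightarrow>
         (\<forall>N\<ge>1. 1 \<le> partition_function d W N \<beta> \<and>
            partition_function d W N \<beta> \<le>
              (if s < real d / 2 then C
               else if s = real d / 2 then C * real N powr (C * \<beta>\<^sup>2)
               else C * exp (C * \<beta> powr (real d / s) * real N powr (2 - real d / s))))))))"
proof (rule exI[of _ "1 / 128"], intro conjI allI impI)
  fix d :: nat assume d: "1 \<le> d"
  show "\<exists>C>0. \<forall>\<beta> W. \<beta> > 0 \<and> admissible_potential d W \<and>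
       \<beta> * (L1_norm (torus d) W + Linf_norm (torus d) (neg_part W)) \<le> 1 / 128 \<and> in_L2 (torus d) W \<longrightarrow>
       (\<forall>N\<ge>1. 1 \<le> partition_function d W N \<beta> \<and>
          partition_function d W N \<beta> \<le> exp (C * \<beta>\<^sup>2 * (L2_norm (torus d) W)\<^sup>2))"
  proof (rule exI[of _ 129], intro conjI allI impI; (elim conjE)?)
    fix \<beta> W and N :: nat
    assume A: "\<beta> > 0" "admissible_potential d W"
      "\<beta> * (L1_norm (torus d) W + Linf_norm (torus d) (neg_part W)) \<le> 1 / 128" "1 \<le> N" and L2: "in_L2 (torus d) W"
    interpret small_potential d N W \<beta> by unfold_locales (fact A)+
    show "1 \<le> partition_function d W N \<beta>" by (rule lower)
    show "partition_function d W N \<beta> \<le> exp (129 * \<beta>\<^sup>2 * (L2_norm (torus d) W)\<^sup>2)" by (rule L2_upper[OF L2])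
  qed simp
  show "\<exists>C>0. \<forall>\<beta> W. \<beta> > 0 \<and> admissible_potential d W \<and>
       \<beta> * (L1_norm (torus d) W + Linf_norm (torus d) (neg_part W)) \<le> 1 / 128 \<and> in_weak_L2 (torus d) W \<longrightarrow>
       (\<forall>N\<ge>1. 1 \<le> partition_function d W N \<beta> \<and>
          partition_function d W N \<beta> \<le> C * real N powr (C * \<beta>\<^sup>2 * (weak_L2_norm (torus d) W)\<^sup>2))"
  proof (rule exI[of _ "exp 258 + 1548"], intro conjI allI impI; (elim conjE)?)
    fix \<beta> W and N :: nat
    assume A: "\<beta> > 0" "admissible_potential d W"
      "\<beta> * (L1_norm (torus d) W + Linf_norm (torus d) (neg_part W)) \<le> 1 / 128" "1 \<le> N" and w: "in_weak_L2 (torus d) W"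
    interpret small_potential d N W \<beta> by unfold_locales (fact A)+
    show "1 \<le> partition_function d W N \<beta>" by (rule lower)
    show "partition_function d W N \<beta> \<le> (exp 258 + 1548) * real N powr ((exp 258 + 1548) * \<beta>\<^sup>2 * (weak_L2_norm (torus d) W)\<^sup>2)"
      by (intro weak_2_upper weak_L2_bound[OF w]) auto
  qed (simp add: add_pos_pos)
  fix s :: real assume "0 < s \<and> s < real d"
  then have s: "0 < s" "s < real d" by auto
  obtain B where B: "0 \<le> B" "\<And>W t. is_riesz_kernel d s W \<Longrightarrow> 0 < t \<Longrightarrow>
      measure (torus d) {x\<in>space (torus d). \<bar>W x\<bar> > t} \<le> B * t powr (- (real d / s))"
    using riesz_weak_type[OF s] by blast
  define C where "C = exp (258 + \<bar>516 * B / (real d / s - 2)\<bar>) + (exp 258 + 1548) * (1 + B)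
      + \<bar>516 * B * (1 / (2 - real d / s) + 1 / (real d / s - 1))\<bar>"
  show "\<exists>C>0. \<forall>\<beta> W. \<beta> > 0 \<and> admissible_potential d W \<and>
         \<beta> * (L1_norm (torus d) W + Linf_norm (torus d) (neg_part W)) \<le> 1 / 128 \<and> is_riesz_kernel d s W \<longrightarrow>
         (\<forall>N\<ge>1. 1 \<le> partition_function d W N \<beta> \<and>
            partition_function d W N \<beta> \<le>
              (if s < real d / 2 then C
               else if s = real d / 2 then C * real N powr (C * \<beta>\<^sup>2)
               else C * exp (C * \<beta> powr (real d / s) * real N powr (2 - real d / s))))"
  proof (rule exI[of _ C], intro conjI allI impI; (elim conjE)?)
    show "0 < C" unfolding C_def using B(1) by (intro add_pos_nonneg mult_nonneg_nonneg) auto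
    fix \<beta> W and N :: nat
    assume A: "\<beta> > 0" "admissible_potential d W"
      "\<beta> * (L1_norm (torus d) W + Linf_norm (torus d) (neg_part W)) \<le> 1 / 128" "1 \<le> N" and R: "is_riesz_kernel d s W"
    interpret small_potential d N W \<beta> by unfold_locales (fact A)+
    show "1 \<le> partition_function d W N \<beta>" by (rule lower)
    show "partition_function d W N \<beta> \<le>
              (if s < real d / 2 then C
               else if s = real d / 2 then C * real N powr (C * \<beta>\<^sup>2)
               else C * exp (C * \<beta> powr (real d / s) * real N powr (2 - real d / s)))"
      by (rule riesz_upper[OF d s R B(1) B(2)[OF R]]) (simp_all add: C_def)
  qed
qed simp

end
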